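(* Let $\delta\ge 1$. Assume that there exist a function $\kappa:\mathbb R^{\mathbb N}\to[1,\infty)$ and a sequence $\boldsymbol\beta=(\beta_j)_{j\in\mathbb N}$ of positive functions on $\mathbb R^{\mathbb N}$ such that for every $\boldsymbol y\in\mathbb R^{\mathbb N}$ there is an open neighborhood $U_{\boldsymbol y}$ of $\boldsymbol y$ with $$\|\partial^{\boldsymbol\nu}a(\boldsymbol\xi)\|_{\infty,a(\boldsymbol\xi)^{-1}}\le \kappa(\boldsymbol y)\,\boldsymbol\beta(\boldsymbol y)^{\boldsymbol\nu}(|\boldsymbol\nu|!)^\delta\qquad\forall\boldsymbol\xi\in U_{\boldsymbol y},\ \forall\boldsymbol\nu\in\mathcal F.$$ Let $X\subseteq V$ be a linear subspace, and for $\boldsymbol y\in\mathbb R^{\mathbb N}$ let $u(\boldsymbol y)\in X$ be the solution of $$\int_D a(\boldsymbol y)(\boldsymbol x)\,\nabla u(\boldsymbol y)(\boldsymbol x)\cdot\nabla v(\boldsymbol x)\,d\boldsymbol x=\langle f,v\rangle\qquad\forall v\in X.$$ Then for every $\boldsymbol y\in\mathbb R^{\mathbb N}$ there is an open neighborhood $U_{\boldsymbol y}$ of $\boldsymbol y$ such that for all $\boldsymbol\xi\in U_{\boldsymbol y}$ and all $\boldsymbol\nu\in\mathcal F$ $$\|\partial^{\boldsymbol\nu}u(\boldsymbol\xi)\|_V\le (12\,\kappa(\boldsymbol y)\boldsymbol\beta(\boldsymbol y))^{\boldsymbol\nu}\,\phi_\delta(\boldsymbol\nu)\,\|f\|_{V'}\,\|a(\boldsymbol\xi)^{-1}\|_\infty\le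 (12\,\kappa(\boldsymbol y)\boldsymbol\beta(\boldsymbol y))^{\boldsymbol\nu}\,(|\boldsymbol\nu|!)^\delta\,\|f\|_{V'}\,\|a(\boldsymbol\xi)^{-1}\|_\infty .$$
   Context: $D\subset\mathbb R^d$ is a bounded Lipschitz domain; $V=H^1_0(D)$ with norm $\|v\|_V=\|\nabla v\|_{L^2(D)}$; $V'=H^{-1}(D)$ is its dual with duality pairing $\langle\cdot,\cdot\rangle$; $f\in V'$ is independent of $\boldsymbol y$. For every $\boldsymbol y\in\mathbb R^{\mathbb N}$ the diffusion coefficient $a(\boldsymbol y):D\to\mathbb R$ satisfies $0<a_{\min}(\boldsymbol y)\le a(\boldsymbol y)(\boldsymbol x)\le a_{\max}(\boldsymbol y)<\infty$ for $\boldsymbol x\in D$. The map $\boldsymbol y\mapsto a(\boldsymbol y)\in L^\infty(D)$ is infinitely differentiable, i.e. all partial derivatives $\partial^{\boldsymbol\nu}a$, $\boldsymbol\nu\in\mathcal F$, exist and are continuous on $\mathbb R^{\mathbb N}$ (product topology). $\mathcal F$ is the set of sequences $\boldsymbol\nu=(\nu_j)_{j\in\mathbb N}$ of non-negative integers with only finitely many nonzero entries; $|\boldsymbol\nu|=\sum_j\nu_j$; for a sequence $\boldsymbol R=(R_j)$ of positive numbers, $\boldsymbol R^{\boldsymbol\nu}=\prod_jR_j^{\nu_j}$, and for a scalar $c$, $c\boldsymbol R=(cR_j)_j$. $\partial^{\boldsymbol\nu}$ is the mixed partial derivative with respect to the parameters $\boldsymbol y$, of order $\nu_j$ in $y_j$.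 For a positive function $\lambda$ on $D$, $\|v\|_{\infty,\lambda}=\operatorname{ess\,sup}_{\boldsymbol x\in D}|v(\boldsymbol x)|\lambda(\boldsymbol x)$, and $\|v\|_\infty=\|v\|_{\infty,1}$. $\phi_\delta(\boldsymbol\nu)=\left[\tfrac12\right]_{|\boldsymbol\nu|}(|\boldsymbol\nu|!)^{\delta-1}$, where $\left[\tfrac12\right]_0=1$ and $\left[\tfrac12\right]_m=\left|\prod_{k=0}^{m-1}(\tfrac12-k)\right|$ for $m\ge1$. *)

theory Defs
  imports "HOL-Analysis.Analysis" "HOL-Probability.Essential_Supremum"
begin

text \<open>
  Elements of Lebesgue and Sobolev spaces are represented by functions on the whole ambient
  space of which only the values on \<open>D\<close> matter, up to null sets. All the norms below are
  therefore seminorms on sets of representatives, and limits with respect to them determine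
  their value up to almost everywhere equality on \<open>D\<close>.
\<close>

subsection \<open>Domains\<close>

text \<open>Near each boundary point, after a rotation taking the last coordinate axis to \<open>e\<close>,
  the set \<open>D\<close> is the part lying above the graph of a Lipschitz function of the remaining
  coordinates; \<open>x - (x \<bullet> e) *\<^sub>R e\<close> is the projection to the orthogonal complement of \<open>e\<close>.\<close>

definition lipschitz_boundary :: "'a::euclidean_space set \<Rightarrow> bool" where
  "lipschitz_boundary D \<longleftrightarrow>
     (\<forall>p \<in> frontier D. \<exists>e \<gamma> L r. norm e = 1 \<and> 0 < r \<and>
        L-lipschitz_on {z. z \<bullet> e = 0} (\<gamma> :: 'a \<Rightarrow> real) \<and>
        D \<inter> ball p r = {x \<in> ball p r. \<gamma> (x - (x \<bullet> e) *\<^sub>R e) < x \<bullet> e})"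

definition bounded_lipschitz_domain :: "'a::euclidean_space set \<Rightarrow> bool" where
  "bounded_lipschitz_domain D \<longleftrightarrow>
     open D \<and> connected D \<and> D \<noteq> {} \<and> bounded D \<and> lipschitz_boundary D"

subsection \<open>Test functions\<close>

fun Ck :: "nat \<Rightarrow> ('a::euclidean_space \<Rightarrow> real) \<Rightarrow> bool" where
  "Ck 0 \<phi> \<longleftrightarrow> continuous_on UNIV \<phi>"
| "Ck (Suc k) \<phi> \<longleftrightarrow> (\<forall>x. \<phi> differentiable (at x)) \<and>
     (\<forall>b \<in> Basis. Ck k (\<lambda>x. frechet_derivative \<phi> (at x) b))"

definition test_functions :: "'a::euclidean_space set \<Rightarrow> ('a \<Rightarrow> real) set" where
  "test_functions D = {\<phi>. (\<forall>k. Ck k \<phi>) \<and>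
     compact (closure {x. \<phi> x \<noteq> 0}) \<and> closure {x. \<phi> x \<noteq> 0} \<subseteq> D}"

subsection \<open>Sobolev spaces\<close>

definition L2 :: "'a::euclidean_space set \<Rightarrow> ('a \<Rightarrow> 'b::euclidean_space) set" where
  "L2 D = {v \<in> borel_measurable (lebesgue_on D).
     integrable (lebesgue_on D) (\<lambda>x. (norm (v x))\<^sup>2)}"

definition is_weak_grad :: "'a::euclidean_space set \<Rightarrow> ('a \<Rightarrow> real) \<Rightarrow> ('a \<Rightarrow> 'a) \<Rightarrow> bool" where
  "is_weak_grad D v g \<longleftrightarrow> g \<in> L2 D \<and>
     (\<forall>\<phi> \<in> test_functions D. \<forall>b \<in> Basis.
        (LINT x|lebesgue_on D. v x * frechet_derivative \<phi> (at x) b) =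
        - (LINT x|lebesgue_on D. (g x \<bullet> b) * \<phi> x))"

definition H1 :: "'a::euclidean_space set \<Rightarrow> ('a \<Rightarrow> real) set" where
  "H1 D = {v \<in> L2 D. \<exists>g. is_weak_grad D v g}"

text \<open>The weak gradient is unique almost everywhere on \<open>D\<close>, so the choice is immaterial.
  It is meaningful for \<open>v \<in> H1 D\<close> only.\<close>

definition wgrad :: "'a::euclidean_space set \<Rightarrow> ('a \<Rightarrow> real) \<Rightarrow> 'a \<Rightarrow> 'a" where
  "wgrad D v = (SOME g. is_weak_grad D v g)"

definition H1_norm :: "'a::euclidean_space set \<Rightarrow> ('a \<Rightarrow> real) \<Rightarrow> real" where
  "H1_norm D v =
     sqrt ((LINT x|lebesgue_on D. (v x)\<^sup>2) + (LINT x|lebesgue_on D. (norm (wgrad D v x))\<^sup>2))"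

definition H10 :: "'a::euclidean_space set \<Rightarrow> ('a \<Rightarrow> real) set" where
  "H10 D = {v \<in> H1 D. \<exists>\<phi> :: nat \<Rightarrow> 'a \<Rightarrow> real. (\<forall>n. \<phi> n \<in> test_functions D) \<and>
     (\<lambda>n. H1_norm D (\<lambda>x. \<phi> n x - v x)) \<longlonglongrightarrow> 0}"

definition V_norm :: "'a::euclidean_space set \<Rightarrow> ('a \<Rightarrow> real) \<Rightarrow> real" where
  "V_norm D v = sqrt (LINT x|lebesgue_on D. (norm (wgrad D v x))\<^sup>2)"

text \<open>Linearity and boundedness force a functional to take equal values on representatives
  of the same class.\<close>

definition V_dual :: "'a::euclidean_space set \<Rightarrow> (('a \<Rightarrow> real) \<Rightarrow> real) set" where
  "V_dual D = {f.
     (\<forall>v \<in> H10 D. \<forall>w \<in> H10 D. f (\<lambda>x. v x + w x) = f v + f w) \<and>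
     (\<forall>v \<in> H10 D. \<forall>c. f (\<lambda>x. c * v x) = c * f v) \<and>
     (\<exists>C. \<forall>v \<in> H10 D. \<bar>f v\<bar> \<le> C * V_norm D v)}"

definition V_dual_norm :: "'a::euclidean_space set \<Rightarrow> (('a \<Rightarrow> real) \<Rightarrow> real) \<Rightarrow> real" where
  "V_dual_norm D f = (SUP v \<in> {v \<in> H10 D. V_norm D v \<le> 1}. \<bar>f v\<bar>)"

text \<open>A set of representatives need not be closed under almost everywhere equality; a subspace of
  the space of equivalence classes corresponds to the set of all its representatives.\<close>

definition linear_subspace :: "('x \<Rightarrow> real) set \<Rightarrow> bool" where
  "linear_subspace X \<longleftrightarrow> (\<lambda>x. 0) \<in> X \<and>
     (\<forall>v \<in> X. \<forall>w \<in> X. (\<lambda>x. v x + w x) \<in> X) \<and> (\<forall>v \<in> X. \<forall>c. (\<lambda>x. c * v x) \<in> X)"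

subsection \<open>Weighted essential supremum norms\<close>

definition ess_norm :: "'a::euclidean_space set \<Rightarrow> ('a \<Rightarrow> real) \<Rightarrow> ('a \<Rightarrow> real) \<Rightarrow> ereal" where
  "ess_norm D w v = esssup (lebesgue_on D) (\<lambda>x. ereal (\<bar>v x\<bar> * w x))"

abbreviation sup_norm :: "'a::euclidean_space set \<Rightarrow> ('a \<Rightarrow> real) \<Rightarrow> ereal" where
  "sup_norm D \<equiv> ess_norm D (\<lambda>_. 1)"

definition Linf :: "'a::euclidean_space set \<Rightarrow> ('a \<Rightarrow> real) set" where
  "Linf D = {v \<in> borel_measurable (lebesgue_on D). sup_norm D v < \<infinity>}"

subsection \<open>Multi-indices\<close>

definition multi_indices :: "(nat \<Rightarrow> nat) set" where
  "multi_indices = {\<nu>. finite {j. \<nu> j \<noteq> 0}}"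

definition mi_size :: "(nat \<Rightarrow> nat) \<Rightarrow> nat" where
  "mi_size \<nu> = (\<Sum>j | \<nu> j \<noteq> 0. \<nu> j)"

definition mi_power :: "(nat \<Rightarrow> real) \<Rightarrow> (nat \<Rightarrow> nat) \<Rightarrow> real" where
  "mi_power R \<nu> = (\<Prod>j | \<nu> j \<noteq> 0. R j ^ \<nu> j)"

definition half_ff :: "nat \<Rightarrow> real" where
  "half_ff m = \<bar>\<Prod>k<m. 1/2 - real k\<bar>"

definition phi :: "real \<Rightarrow> (nat \<Rightarrow> nat) \<Rightarrow> real" where
  "phi \<delta> \<nu> = half_ff (mi_size \<nu>) * fact (mi_size \<nu>) powr (\<delta> - 1)"

subsection \<open>Parametric derivatives\<close>

text \<open>Here \<open>g\<close> maps parameters to functions in a space \<open>S\<close> with (semi)norm \<open>N\<close>, and the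
  difference quotients converge with respect to \<open>N\<close>.\<close>

definition has_partial :: "(('x \<Rightarrow> real) \<Rightarrow> ereal) \<Rightarrow> ((nat \<Rightarrow> real) \<Rightarrow> 'x \<Rightarrow> real) \<Rightarrow>
    nat \<Rightarrow> (nat \<Rightarrow> real) \<Rightarrow> ('x \<Rightarrow> real) \<Rightarrow> bool" where
  "has_partial N g j y v \<longleftrightarrow>
     ((\<lambda>h::real. N (\<lambda>x. (g (y(j := y j + h)) x - g y x) / h - v x)) \<longlongrightarrow> 0) (at 0)"

text \<open>The family \<open>dg\<close> consists of the mixed partial derivatives of \<open>g\<close> of all orders: every
  iterated partial derivative exists, and \<open>dg \<nu>\<close> is the result of differentiating \<open>\<nu> j\<close> times in
  each coordinate \<open>j\<close>, in whatever order.\<close>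

definition mixed_partials :: "('x \<Rightarrow> real) set \<Rightarrow> (('x \<Rightarrow> real) \<Rightarrow> ereal) \<Rightarrow>
    ((nat \<Rightarrow> real) \<Rightarrow> 'x \<Rightarrow> real) \<Rightarrow> ((nat \<Rightarrow> nat) \<Rightarrow> (nat \<Rightarrow> real) \<Rightarrow> 'x \<Rightarrow> real) \<Rightarrow> bool" where
  "mixed_partials S N g dg \<longleftrightarrow> dg (\<lambda>_. 0) = g \<and>
     (\<forall>\<nu> \<in> multi_indices. \<forall>y. dg \<nu> y \<in> S) \<and>
     (\<forall>\<nu> \<in> multi_indices. \<forall>j y. has_partial N (dg \<nu>) j y (dg (\<nu>(j := Suc (\<nu> j))) y))"

text \<open>The filter \<open>at y\<close> on the type \<open>nat \<Rightarrow> real\<close> refers to the product topology.\<close>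

definition param_continuous ::
    "(('x \<Rightarrow> real) \<Rightarrow> ereal) \<Rightarrow> ((nat \<Rightarrow> real) \<Rightarrow> 'x \<Rightarrow> real) \<Rightarrow> bool" where
  "param_continuous N g \<longleftrightarrow> (\<forall>y. ((\<lambda>\<xi>. N (\<lambda>x. g \<xi> x - g y x)) \<longlongrightarrow> 0) (at y))"

end

theory Submission
  imports Defs
begin

text \<open>
  Identify \<open>v \<in> H10 D\<close> with its weak gradient in the Hilbert space of square integrable vector
  fields; by the Poincare inequality the image of \<open>H10 D\<close> is closed. Let \<open>M\<close> be the closure of the
  image of \<open>X\<close>. Differentiating the variational equation formally with the Leibniz rule expresses
  \<open>a\<close> applied to \<open>\<partial>\<^sup>\<nu> u\<close> through lower derivatives of \<open>u\<close>, and Riesz representation on \<open>M\<close> turns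
  this into a recursive definition of the derivatives. Coercivity bounds the remainder of the
  difference quotients, so these are indeed the partial derivatives.

  For the estimate, test the differentiated equation with \<open>\<partial>\<^sup>\<nu> u\<close> itself in the energy norm
  \<open>\<integral> a |\<nabla> v|\<^sup>2\<close>, in which the weighted bounds on \<open>\<partial>\<^sup>\<nu> a\<close> are operator bounds. The resulting recursion
  is dominated by the numbers \<open>b n = [1/2]\<^sub>n / n!\<close>, because
  \<open>(\<Sum>k=1..n. b (n - k) / 12 ^ k) \<le> b n\<close>; this follows from \<open>b n \<le> 4 * b (n + 1)\<close>.
\<close>

subsection \<open>Multi-indices and the Leibniz rule\<close>

text \<open>The energy norm at the current parameter keeps the estimate free of the contrast
  \<open>a_max / a_min\<close>: in the norm of V every Leibniz term would cost such a factor,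
  whereas the weight \<open>1 / a\<close> in the hypothesis bounds
  \<open>A \<nu> y v \<bullet> w\<close> directly by a multiple of
  \<open>energy y v * energy y w\<close>. The energy norm is exchanged for the norm of V only at the
  two ends, for the derivative of order \<nu> and for u itself, and each exchange costs the square
  root of the sup norm of \<open>1 / a\<close>. The bound \<open>a_min\<close> enters qualitatively,
  through coercivity, and not through the constants.

  The space X need not be closed, so derivatives of u may leave it. They are sought in the closure
  of its image, and closedness of the image of \<open>H10 D\<close> makes every element of that
  closure a weak gradient again.

  Infinitely many parameters cause no trouble: a partial derivative moves a single coordinate, so
  calculus of functions of one real variable with values in a Hilbert space suffices.\<close>

text \<open>Each multi-index is represented by a finite set of boxes, one for every single
  differentiation. Sums over subsets of this set replace sums over smaller multi-indices with
  products of binomial coefficients.\<close>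

definition boxes :: "(nat \<Rightarrow> nat) \<Rightarrow> (nat \<times> nat) set" where
  "boxes \<nu> = {(j, i). i < \<nu> j}"

text \<open>A subset of \<open>boxes \<nu>\<close> may have gaps in its columns. Its multi-index is
  therefore read off by counting each column, and a given multi-index arises from as many subsets as
  the product of binomial coefficients says.\<close>

definition cnt :: "(nat \<times> nat) set \<Rightarrow> nat \<Rightarrow> nat" where
  "cnt S j = card {i. (j, i) \<in> S}"

lemma finite_boxes: "\<nu> \<in> multi_indices \<Longrightarrow> finite (boxes \<nu>)"
proof -
  assume "\<nu> \<in> multi_indices"
  moreover have "boxes \<nu> = (SIGMA j:{j. \<nu> j \<noteq> 0}. {..<\<nu> j})"
    unfolding boxes_def by auto
  ultimately show ?thesis unfolding multi_indices_def by auto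
qed

lemma boxes_Suc: "boxes (\<nu>(j := Suc (\<nu> j))) = insert (j, \<nu> j) (boxes \<nu>)"
  unfolding boxes_def by (auto split: if_splits)

lemma notin_boxes: "(j, \<nu> j) \<notin> boxes \<nu>"
  unfolding boxes_def by auto

lemma boxes_zero [simp]: "boxes (\<lambda>_. 0) = {}"
  unfolding boxes_def by auto

lemma cnt_boxes [simp]: "cnt (boxes \<nu>) = \<nu>"
  unfolding boxes_def cnt_def by auto

lemma cnt_empty [simp]: "cnt {} = (\<lambda>_. 0)"
  unfolding cnt_def by auto

lemma cnt_multi_index: "finite S \<Longrightarrow> cnt S \<in> multi_indices"
proof -
  assume S: "finite S"
  have "{j. cnt S j \<noteq> 0} \<subseteq> fst ` S"
  proof
    fix j assume "j \<in> {j. cnt S j \<noteq> 0}"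
    then have "{i. (j, i) \<in> S} \<noteq> {}" unfolding cnt_def by force
    then show "j \<in> fst ` S" by force
  qed
  then show ?thesis unfolding multi_indices_def using S finite_subset by blast
qed

lemma cnt_insert:
  assumes "finite S" "(j, i) \<notin> S"
  shows "cnt (insert (j, i) S) = (cnt S)(j := Suc (cnt S j))"
proof
  fix k
  have "finite {i. (k, i) \<in> S}"
    by (rule finite_subset[of _ "snd ` S"]) (use assms in force)+
  moreover have "{i'. (k, i') \<in> insert (j, i) S} =
      (if k = j then insert i {i. (k, i) \<in> S} else {i. (k, i) \<in> S})" by auto
  ultimately show "cnt (insert (j, i) S) k = ((cnt S)(j := Suc (cnt S j))) k"
    unfolding cnt_def using assms(2) by (auto simp: card_insert_if)
qed

lemma multi_index_zero [simp]: "(\<lambda>_. 0) \<in> multi_indices"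
  unfolding multi_indices_def by simp

lemma multi_index_Suc: "\<nu> \<in> multi_indices \<Longrightarrow> \<nu>(j := Suc (\<nu> j)) \<in> multi_indices"
  using cnt_multi_index[of "boxes (\<nu>(j := Suc (\<nu> j)))"] finite_boxes[of \<nu>]
  by (simp add: boxes_Suc del: cnt_boxes) (simp add: boxes_Suc[symmetric])

lemma mi_size_zero [simp]: "mi_size (\<lambda>_. 0) = 0"
  unfolding mi_size_def by simp

lemma mi_power_zero [simp]: "mi_power R (\<lambda>_. 0) = 1"
  unfolding mi_power_def by simp

lemma mi_size_Suc:
  assumes "\<nu> \<in> multi_indices"
  shows "mi_size (\<nu>(j := Suc (\<nu> j))) = Suc (mi_size \<nu>)"
proof -
  \<comment> \<open>The support grows when \<open>\<nu> j = 0\<close>; over the common index set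
    \<open>?F\<close> both sums can be compared term by term.\<close>
  let ?F = "insert j {k. \<nu> k \<noteq> 0}"
  have F: "finite ?F" using assms unfolding multi_indices_def by simp
  have "mi_size \<nu> = (\<Sum>k\<in>?F. \<nu> k)"
    unfolding mi_size_def by (rule sum.mono_neutral_left) (use F in auto)
  moreover have "mi_size (\<nu>(j := Suc (\<nu> j))) = (\<Sum>k\<in>?F. (\<nu>(j := Suc (\<nu> j))) k)"
    unfolding mi_size_def by (rule sum.mono_neutral_left) (use F in auto)
  moreover have "\<dots> = Suc (\<nu> j) + (\<Sum>k\<in>?F - {j}. \<nu> k)"
    using F by (subst sum.remove[of _ j]) auto
  moreover have "(\<Sum>k\<in>?F. \<nu> k) = \<nu> j + (\<Sum>k\<in>?F - {j}. \<nu> k)"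
    using F by (subst sum.remove[of _ j]) auto
  ultimately show ?thesis by simp
qed

lemma mi_power_Suc:
  assumes "\<nu> \<in> multi_indices"
  shows "mi_power R (\<nu>(j := Suc (\<nu> j))) = R j * mi_power R \<nu>"
proof -
  let ?F = "insert j {k. \<nu> k \<noteq> 0}"
  have F: "finite ?F" using assms unfolding multi_indices_def by simp
  have "mi_power R \<nu> = (\<Prod>k\<in>?F. R k ^ \<nu> k)"
    unfolding mi_power_def by (rule prod.mono_neutral_left) (use F in auto)
  moreover have "mi_power R (\<nu>(j := Suc (\<nu> j))) = (\<Prod>k\<in>?F. R k ^ (\<nu>(j := Suc (\<nu> j))) k)"
    unfolding mi_power_def by (rule prod.mono_neutral_left) (use F in auto)
  moreover have "\<dots> = R j ^ Suc (\<nu> j) * (\<Prod>k\<in>?F - {j}. R k ^ \<nu> k)"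
    using F by (subst prod.remove[of _ j]) auto
  moreover have "(\<Prod>k\<in>?F. R k ^ \<nu> k) = R j ^ \<nu> j * (\<Prod>k\<in>?F - {j}. R k ^ \<nu> k)"
    using F by (subst prod.remove[of _ j]) auto
  ultimately show ?thesis by simp
qed

lemma mi_size_cnt: "finite S \<Longrightarrow> mi_size (cnt S) = card S"
proof (induction S rule: finite_induct)
  case (insert x F)
  then show ?case by (cases x) (simp add: cnt_insert mi_size_Suc cnt_multi_index del: fun_upd_apply)
qed simp

lemma mi_power_cnt: "finite S \<Longrightarrow> mi_power R (cnt S) = (\<Prod>p\<in>S. R (fst p))"
proof (induction S rule: finite_induct)
  case (insert x F)
  then show ?case by (cases x) (simp add: cnt_insert mi_power_Suc cnt_multi_index del: fun_upd_apply)
qed simp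

lemma mi_size_boxes: "\<nu> \<in> multi_indices \<Longrightarrow> card (boxes \<nu>) = mi_size \<nu>"
  by (metis cnt_boxes finite_boxes mi_size_cnt)

lemma mi_size_cnt_diff_less:
  assumes "\<nu> \<in> multi_indices" "S \<subseteq> boxes \<nu>" "S \<noteq> {}"
  shows "mi_size (cnt (boxes \<nu> - S)) < mi_size \<nu>"
proof -
  have "boxes \<nu> - S \<subset> boxes \<nu>" using assms by auto
  then show ?thesis
    using psubset_card_mono[OF finite_boxes[OF assms(1)]] finite_boxes[OF assms(1)]
    by (simp add: mi_size_cnt mi_size_boxes[symmetric] assms(1))
qed

lemma mi_power_cnt_split:
  assumes "\<nu> \<in> multi_indices" "S \<subseteq> boxes \<nu>"
  shows "mi_power R (cnt S) * mi_power R (cnt (boxes \<nu> - S)) = mi_power R \<nu>"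
proof -
  have f: "finite (boxes \<nu>)" by (rule finite_boxes) fact
  have "mi_power R \<nu> = (\<Prod>p\<in>boxes \<nu>. R (fst p))"
    using mi_power_cnt[OF f] by simp
  also have "\<dots> = (\<Prod>p\<in>boxes \<nu> - S. R (fst p)) * (\<Prod>p\<in>S. R (fst p))"
    by (rule prod.subset_diff) (use assms f in auto)
  finally show ?thesis
    using mi_power_cnt[of S R] mi_power_cnt[of "boxes \<nu> - S" R] f finite_subset[OF assms(2) f]
    by (simp add: mult.commute)
qed

lemma mi_power_scale: "\<nu> \<in> multi_indices \<Longrightarrow> mi_power (\<lambda>j. c * R j) \<nu> = c ^ mi_size \<nu> * mi_power R \<nu>"
  using mi_power_cnt[OF finite_boxes, of \<nu>] mi_size_boxes[of \<nu>] by (simp add: prod.distrib)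

lemma mi_power_nonneg: "(\<And>j. 0 \<le> R j) \<Longrightarrow> 0 \<le> mi_power R \<nu>"
  unfolding mi_power_def by (intro prod_nonneg) auto

lemma sum_Pow_insert:
  fixes g :: "'b set \<Rightarrow> 'c::ab_group_add"
  assumes "finite P" "x \<notin> P"
  shows "(\<Sum>S\<in>Pow (insert x P). g S) = (\<Sum>S\<in>Pow P. g S + g (insert x S))"
proof -
  have "(\<Sum>S\<in>Pow (insert x P). g S) = (\<Sum>S\<in>Pow P. g S) + (\<Sum>S\<in>insert x ` Pow P. g S)"
    unfolding Pow_insert by (rule sum.union_disjoint) (use assms in auto)
  also have "(\<Sum>S\<in>insert x ` Pow P. g S) = (\<Sum>S\<in>Pow P. g (insert x S))"
    by (subst sum.reindex) (use assms in \<open>auto intro!: inj_onI\<close>)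
  finally show ?thesis by (simp add: sum.distrib)
qed

text \<open>The product rule in place of Pascal's rule for binomials. The additional box either
  stays in the complement of S, so that the new derivative falls on the second factor, or joins S,
  so that it falls on the first.\<close>

lemma leibniz_Suc:
  fixes g :: "(nat \<Rightarrow> nat) \<Rightarrow> (nat \<Rightarrow> nat) \<Rightarrow> 'c::ab_group_add"
  assumes "\<nu> \<in> multi_indices" and "\<nu>' = \<nu>(j := Suc (\<nu> j))"
  shows "(\<Sum>S\<in>Pow (boxes \<nu>'). g (cnt S) (cnt (boxes \<nu>' - S))) =
    (\<Sum>S\<in>Pow (boxes \<nu>).
       g (cnt S) ((cnt (boxes \<nu> - S))(j := Suc (cnt (boxes \<nu> - S) j))) +
       g ((cnt S)(j := Suc (cnt S j))) (cnt (boxes \<nu> - S)))"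
proof -
  have f: "finite (boxes \<nu>)" by (rule finite_boxes) fact
  have n: "(j, \<nu> j) \<notin> boxes \<nu>" by (rule notin_boxes)
  show ?thesis
    unfolding assms(2) boxes_Suc sum_Pow_insert[OF f n]
  proof (rule sum.cong[OF refl])
    fix S assume S: "S \<in> Pow (boxes \<nu>)"
    have "finite S" using S f finite_subset by auto
    moreover have "(j, \<nu> j) \<notin> S" "(j, \<nu> j) \<notin> boxes \<nu> - S" using S n by auto
    moreover have "insert (j, \<nu> j) (boxes \<nu>) - S = insert (j, \<nu> j) (boxes \<nu> - S)"
      "insert (j, \<nu> j) (boxes \<nu>) - insert (j, \<nu> j) S = boxes \<nu> - S"
      using S n by auto
    ultimately show "g (cnt S) (cnt (insert (j, \<nu> j) (boxes \<nu>) - S)) +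
        g (cnt (insert (j, \<nu> j) S)) (cnt (insert (j, \<nu> j) (boxes \<nu>) - insert (j, \<nu> j) S)) =
        g (cnt S) ((cnt (boxes \<nu> - S))(j := Suc (cnt (boxes \<nu> - S) j))) +
        g ((cnt S)(j := Suc (cnt S j))) (cnt (boxes \<nu> - S))"
      using f by (simp add: cnt_insert)
  qed
qed

section \<open>Symmetric coercive equations on a closed subspace\<close>

lemma quadratic_nonneg_imp_linear_zero:
  fixes p q :: real
  assumes "\<And>t. 0 \<le> 2 * t * p + t\<^sup>2 * q"
  shows "p = 0"
proof (rule ccontr)
  assume p: "p \<noteq> 0"
  \<comment> \<open>A positive upper bound of q, whatever the sign of q, so that
    \<open>t = - (p / k)\<close> is defined and gives the value \<open>- (p\<^sup>2 / k)\<close> at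
    most.\<close>
  define k where "k = \<bar>q\<bar> + 1"
  have k: "k > 0" "q \<le> k" unfolding k_def by auto
  have "0 \<le> 2 * (-(p / k)) * p + (-(p / k))\<^sup>2 * q" by (rule assms)
  also have "\<dots> \<le> 2 * (-(p / k)) * p + (-(p / k))\<^sup>2 * k"
    by (intro add_left_mono mult_left_mono) (use k in auto)
  also have "\<dots> = - (p\<^sup>2 / k)" using k by (simp add: field_simps power2_eq_square)
  also have "\<dots> < 0" using p k by simp
  finally show False by simp
qed

text \<open>Direct method of the calculus of variations: coercivity bounds the quadratic functional
  \<open>J\<close> below on M, minimising sequences are Cauchy, and the first variation at the limit
  is the desired equation.\<close>

lemma riesz_subspace:
  fixes A :: "'h::{real_inner, complete_space} \<Rightarrow>\<^sub>L 'h"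
  assumes M: "subspace M" "closed M"
    and sym: "\<And>v w. A v \<bullet> w = v \<bullet> A w"
    and c: "0 < c" and coercive: "\<And>v. v \<in> M \<Longrightarrow> c * (norm v)\<^sup>2 \<le> A v \<bullet> v"
  shows "\<exists>w\<in>M. \<forall>v\<in>M. A w \<bullet> v = r \<bullet> v"
proof -
  define J where "J w = A w \<bullet> w - 2 * (r \<bullet> w)" for w
  have low: "- ((norm r)\<^sup>2 / c) \<le> J w" if "w \<in> M" for w
  proof -
    have "r \<bullet> w \<le> norm r * norm w" by (rule norm_cauchy_schwarz)
    moreover have "0 \<le> (c * norm w - norm r)\<^sup>2 / c" using c by simp
    then have "0 \<le> c * (norm w)\<^sup>2 - 2 * (norm r * norm w) + (norm r)\<^sup>2 / c"
      using c by (simp add: power2_eq_square field_simps)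
    ultimately show ?thesis unfolding J_def using coercive[OF that] by linarith
  qed
  define m where "m = Inf (J ` M)"
  have M0: "0 \<in> M" using M(1) subspace_0 by blast
  have bdd: "bdd_below (J ` M)" using low by (intro bdd_belowI2)
  have mlow: "m \<le> J w" if "w \<in> M" for w
    unfolding m_def by (rule cInf_lower) (use that bdd in auto)
  have "\<exists>w\<in>M. J w < m + inverse (real (Suc n))" for n
  proof -
    have "Inf (J ` M) < m + inverse (real (Suc n))" unfolding m_def by simp
    then show ?thesis using cInf_less_iff[OF _ bdd] M0 by auto
  qed
  then obtain w where w: "\<And>n. w n \<in> M" "\<And>n. J (w n) < m + inverse (real (Suc n))" by metis
  \<comment> \<open>Parallelogram identity for the quadratic part of \<open>J\<close>: the midpoint
    cannot fall below the infimum m, so two near-minimisers must be close to each other.\<close>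
  have par: "2 * (c / 4 * (norm (x - z))\<^sup>2) \<le> J x + J z - 2 * m" if "x \<in> M" "z \<in> M" for x z
  proof -
    have "(1/2) *\<^sub>R (x + z) \<in> M" using that M(1) by (simp add: subspace_add subspace_scale)
    then have "m \<le> J ((1/2) *\<^sub>R (x + z))" by (rule mlow)
    also have "J ((1/2) *\<^sub>R (x + z)) = (J x + J z) / 2 - (A (x - z) \<bullet> (x - z)) / 4"
      unfolding J_def using sym[of x z]
      by (simp add: blinfun.bilinear_simps inner_add inner_diff inner_commute field_simps)
    finally show ?thesis using coercive[OF subspace_diff[OF M(1) that]] by (simp add: field_simps)
  qed
  have aux: "x < z" if "i \<le> l" "i' \<le> l" "2 * x \<le> p + q - 2 * m" "p < m + i" "q < m + i'" "l < z"
    for x z i i' l p q :: real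
    using that by linarith
  have "Cauchy w"
  proof (rule metric_CauchyI)
    fix e :: real assume e: "0 < e"
    have "0 < c / 4 * e\<^sup>2" using c e by simp
    then obtain N where N: "inverse (real (Suc N)) < c / 4 * e\<^sup>2" using reals_Archimedean by blast
    show "\<exists>N. \<forall>k\<ge>N. \<forall>n\<ge>N. dist (w k) (w n) < e"
    proof (intro exI allI impI)
      fix k n assume "N \<le> k" "N \<le> n"
      then have "inverse (real (Suc k)) \<le> inverse (real (Suc N))"
        "inverse (real (Suc n)) \<le> inverse (real (Suc N))" by (simp_all add: field_simps)
      then have "c / 4 * (norm (w k - w n))\<^sup>2 < c / 4 * e\<^sup>2"
        using par[OF w(1)[of k] w(1)[of n]] w(2)[of k] w(2)[of n] N aux by blast
      then have "(norm (w k - w n))\<^sup>2 < e\<^sup>2" using c by (simp add: mult_less_cancel_left)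
      then show "dist (w k) (w n) < e" using e by (simp add: dist_norm power_less_imp_less_base)
    qed
  qed
  then obtain l where l: "w \<longlonglongrightarrow> l" using Cauchy_convergent convergent_def by blast
  have lM: "l \<in> M" using closed_sequentially[OF M(2)] w(1) l by blast
  have "(\<lambda>n. J (w n)) \<longlonglongrightarrow> J l" unfolding J_def
    by (intro tendsto_intros l)
  moreover have "(\<lambda>n. m + inverse (real (Suc n))) \<longlonglongrightarrow> m + 0"
    by (intro tendsto_intros LIMSEQ_inverse_real_of_nat)
  ultimately have Jl: "J l \<le> m + 0"
    by (rule LIMSEQ_le) (use w(2) in \<open>auto intro: less_imp_le\<close>)
  have "A l \<bullet> v = r \<bullet> v" if v: "v \<in> M" for v
  proof -
    have "0 \<le> 2 * t * (A l \<bullet> v - r \<bullet> v) + t\<^sup>2 * (A v \<bullet> v)" for t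
    proof -
      have "l + t *\<^sub>R v \<in> M" using lM v M(1) by (simp add: subspace_add subspace_scale)
      then have "J l \<le> J (l + t *\<^sub>R v)" using mlow Jl by fastforce
      also have "J (l + t *\<^sub>R v) = J l + 2 * t * (A l \<bullet> v - r \<bullet> v) + t\<^sup>2 * (A v \<bullet> v)"
        unfolding J_def using sym[of l v]
        by (simp add: blinfun.bilinear_simps algebra_simps inner_commute power2_eq_square)
      finally show ?thesis by simp
    qed
    then have "A l \<bullet> v - r \<bullet> v = 0" by (rule quadratic_nonneg_imp_linear_zero)
    then show ?thesis by simp
  qed
  then show ?thesis using lM by blast
qed

section \<open>Combinatorics of the derivative bounds\<close>

lemma half_ff_0 [simp]: "half_ff 0 = 1"
  unfolding half_ff_def by simp

lemma half_ff_Suc: "half_ff (Suc n) = half_ff n * \<bar>1/2 - real n\<bar>"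
  unfolding half_ff_def by (simp add: abs_mult)

lemma half_ff_nonneg: "0 \<le> half_ff n"
  unfolding half_ff_def by simp

lemma half_ff_le_fact: "half_ff n \<le> fact n"
proof (induction n)
  case (Suc n)
  have "\<bar>1/2 - real n\<bar> \<le> real (Suc n)" by linarith
  then have "half_ff n * \<bar>1/2 - real n\<bar> \<le> fact n * real (Suc n)"
    using Suc half_ff_nonneg by (intro mult_mono) auto
  then show ?case by (simp add: half_ff_Suc algebra_simps)
qed simp

text \<open>The ratio of consecutive terms is \<open>\<bar>1/2 - n\<bar> / (n + 1)\<close>. It is
  smallest at \<open>n = 1\<close>, where it equals \<open>1/4\<close>.\<close>

lemma half_ff_fact_Suc_ge: "half_ff n / fact n \<le> 4 * (half_ff (Suc n) / fact (Suc n))"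
proof -
  have "real (Suc n) \<le> 4 * \<bar>1/2 - real n\<bar>" by (cases n) auto
  then have "half_ff n * real (Suc n) \<le> half_ff n * (4 * \<bar>1/2 - real n\<bar>)"
    using half_ff_nonneg by (rule mult_left_mono)
  then show ?thesis by (simp add: half_ff_Suc field_simps del: of_nat_Suc)
qed

text \<open>With b for the quotients, splitting off one factor \<open>1/12\<close> turns the sum for
  \<open>n + 1\<close> into \<open>1/12\<close> times (b n plus the sum for n), hence at most
  \<open>2/12 * b n \<le> 8/12 * b (n + 1)\<close>. The size of the constant 12 matters only here,
  through \<open>2 * 4 \<le> 12\<close>.\<close>

lemma half_ff_convolution:
  "(\<Sum>k=1..n. (1/12) ^ k * (half_ff (n - k) / fact (n - k))) \<le> half_ff n / fact n"
proof (induction n)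
  case (Suc n)
  let ?b = "\<lambda>n. half_ff n / fact n"
  have "(\<Sum>k=1..Suc n. (1/12) ^ k * ?b (Suc n - k)) =
      (\<Sum>k=0..n. (1/12) ^ Suc k * ?b (n - k))"
    using sum.shift_bounds_cl_Suc_ivl[of "\<lambda>k. (1/12) ^ k * ?b (Suc n - k)" 0 n] by simp
  also have "\<dots> = (1/12) * (\<Sum>k=0..n. (1/12) ^ k * ?b (n - k))"
    by (simp add: sum_distrib_left)
  also have "(\<Sum>k=0..n. (1/12) ^ k * ?b (n - k)) =
      ?b n + (\<Sum>k=1..n. (1/12) ^ k * ?b (n - k))"
    by (simp add: sum.atLeast_Suc_atMost)
  also have "(1/12) * \<dots> \<le> (1/12) * (?b n + ?b n)"
    using Suc by simp
  also have "\<dots> \<le> ?b (Suc n)"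
  proof -
    have "0 \<le> ?b (Suc n)" using half_ff_nonneg[of "Suc n"] by simp
    moreover have "(1/12) * (p + p) \<le> q" if "p \<le> 4 * q" "0 \<le> q" for p q :: real
      using that by simp
    ultimately show ?thesis using half_ff_fact_Suc_ge[of n] by blast
  qed
  finally show ?case .
qed (simp)

text \<open>Here the binomial coefficients return: once a bound depends on a set of boxes only
  through its cardinality, the sum over subsets becomes a sum over k.\<close>

lemma sum_Pow_card:
  fixes h :: "nat \<Rightarrow> real"
  assumes "finite P"
  shows "(\<Sum>S\<in>Pow P - {{}}. h (card S)) = (\<Sum>k=1..card P. real (card P choose k) * h k)"
proof -
  have "(\<Sum>S\<in>Pow P - {{}}. h (card S)) =
      (\<Sum>k=1..card P. \<Sum>S | S \<in> Pow P - {{}} \<and> card S = k. h (card S))"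
  proof (rule sum.group[symmetric])
    show "card ` (Pow P - {{}}) \<subseteq> {1..card P}"
    proof
      fix k assume "k \<in> card ` (Pow P - {{}})"
      then obtain S where "S \<subseteq> P" "S \<noteq> {}" "k = card S" by auto
      then show "k \<in> {1..card P}"
        using assms card_mono[of P S] finite_subset[of S P] by (simp add: Suc_le_eq card_gt_0_iff)
    qed
  qed (use assms in auto)
  also have "\<dots> = (\<Sum>k=1..card P. real (card P choose k) * h k)"
  proof (rule sum.cong[OF refl])
    fix k assume k: "k \<in> {1..card P}"
    have "(\<Sum>S | S \<in> Pow P - {{}} \<and> card S = k. h (card S)) =
        (\<Sum>S | S \<in> Pow P - {{}} \<and> card S = k. h k)" by (rule sum.cong) auto
    moreover have "{S \<in> Pow P - {{}}. card S = k} = {S. S \<subseteq> P \<and> card S = k}" using k by auto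
    ultimately show "(\<Sum>S | S \<in> Pow P - {{}} \<and> card S = k. h (card S)) =
        real (card P choose k) * h k"
      using n_subsets[OF assms, of k] by simp
  qed
  finally show ?thesis .
qed

lemma phi_nonneg: "0 \<le> phi \<delta> \<nu>"
  unfolding phi_def using half_ff_nonneg by simp

lemma phi_le: "phi \<delta> \<nu> \<le> fact (mi_size \<nu>) powr \<delta>"
proof -
  have "phi \<delta> \<nu> \<le> fact (mi_size \<nu>) * fact (mi_size \<nu>) powr (\<delta> - 1)"
    unfolding phi_def using half_ff_le_fact by (intro mult_right_mono) auto
  also have "\<dots> = fact (mi_size \<nu>) powr \<delta>"
    by (simp add: powr_mult_base)
  finally show ?thesis .
qed

text \<open>Two independent absorptions. Since \<open>\<delta> - 1 \<ge> 0\<close>, the powers of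
  \<open>fact k * fact (n - k) \<le> fact n\<close> compare. A Leibniz term carries \<kappa> only
  once, but k derivatives falling on the coefficient release \<open>\<kappa> ^ k\<close> from
  \<open>(12 * \<kappa>) ^ n\<close>, and \<open>\<kappa> \<le> \<kappa> ^ k\<close> because
  \<open>k \<ge> 1\<close>.\<close>

lemma leibniz_term_bound:
  assumes "1 \<le> \<delta>" "1 \<le> \<kappa>" "1 \<le> k" "k \<le> n"
  shows "\<kappa> * fact k powr \<delta> * ((12 * \<kappa>) ^ (n - k) * (half_ff (n - k) * fact (n - k) powr (\<delta> - 1)))
    \<le> (12 * \<kappa>) ^ n * fact n powr (\<delta> - 1) * ((1/12) ^ k * (fact k * half_ff (n - k)))"
proof -
  have "fact k * fact (n - k) \<le> (fact n :: real)"
  proof -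
    have "fact k * fact (n - k) dvd (fact n :: nat)"
      using fact_fact_dvd_fact[of k "n - k"] assms(4) by simp
    then have "fact k * fact (n - k) \<le> (fact n :: nat)" by (rule dvd_imp_le) simp
    then show ?thesis by (metis of_nat_fact of_nat_le_iff of_nat_mult)
  qed
  then have p: "fact k powr (\<delta> - 1) * fact (n - k) powr (\<delta> - 1) \<le> (fact n :: real) powr (\<delta> - 1)"
    using assms(1) by (simp add: powr_mult[symmetric] powr_mono2)
  have q: "\<kappa> * (12 * \<kappa>) ^ (n - k) \<le> (12 * \<kappa>) ^ n * (1/12) ^ k"
  proof -
    have "\<kappa> ^ 1 \<le> \<kappa> ^ k" using assms by (intro power_increasing) auto
    then have "\<kappa> * (12 * \<kappa>) ^ (n - k) \<le> \<kappa> ^ k * (12 * \<kappa>) ^ (n - k)"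
      using assms(2) by (intro mult_right_mono) auto
    also have "\<kappa> ^ k = (12 * \<kappa>) ^ k * (1/12) ^ k"
      by (subst power_mult_distrib[symmetric]) simp
    also have "\<dots> * (12 * \<kappa>) ^ (n - k) = (12 * \<kappa>) ^ (k + (n - k)) * (1/12) ^ k"
      by (simp add: power_add)
    finally show ?thesis using assms(4) by simp
  qed
  have "fact k powr \<delta> = fact k * (fact k :: real) powr (\<delta> - 1)"
    by (simp add: powr_mult_base)
  then have "\<kappa> * fact k powr \<delta> * ((12 * \<kappa>) ^ (n - k) * (half_ff (n - k) * fact (n - k) powr (\<delta> - 1)))
     = (\<kappa> * (12 * \<kappa>) ^ (n - k)) * (fact k powr (\<delta> - 1) * fact (n - k) powr (\<delta> - 1)) *
       (fact k * half_ff (n - k))" by simp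
  also have "\<dots> \<le> ((12 * \<kappa>) ^ n * (1/12) ^ k) * fact n powr (\<delta> - 1) * (fact k * half_ff (n - k))"
    using assms half_ff_nonneg by (intro mult_right_mono[OF mult_mono[OF q p]]) auto
  finally show ?thesis by (simp add: mult_ac)
qed

text \<open>Strong induction on the order. The powers of \<beta> multiply up to the same product for
  every S, so what remains is a recursion in the order alone, and the claimed bound is a
  supersolution of it.\<close>

lemma gevrey_recursion:
  fixes x :: "(nat \<Rightarrow> nat) \<Rightarrow> real"
  assumes \<delta>: "1 \<le> \<delta>" and \<kappa>: "1 \<le> \<kappa>" and \<beta>: "\<And>j. 0 \<le> \<beta> j" and C: "0 \<le> C"
    and x0: "x (\<lambda>_. 0) \<le> C"
    and rec: "\<And>\<nu>. \<nu> \<in> multi_indices \<Longrightarrow> \<nu> \<noteq> (\<lambda>_. 0) \<Longrightarrow>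
      x \<nu> \<le> (\<Sum>S\<in>Pow (boxes \<nu>) - {{}}.
        \<kappa> * mi_power \<beta> (cnt S) * fact (card S) powr \<delta> * x (cnt (boxes \<nu> - S)))"
    and \<nu>: "\<nu> \<in> multi_indices"
  shows "x \<nu> \<le> mi_power (\<lambda>j. 12 * \<kappa> * \<beta> j) \<nu> * phi \<delta> \<nu> * C"
  using \<nu>
proof (induction "mi_size \<nu>" arbitrary: \<nu> rule: less_induct)
  case less
  show ?case
  proof (cases "\<nu> = (\<lambda>_. 0)")
    case True
    then show ?thesis using x0 by (simp add: phi_def)
  next
    case False
    let ?P = "boxes \<nu>"
    define n where "n = mi_size \<nu>"
    \<comment> \<open>All factors common to the bounds of the summands, that is, those independent
      of S.\<close>
    define W where "W = C * mi_power \<beta> \<nu> * (12 * \<kappa>) ^ n * fact n powr (\<delta> - 1)"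
    have \<nu>: "\<nu> \<in> multi_indices" by fact
    have f: "finite ?P" by (rule finite_boxes) fact
    have cP: "card ?P = n" unfolding n_def by (rule mi_size_boxes) fact
    have \<beta>\<nu>: "0 \<le> mi_power \<beta> \<mu>" for \<mu> using \<beta> by (rule mi_power_nonneg)
    have W: "0 \<le> W" unfolding W_def using C \<beta>\<nu> \<kappa> by simp
    have "x \<nu> \<le> (\<Sum>S\<in>Pow ?P - {{}}.
        \<kappa> * mi_power \<beta> (cnt S) * fact (card S) powr \<delta> * x (cnt (?P - S)))"
      by (rule rec) fact+
    also have "\<dots> \<le> (\<Sum>S\<in>Pow ?P - {{}}. W * ((1/12) ^ card S * (fact (card S) * half_ff (n - card S))))"
    proof (rule sum_mono)
      fix S assume S: "S \<in> Pow ?P - {{}}"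
      then have fS: "finite S" "finite (?P - S)" using f finite_subset by auto
      define k where "k = card S"
      have k: "1 \<le> k" "k \<le> n"
        using S fS f card_mono[of ?P S] unfolding k_def cP[symmetric]
        by (auto simp: Suc_le_eq card_gt_0_iff)
      have sz: "mi_size (cnt (?P - S)) = n - k"
        using fS S by (simp add: mi_size_cnt card_Diff_subset cP k_def)
      have "x (cnt (?P - S)) \<le> mi_power (\<lambda>j. 12 * \<kappa> * \<beta> j) (cnt (?P - S)) * phi \<delta> (cnt (?P - S)) * C"
        by (rule less.hyps) (use S mi_size_cnt_diff_less[OF \<nu>] cnt_multi_index fS in auto)
      also have "mi_power (\<lambda>j. 12 * \<kappa> * \<beta> j) (cnt (?P - S)) =
          (12 * \<kappa>) ^ (n - k) * mi_power \<beta> (cnt (?P - S))"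
        using mi_power_scale[OF cnt_multi_index[OF fS(2)], of "12 * \<kappa>" \<beta>] sz by simp
      finally have "\<kappa> * mi_power \<beta> (cnt S) * fact k powr \<delta> * x (cnt (?P - S)) \<le>
          \<kappa> * mi_power \<beta> (cnt S) * fact k powr \<delta> *
            ((12 * \<kappa>) ^ (n - k) * mi_power \<beta> (cnt (?P - S)) * phi \<delta> (cnt (?P - S)) * C)"
        using \<beta>\<nu> \<kappa> by (intro mult_left_mono) auto
      also have "\<dots> = (mi_power \<beta> (cnt S) * mi_power \<beta> (cnt (?P - S)) * C) *
          (\<kappa> * fact k powr \<delta> * ((12 * \<kappa>) ^ (n - k) * (half_ff (n - k) * fact (n - k) powr (\<delta> - 1))))"
        unfolding phi_def sz by (simp only: mult_ac)
      also have "\<dots> \<le> (mi_power \<beta> (cnt S) * mi_power \<beta> (cnt (?P - S)) * C) *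
          ((12 * \<kappa>) ^ n * fact n powr (\<delta> - 1) * ((1/12) ^ k * (fact k * half_ff (n - k))))"
        using \<beta>\<nu> C by (intro mult_left_mono leibniz_term_bound \<delta> \<kappa> k) auto
      also have "mi_power \<beta> (cnt S) * mi_power \<beta> (cnt (?P - S)) = mi_power \<beta> \<nu>"
        by (rule mi_power_cnt_split) (use S \<nu> in auto)
      finally show "\<kappa> * mi_power \<beta> (cnt S) * fact (card S) powr \<delta> * x (cnt (?P - S)) \<le>
          W * ((1/12) ^ card S * (fact (card S) * half_ff (n - card S)))"
        unfolding W_def k_def by (simp only: mult_ac)
    qed
    also have "\<dots> = (\<Sum>k=1..n. real (n choose k) * (W * ((1/12) ^ k * (fact k * half_ff (n - k)))))"
      by (subst sum_Pow_card[OF f, where h = "\<lambda>k. W * ((1/12) ^ k * (fact k * half_ff (n - k)))"])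
        (simp add: cP)
    \<comment> \<open>The factor \<open>fact k\<close> cancels against the binomial coefficient,
      which leaves exactly the convolution estimated before.\<close>
    also have "\<dots> = (\<Sum>k=1..n. (W * fact n) * ((1/12) ^ k * (half_ff (n - k) / fact (n - k))))"
    proof (rule sum.cong[OF refl])
      fix k assume "k \<in> {1..n}"
      then have "real (n choose k) = fact n / (fact k * fact (n - k))"
        by (simp add: binomial_fact)
      then show "real (n choose k) * (W * ((1/12) ^ k * (fact k * half_ff (n - k)))) =
          (W * fact n) * ((1/12) ^ k * (half_ff (n - k) / fact (n - k)))"
        by (simp add: field_simps)
    qed
    also have "\<dots> = (W * fact n) * (\<Sum>k=1..n. (1/12) ^ k * (half_ff (n - k) / fact (n - k)))"
      by (simp add: sum_distrib_left)
    also have "\<dots> \<le> (W * fact n) * (half_ff n / fact n)"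
      using W by (intro mult_left_mono half_ff_convolution) auto
    also have "\<dots> = mi_power (\<lambda>j. 12 * \<kappa> * \<beta> j) \<nu> * phi \<delta> \<nu> * C"
      using mi_power_scale[OF \<nu>, of "12 * \<kappa>" \<beta>]
      unfolding W_def phi_def n_def[symmetric] by simp
    finally show ?thesis .
  qed
qed

text \<open>The derivative \<open>d\<close> of the solution is not obtained as a limit: it is given by the
  differentiated equation, and coercivity bounds the remainder.\<close>

lemma has_vector_derivative_solution:
  fixes A :: "real \<Rightarrow> 'h::real_inner \<Rightarrow>\<^sub>L 'h"
  assumes A: "(A has_vector_derivative A') (at s)"
    and G: "(G has_vector_derivative G') (at s)"
    and M: "subspace M" and w: "\<And>t. w t \<in> M" and d: "d \<in> M"
    and eq: "\<And>t v. v \<in> M \<Longrightarrow> (A t (w t) + G t) \<bullet> v = (A s (w s) + G s) \<bullet> v"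
    and deq: "\<And>v. v \<in> M \<Longrightarrow> (A s d + A' (w s) + G') \<bullet> v = 0"
    and c: "0 < c" and coercive: "\<And>v. v \<in> M \<Longrightarrow> c * (norm v)\<^sup>2 \<le> A s v \<bullet> v"
  shows "(w has_vector_derivative d) (at s)"
proof -
  \<comment> \<open>The left-hand side of the equation with w replaced by its candidate
    linearisation. It is differentiable with no information on w beyond its value at s, and by
    \<open>deq\<close> its derivative is orthogonal to M.\<close>
  define \<rho> where "\<rho> t = G t + A t (w s + (t - s) *\<^sub>R d)" for t
  define \<rho>' where "\<rho>' = G' + (A s d + A' (w s))"
  have lin: "((\<lambda>t. w s + (t - s) *\<^sub>R d) has_vector_derivative d) (at s)"
    by (auto intro!: derivative_eq_intros)
  have "(\<rho> has_vector_derivative \<rho>') (at s)"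
    unfolding \<rho>_def \<rho>'_def
    using has_vector_derivative_add[OF G
        bounded_bilinear.has_vector_derivative[OF bounded_bilinear_blinfun_apply A lin]]
    by simp
  then have \<rho>: "(\<rho> has_derivative (\<lambda>h. h *\<^sub>R \<rho>')) (at s)"
    unfolding has_vector_derivative_def .
  \<comment> \<open>Tested with M, the true equation has the same value at t and at s, so the
    linearisation error of w solves an equation whose right-hand side is the Taylor remainder of
    \<open>\<rho>\<close>.\<close>
  have rem: "A t (w t - w s - (t - s) *\<^sub>R d) \<bullet> v = - ((\<rho> t - \<rho> s - (t - s) *\<^sub>R \<rho>') \<bullet> v)"
    if "v \<in> M" for t v
  proof -
    have "\<rho>' \<bullet> v = 0" using deq[OF that] unfolding \<rho>'_def by (simp add: algebra_simps)
    then show ?thesis using eq[OF that, of t] unfolding \<rho>_def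
      by (simp add: blinfun.bilinear_simps algebra_simps)
  qed
  have "isCont A s" using A by (rule has_vector_derivative_continuous)
  then obtain r where r: "0 < r" "\<And>t. norm (t - s) < r \<Longrightarrow> norm (A t - A s) < c / 2"
    using c unfolding continuous_at_eps_delta dist_norm by (meson half_gt_zero)
  \<comment> \<open>Coercivity is assumed at s only. By continuity of A half of the constant
    survives nearby, and this uniform constant gives the remainder estimate below.\<close>
  have coer: "c / 2 * (norm v)\<^sup>2 \<le> A t v \<bullet> v" if "norm (t - s) < r" "v \<in> M" for t v
  proof -
    have "\<bar>(A t - A s) v \<bullet> v\<bar> \<le> norm ((A t - A s) v) * norm v" by (rule Cauchy_Schwarz_ineq2)
    also have "\<dots> \<le> (norm (A t - A s) * norm v) * norm v"
      by (intro mult_right_mono norm_blinfun) auto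
    also have "\<dots> \<le> c / 2 * (norm v)\<^sup>2"
      using mult_right_mono[OF less_imp_le[OF r(2)[OF that(1)]], of "(norm v)\<^sup>2"]
      by (simp add: power2_eq_square mult.assoc)
    finally have "\<bar>A t v \<bullet> v - A s v \<bullet> v\<bar> \<le> c / 2 * (norm v)\<^sup>2"
      by (simp add: blinfun.diff_left inner_diff_left)
    then show ?thesis using coercive[OF that(2)] by linarith
  qed
  have est: "norm (w t - w s - (t - s) *\<^sub>R d) \<le> 2 / c * norm (\<rho> t - \<rho> s - (t - s) *\<^sub>R \<rho>')"
    if "norm (t - s) < r" for t
  proof -
    let ?e = "w t - w s - (t - s) *\<^sub>R d" and ?R = "\<rho> t - \<rho> s - (t - s) *\<^sub>R \<rho>'"
    have eM: "?e \<in> M" using w d M by (intro subspace_diff subspace_scale) auto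
    have "c / 2 * (norm ?e)\<^sup>2 \<le> A t ?e \<bullet> ?e" by (rule coer) fact+
    also have "\<dots> = - (?R \<bullet> ?e)" by (rule rem) fact
    also have "\<dots> \<le> norm ?R * norm ?e" using Cauchy_Schwarz_ineq2[of ?R ?e] by linarith
    finally have *: "(c / 2 * norm ?e) * norm ?e \<le> norm ?R * norm ?e"
      by (simp only: power2_eq_square mult.assoc)
    have "c / 2 * norm ?e \<le> norm ?R"
    proof (cases "?e = 0")
      case True
      then show ?thesis by (simp only: norm_zero mult_zero_right norm_ge_zero)
    next
      case False
      then have "0 < norm ?e" by (simp only: zero_less_norm_iff not_False_eq_True)
      with * show ?thesis by (rule mult_right_le_imp_le)
    qed
    then show ?thesis using c by (simp add: field_simps)
  qed
  show ?thesis
    unfolding has_vector_derivative_def has_derivative_at_alt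
  proof (intro conjI allI impI)
    show "bounded_linear (\<lambda>x. x *\<^sub>R d)" by (rule bounded_linear_scaleR_left)
    fix e :: real assume "0 < e"
    then have pos: "0 < c / 2 * e" using c by simp
    from \<rho> have "\<forall>e>0. \<exists>r>0. \<forall>t. norm (t - s) < r \<longrightarrow>
        norm (\<rho> t - \<rho> s - (t - s) *\<^sub>R \<rho>') \<le> e * norm (t - s)"
      unfolding has_derivative_at_alt by (rule conjunct2)
    from this[rule_format, OF pos] obtain r' where r': "0 < r'"
      "\<And>t. norm (t - s) < r' \<Longrightarrow> norm (\<rho> t - \<rho> s - (t - s) *\<^sub>R \<rho>') \<le> c / 2 * e * norm (t - s)"
      by blast
    show "\<exists>r>0. \<forall>t. norm (t - s) < r \<longrightarrow> norm (w t - w s - (t - s) *\<^sub>R d) \<le> e * norm (t - s)"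
    proof (intro exI[of _ "min r r'"] conjI allI impI)
      fix t assume t: "norm (t - s) < min r r'"
      have "norm (w t - w s - (t - s) *\<^sub>R d) \<le> 2 / c * norm (\<rho> t - \<rho> s - (t - s) *\<^sub>R \<rho>')"
        using t by (intro est) auto
      also have "\<dots> \<le> 2 / c * (c / 2 * e * norm (t - s))"
        using t c by (intro mult_left_mono r'(2)) auto
      also have "\<dots> = e * norm (t - s)" using c by simp
      finally show "norm (w t - w s - (t - s) *\<^sub>R d) \<le> e * norm (t - s)" .
    qed (use r r' in auto)
  qed
qed

subsection \<open>Derivatives of parametric variational problems\<close>

text \<open>The recursion descends in the order, since a nonempty S puts at least one derivative on
  the coefficient. Order zero is the given solution. Outside \<open>multi_indices\<close> the value
  is an arbitrary default, so that the measure has to decrease only for genuine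
  multi-indices.\<close>

function dsol :: "'h::real_inner set \<Rightarrow> ((nat \<Rightarrow> nat) \<Rightarrow> (nat \<Rightarrow> real) \<Rightarrow> 'h \<Rightarrow>\<^sub>L 'h) \<Rightarrow>
    ((nat \<Rightarrow> real) \<Rightarrow> 'h) \<Rightarrow> (nat \<Rightarrow> nat) \<Rightarrow> (nat \<Rightarrow> real) \<Rightarrow> 'h" where
  "dsol M A u0 \<nu> y =
    (if \<nu> \<notin> multi_indices \<or> \<nu> = (\<lambda>_. 0) then u0 y
     else SOME w. w \<in> M \<and> (\<forall>v\<in>M. A (\<lambda>_. 0) y w \<bullet> v =
       (- (\<Sum>S\<in>Pow (boxes \<nu>) - {{}}. A (cnt S) y (dsol M A u0 (cnt (boxes \<nu> - S)) y))) \<bullet> v))"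
  by pat_completeness auto
termination
  by (relation "Wellfounded.measure (\<lambda>(M, A, u0, \<nu>, y). mi_size \<nu>)") (auto simp: mi_size_cnt_diff_less)

declare dsol.simps [simp del]

text \<open>The functional f appears only through \<open>u0_eq\<close>: tested with M, the operator
  applied to the solution gives the same value for all parameters, which is all that differentiation
  needs. Coercivity is required on M only, because the multiplication operators used later
  annihilate fields living off D.\<close>

locale parametric_problem =
  fixes M :: "'h::{real_inner, complete_space} set"
    and A :: "(nat \<Rightarrow> nat) \<Rightarrow> (nat \<Rightarrow> real) \<Rightarrow> 'h \<Rightarrow>\<^sub>L 'h"
    and u0 :: "(nat \<Rightarrow> real) \<Rightarrow> 'h"
    and c :: "(nat \<Rightarrow> real) \<Rightarrow> real"
  assumes M: "subspace M" "closed M"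
    and sym: "\<And>y v w. A (\<lambda>_. 0) y v \<bullet> w = v \<bullet> A (\<lambda>_. 0) y w"
    and c: "\<And>y. 0 < c y"
    and coercive: "\<And>y v. v \<in> M \<Longrightarrow> c y * (norm v)\<^sup>2 \<le> A (\<lambda>_. 0) y v \<bullet> v"
    and deriv: "\<And>\<nu> j y. \<nu> \<in> multi_indices \<Longrightarrow>
      ((\<lambda>t. A \<nu> (y(j := t))) has_vector_derivative A (\<nu>(j := Suc (\<nu> j))) y) (at (y j))"
    and u0: "\<And>y. u0 y \<in> M"
    and u0_eq: "\<And>y z v. v \<in> M \<Longrightarrow> A (\<lambda>_. 0) y (u0 y) \<bullet> v = A (\<lambda>_. 0) z (u0 z) \<bullet> v"
begin

abbreviation du :: "(nat \<Rightarrow> nat) \<Rightarrow> (nat \<Rightarrow> real) \<Rightarrow> 'h" where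
  "du \<equiv> dsol M A u0"

lemma du_zero: "du (\<lambda>_. 0) = u0"
  by (rule ext) (subst dsol.simps, simp)

lemma du_spec:
  assumes "\<nu> \<in> multi_indices" "\<nu> \<noteq> (\<lambda>_. 0)"
  shows "du \<nu> y \<in> M \<and> (\<forall>v\<in>M. A (\<lambda>_. 0) y (du \<nu> y) \<bullet> v =
       (- (\<Sum>S\<in>Pow (boxes \<nu>) - {{}}. A (cnt S) y (du (cnt (boxes \<nu> - S)) y))) \<bullet> v)"
proof -
  let ?r = "- (\<Sum>S\<in>Pow (boxes \<nu>) - {{}}. A (cnt S) y (du (cnt (boxes \<nu> - S)) y))"
  have eq: "du \<nu> y = (SOME w. w \<in> M \<and> (\<forall>v\<in>M. A (\<lambda>_. 0) y w \<bullet> v = ?r \<bullet> v))"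
    using assms by (subst dsol.simps) simp
  have "\<exists>w. w \<in> M \<and> (\<forall>v\<in>M. A (\<lambda>_. 0) y w \<bullet> v = ?r \<bullet> v)"
    using riesz_subspace[OF M sym c coercive] by blast
  then show ?thesis unfolding eq by (rule someI_ex)
qed

lemma du_mem: "\<nu> \<in> multi_indices \<Longrightarrow> du \<nu> y \<in> M"
  by (cases "\<nu> = (\<lambda>_. 0)") (auto simp: du_zero u0 du_spec)

definition rest :: "(nat \<Rightarrow> nat) \<Rightarrow> (nat \<Rightarrow> real) \<Rightarrow> 'h" where
  "rest \<nu> y = (\<Sum>S\<in>Pow (boxes \<nu>) - {{}}. A (cnt S) y (du (cnt (boxes \<nu> - S)) y))"

lemma rest_zero: "rest (\<lambda>_. 0) y = 0"
  unfolding rest_def by simp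

lemma leibniz_sum_eq:
  assumes "\<nu> \<in> multi_indices"
  shows "(\<Sum>S\<in>Pow (boxes \<nu>). A (cnt S) y (du (cnt (boxes \<nu> - S)) y)) =
    A (\<lambda>_. 0) y (du \<nu> y) + rest \<nu> y"
  unfolding rest_def using finite_boxes[OF assms]
  by (subst sum.remove[of _ "{}"]) auto

lemma du_eq_zero:
  assumes "\<nu> \<in> multi_indices" "\<nu> \<noteq> (\<lambda>_. 0)" "v \<in> M"
  shows "(A (\<lambda>_. 0) y (du \<nu> y) + rest \<nu> y) \<bullet> v = 0"
  using du_spec[OF assms(1,2), of y] assms(3) unfolding rest_def by (simp add: inner_add_left)

text \<open>The common form for all orders that the differentiation lemma takes as input: tested
  with M, the Leibniz sum does not depend on the parameter. It is the functional of the original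
  problem for order zero and vanishes otherwise.\<close>

lemma du_eq:
  assumes "\<nu> \<in> multi_indices" "v \<in> M"
  shows "(A (\<lambda>_. 0) y (du \<nu> y) + rest \<nu> y) \<bullet> v = (A (\<lambda>_. 0) z (du \<nu> z) + rest \<nu> z) \<bullet> v"
proof (cases "\<nu> = (\<lambda>_. 0)")
  case True
  then show ?thesis using u0_eq[OF assms(2), of y z] by (simp add: rest_zero du_zero)
next
  case False
  then show ?thesis using du_eq_zero[OF assms(1) _ assms(2)] by simp
qed

text \<open>Strong induction on the order: \<open>rest \<nu>\<close> contains only derivatives of
  lower order and is differentiable by the induction hypothesis, so \<open>du \<nu>\<close> solves a
  coercive equation with differentiable data.\<close>

lemma du_deriv:
  assumes "\<nu> \<in> multi_indices"
  shows "((\<lambda>t. du \<nu> (y(j := t))) has_vector_derivative du (\<nu>(j := Suc (\<nu> j))) y) (at (y j))"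
  using assms
proof (induction "mi_size \<nu>" arbitrary: \<nu> rule: less_induct)
  case less
  let ?P = "boxes \<nu>"
  define e where "e \<mu> = (\<mu>(j := Suc (\<mu> j)) :: nat \<Rightarrow> nat)" for \<mu>
  \<comment> \<open>The product rule applied to the Leibniz term of S.\<close>
  define T where "T S = A (cnt S) y (du (e (cnt (?P - S))) y) + A (e (cnt S)) y (du (cnt (?P - S)) y)"
    for S
  have \<nu>: "\<nu> \<in> multi_indices" by fact
  have e\<nu>: "e \<nu> \<in> multi_indices" "e \<nu> \<noteq> (\<lambda>_. 0)"
    using multi_index_Suc[OF \<nu>] by (auto simp: e_def fun_eq_iff intro!: exI[of _ j])
  have fP: "finite ?P" by (rule finite_boxes) fact
  have rest: "((\<lambda>t. rest \<nu> (y(j := t))) has_vector_derivative (\<Sum>S\<in>Pow ?P - {{}}. T S)) (at (y j))"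
    unfolding rest_def
  proof (rule has_vector_derivative_sum)
    fix S assume S: "S \<in> Pow ?P - {{}}"
    then have f: "finite S" "finite (?P - S)" using fP finite_subset by auto
    have dA: "((\<lambda>t. A (cnt S) (y(j := t))) has_vector_derivative A (e (cnt S)) y) (at (y j))"
      unfolding e_def by (rule deriv) (rule cnt_multi_index, fact)
    have du: "((\<lambda>t. du (cnt (?P - S)) (y(j := t))) has_vector_derivative du (e (cnt (?P - S))) y) (at (y j))"
      unfolding e_def by (rule less.hyps) (use S mi_size_cnt_diff_less[OF \<nu>] cnt_multi_index f in auto)
    show "((\<lambda>t. A (cnt S) (y(j := t)) (du (cnt (?P - S)) (y(j := t)))) has_vector_derivative T S) (at (y j))"
      using bounded_bilinear.has_vector_derivative[OF bounded_bilinear_blinfun_apply dA du]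
      unfolding T_def by simp
  qed
  \<comment> \<open>The equation defining \<open>du (e \<nu>)\<close> has to be recognised as the
    derivative of the one for \<nu>. Its Leibniz sum regroups into the terms \<open>T S\<close>, and
    \<open>T {}\<close> supplies the unknown derivative together with the derivative of the
    operator.\<close>
  have "A (\<lambda>_. 0) y (du (e \<nu>) y) + rest (e \<nu>) y =
      (\<Sum>S\<in>Pow (boxes (e \<nu>)). A (cnt S) y (du (cnt (boxes (e \<nu>) - S)) y))"
    by (rule leibniz_sum_eq[OF e\<nu>(1), symmetric])
  also have "\<dots> = (\<Sum>S\<in>Pow ?P. T S)"
    unfolding T_def e_def by (rule leibniz_Suc[where g = "\<lambda>a b. A a y (du b y)", OF \<nu> refl])
  also have "\<dots> = T {} + (\<Sum>S\<in>Pow ?P - {{}}. T S)"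
    using fP by (subst sum.remove[of _ "{}"]) auto
  also have "T {} = A (\<lambda>_. 0) y (du (e \<nu>) y) + A (e (\<lambda>_. 0)) y (du \<nu> y)"
    unfolding T_def by simp
  finally have split: "A (\<lambda>_. 0) y (du (e \<nu>) y) + rest (e \<nu>) y =
    A (\<lambda>_. 0) y (du (e \<nu>) y) + A (e (\<lambda>_. 0)) y (du \<nu> y) + (\<Sum>S\<in>Pow ?P - {{}}. T S)" .
  have upd: "y(j := y j) = y" by simp
  show ?case
    unfolding e_def[symmetric]
  proof (rule has_vector_derivative_solution[where c = "c y" and M = M and
        A = "\<lambda>t. A (\<lambda>_. 0) (y(j := t))" and A' = "A (e (\<lambda>_. 0)) y" and
        G = "\<lambda>t. rest \<nu> (y(j := t))" and G' = "\<Sum>S\<in>Pow ?P - {{}}. T S"], unfold upd)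
    show "((\<lambda>t. A (\<lambda>_. 0) (y(j := t))) has_vector_derivative A (e (\<lambda>_. 0)) y) (at (y j))"
      unfolding e_def by (rule deriv) simp
    fix v assume v: "v \<in> M"
    show "(A (\<lambda>_. 0) y (du (e \<nu>) y) + A (e (\<lambda>_. 0)) y (du \<nu> y) + (\<Sum>S\<in>Pow ?P - {{}}. T S)) \<bullet> v = 0"
      unfolding split[symmetric] by (rule du_eq_zero) fact+
  qed (use rest M c coercive du_mem[OF \<nu>] du_mem[OF e\<nu>(1)] du_eq[OF \<nu>] in auto)
qed

definition energy :: "(nat \<Rightarrow> real) \<Rightarrow> 'h \<Rightarrow> real" where
  "energy y v = sqrt (A (\<lambda>_. 0) y v \<bullet> v)"

lemma energy_sq: "v \<in> M \<Longrightarrow> (energy y v)\<^sup>2 = A (\<lambda>_. 0) y v \<bullet> v"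
proof -
  assume v: "v \<in> M"
  have "0 \<le> c y * (norm v)\<^sup>2" using c[of y] by simp
  then show ?thesis unfolding energy_def using coercive[OF v, of y] by simp
qed

lemma energy_nonneg: "v \<in> M \<Longrightarrow> 0 \<le> energy y v"
  using energy_sq[of v y] unfolding energy_def by (metis real_sqrt_ge_zero zero_le_power2)

lemma energy_du_le:
  assumes "1 \<le> \<delta>" "1 \<le> \<kappa>" "\<And>j. 0 \<le> \<beta> j"
    and bound: "\<And>\<nu> v w. \<nu> \<in> multi_indices \<Longrightarrow> v \<in> M \<Longrightarrow> w \<in> M \<Longrightarrow> \<bar>A \<nu> y v \<bullet> w\<bar> \<le>
      \<kappa> * mi_power \<beta> \<nu> * fact (mi_size \<nu>) powr \<delta> * energy y v * energy y w"
    and \<nu>: "\<nu> \<in> multi_indices"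
  shows "energy y (du \<nu> y) \<le> mi_power (\<lambda>j. 12 * \<kappa> * \<beta> j) \<nu> * phi \<delta> \<nu> * energy y (u0 y)"
proof (rule gevrey_recursion[where x = "\<lambda>\<nu>. energy y (du \<nu> y)"])
  fix \<nu> assume \<nu>: "\<nu> \<in> multi_indices" "\<nu> \<noteq> (\<lambda>_. 0)"
  let ?P = "boxes \<nu>" and ?w = "du \<nu> y"
  let ?s = "\<Sum>S\<in>Pow ?P - {{}}.
        \<kappa> * mi_power \<beta> (cnt S) * fact (card S) powr \<delta> * energy y (du (cnt (?P - S)) y)"
  have fP: "finite ?P" by (rule finite_boxes) fact
  have "energy y ?w * energy y ?w = - (rest \<nu> y \<bullet> ?w)"
    using du_eq_zero[OF \<nu> du_mem[OF \<nu>(1)], of y y] energy_sq[OF du_mem[OF \<nu>(1)], of y]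
    by (simp add: inner_add_left power2_eq_square)
  also have "\<dots> = (\<Sum>S\<in>Pow ?P - {{}}. - (A (cnt S) y (du (cnt (?P - S)) y) \<bullet> ?w))"
    unfolding rest_def by (simp add: inner_sum_left sum_negf)
  also have "\<dots> \<le> (\<Sum>S\<in>Pow ?P - {{}}.
      \<kappa> * mi_power \<beta> (cnt S) * fact (card S) powr \<delta> * energy y (du (cnt (?P - S)) y) * energy y ?w)"
  proof (rule sum_mono)
    fix S assume "S \<in> Pow ?P - {{}}"
    then have "finite S" "finite (?P - S)" using fP finite_subset by auto
    then show "- (A (cnt S) y (du (cnt (?P - S)) y) \<bullet> ?w) \<le>
      \<kappa> * mi_power \<beta> (cnt S) * fact (card S) powr \<delta> * energy y (du (cnt (?P - S)) y) * energy y ?w"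
      using bound[OF cnt_multi_index du_mem[OF cnt_multi_index] du_mem[OF \<nu>(1)], of S "?P - S" y y]
      by (simp add: mi_size_cnt)
  qed
  also have "\<dots> = ?s * energy y ?w" by (simp add: sum_distrib_right)
  finally have *: "energy y ?w * energy y ?w \<le> ?s * energy y ?w" .
  have "0 \<le> energy y (du (cnt (?P - S)) y)" for S
    using fP by (intro energy_nonneg du_mem cnt_multi_index) auto
  \<comment> \<open>Covers the case of zero energy, where the factor \<open>energy y ?w\<close>
    cannot be cancelled.\<close>
  then have "0 \<le> ?s" using assms by (intro sum_nonneg mult_nonneg_nonneg mi_power_nonneg) auto
  then show "energy y ?w \<le> ?s"
    using * energy_nonneg[OF du_mem[OF \<nu>(1)], of y y] by (cases "energy y ?w = 0") (auto intro: mult_right_le_imp_le)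
qed (use assms energy_nonneg[OF u0] in \<open>auto simp: du_zero\<close>)

end

subsection \<open>The Hilbert space of square integrable functions\<close>

definition sq_int :: "('a::euclidean_space \<Rightarrow> 'b::euclidean_space) \<Rightarrow> bool" where
  "sq_int f \<longleftrightarrow> f \<in> borel_measurable lebesgue \<and> integrable lebesgue (\<lambda>x. (norm (f x))\<^sup>2)"

lemma sq_int_zero [simp]: "sq_int (\<lambda>x. 0)"
  unfolding sq_int_def by simp

lemma sq_int_scaleR: "sq_int f \<Longrightarrow> sq_int (\<lambda>x. c *\<^sub>R f x)"
  unfolding sq_int_def by (auto simp: power_mult_distrib)

lemma sq_int_uminus: "sq_int f \<Longrightarrow> sq_int (\<lambda>x. - f x)"
  using sq_int_scaleR[of f "-1"] by simp

lemma norm_add_sq_le: "(norm (a + b))\<^sup>2 \<le> 2 * (norm a)\<^sup>2 + 2 * (norm (b::'b::real_inner))\<^sup>2"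
proof -
  have "0 \<le> (norm (a - b))\<^sup>2" by simp
  then show ?thesis
    by (simp add: power2_norm_eq_inner inner_add inner_diff inner_commute)
qed

lemma sq_int_add:
  assumes "sq_int f" "sq_int g"
  shows "sq_int (\<lambda>x. f x + g x)"
proof -
  have m: "f \<in> borel_measurable lebesgue" "g \<in> borel_measurable lebesgue"
    using assms unfolding sq_int_def by auto
  have "integrable lebesgue (\<lambda>x. (norm (f x + g x))\<^sup>2)"
  proof (rule Bochner_Integration.integrable_bound)
    show "integrable lebesgue (\<lambda>x. 2 * (norm (f x))\<^sup>2 + 2 * (norm (g x))\<^sup>2)"
      using assms unfolding sq_int_def by auto
  qed (use m norm_add_sq_le in auto)
  then show ?thesis using m unfolding sq_int_def by auto
qed

lemma sq_int_diff: "sq_int f \<Longrightarrow> sq_int g \<Longrightarrow> sq_int (\<lambda>x. f x - g x)"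
  using sq_int_add[of f "\<lambda>x. - g x"] sq_int_uminus[of g] by simp

lemma sq_int_inner:
  assumes "sq_int f" "sq_int g"
  shows "integrable lebesgue (\<lambda>x. f x \<bullet> g x)"
proof (rule Bochner_Integration.integrable_bound)
  show "integrable lebesgue (\<lambda>x. (norm (f x))\<^sup>2 + (norm (g x))\<^sup>2)"
    using assms unfolding sq_int_def by auto
  show "AE x in lebesgue. norm (f x \<bullet> g x) \<le> norm ((norm (f x))\<^sup>2 + (norm (g x))\<^sup>2)"
  proof (rule AE_I2)
    fix x
    have "\<bar>f x \<bullet> g x\<bar> \<le> norm (f x) * norm (g x)" by (rule Cauchy_Schwarz_ineq2)
    moreover have "0 \<le> (norm (f x) - norm (g x))\<^sup>2" by simp
    moreover have "0 \<le> norm (f x) * norm (g x)" by simp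
    ultimately show "norm (f x \<bullet> g x) \<le> norm ((norm (f x))\<^sup>2 + (norm (g x))\<^sup>2)"
      unfolding power2_diff by simp
  qed
qed (use assms in \<open>auto simp: sq_int_def\<close>)

\<comment> \<open>The domain D is a term and cannot index a type. The type is therefore the space
  over the whole of the ambient space, and functions on D enter by extension with zero.\<close>
quotient_type (overloaded) ('a, 'b) l2 = "'a::euclidean_space \<Rightarrow> 'b::euclidean_space" /
  partial: "\<lambda>f g. sq_int f \<and> sq_int g \<and> (AE x in lebesgue. f x = g x)"
proof (rule part_equivpI)
  show "\<exists>f::'a \<Rightarrow> 'b. sq_int f \<and> sq_int f \<and> (AE x in lebesgue. f x = f x)"
    by (rule exI[of _ "\<lambda>x. 0"]) simp
  show "transp (\<lambda>f g::'a \<Rightarrow> 'b. sq_int f \<and> sq_int g \<and> (AE x in lebesgue. f x = g x))"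
  proof (rule transpI)
    fix f g h :: "'a \<Rightarrow> 'b"
    assume "sq_int f \<and> sq_int g \<and> (AE x in lebesgue. f x = g x)"
      and "sq_int g \<and> sq_int h \<and> (AE x in lebesgue. g x = h x)"
    then show "sq_int f \<and> sq_int h \<and> (AE x in lebesgue. f x = h x)"
      by (auto elim: AE_mp)
  qed
qed (auto intro!: sympI simp: eq_commute)

instantiation l2 :: (euclidean_space, euclidean_space) real_vector
begin

lift_definition zero_l2 :: "('a, 'b) l2" is "\<lambda>x. 0" by simp

lift_definition plus_l2 :: "('a, 'b) l2 \<Rightarrow> ('a, 'b) l2 \<Rightarrow> ('a, 'b) l2" is "\<lambda>f g x. f x + g x"
  by (auto intro: sq_int_add elim!: AE_mp)

lift_definition minus_l2 :: "('a, 'b) l2 \<Rightarrow> ('a, 'b) l2 \<Rightarrow> ('a, 'b) l2" is "\<lambda>f g x. f x - g x"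
  by (auto intro: sq_int_diff elim!: AE_mp)

lift_definition uminus_l2 :: "('a, 'b) l2 \<Rightarrow> ('a, 'b) l2" is "\<lambda>f x. - f x"
  by (auto intro: sq_int_uminus elim!: AE_mp)

lift_definition scaleR_l2 :: "real \<Rightarrow> ('a, 'b) l2 \<Rightarrow> ('a, 'b) l2" is "\<lambda>c f x. c *\<^sub>R f x"
  by (auto intro: sq_int_scaleR elim!: AE_mp)

instance
proof
  fix a b c :: "('a, 'b) l2" and r s :: real
  show "a + b + c = a + (b + c)"
    by transfer (auto intro!: sq_int_add simp: algebra_simps)
  show "a + b = b + a" by transfer (auto intro!: sq_int_add simp: algebra_simps)
  show "0 + a = a" by transfer auto
  show "- a + a = 0" by transfer auto
  show "a - b = a + - b" by transfer (auto intro!: sq_int_diff)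
  show "r *\<^sub>R (a + b) = r *\<^sub>R a + r *\<^sub>R b"
    by transfer (auto intro!: sq_int_scaleR sq_int_add simp: algebra_simps)
  show "(r + s) *\<^sub>R a = r *\<^sub>R a + s *\<^sub>R a"
    by transfer (auto intro!: sq_int_scaleR sq_int_add simp: algebra_simps)
  show "r *\<^sub>R s *\<^sub>R a = (r * s) *\<^sub>R a"
    by transfer (auto intro!: sq_int_scaleR)
  show "1 *\<^sub>R a = a" by transfer auto
qed

end

instantiation l2 :: (euclidean_space, euclidean_space) real_inner
begin

lift_definition inner_l2 :: "('a, 'b) l2 \<Rightarrow> ('a, 'b) l2 \<Rightarrow> real" is
  "\<lambda>f g. integral\<^sup>L lebesgue (\<lambda>x. f x \<bullet> g x)"
  by (rule integral_cong_AE) (auto simp: sq_int_def elim!: AE_mp)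

definition norm_l2 :: "('a, 'b) l2 \<Rightarrow> real" where "norm_l2 x = sqrt (x \<bullet> x)"
definition dist_l2 :: "('a, 'b) l2 \<Rightarrow> ('a, 'b) l2 \<Rightarrow> real" where "dist_l2 x y = norm (x - y)"
definition sgn_l2 :: "('a, 'b) l2 \<Rightarrow> ('a, 'b) l2" where "sgn_l2 x = x /\<^sub>R norm x"
definition uniformity_l2 :: "(('a, 'b) l2 \<times> ('a, 'b) l2) filter" where
  "uniformity_l2 = (INF e\<in>{0<..}. principal {(x, y). dist x y < e})"
definition open_l2 :: "('a, 'b) l2 set \<Rightarrow> bool" where
  "open_l2 U = (\<forall>x\<in>U. \<forall>\<^sub>F (x', y) in uniformity. x' = x \<longrightarrow> y \<in> U)"

instance
proof
  fix a b c :: "('a, 'b) l2" and r :: real and U :: "('a, 'b) l2 set"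
  show "a \<bullet> b = b \<bullet> a" by transfer (simp add: inner_commute)
  show "(a + b) \<bullet> c = a \<bullet> c + b \<bullet> c"
    by transfer (simp add: inner_add_left sq_int_inner)
  show "(r *\<^sub>R a) \<bullet> b = r * (a \<bullet> b)"
    by transfer simp
  show "0 \<le> a \<bullet> a" by transfer simp
  show "(a \<bullet> a = 0) = (a = 0)"
  proof transfer
    fix f :: "'a \<Rightarrow> 'b"
    assume "sq_int f \<and> sq_int f \<and> (AE x in lebesgue. f x = f x)"
    then have f: "sq_int f" by simp
    then show "((LINT x|lebesgue. f x \<bullet> f x) = 0) =
        (sq_int f \<and> sq_int (\<lambda>x. 0::'b) \<and> (AE x in lebesgue. f x = 0))"
      using integral_nonneg_eq_0_iff_AE[OF sq_int_inner[OF f f]] by simp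
  qed
qed (auto simp: norm_l2_def dist_l2_def sgn_l2_def uniformity_l2_def open_l2_def)

end

lemma sq_int_rep: "sq_int (rep_l2 x)"
  using Quotient3_rep_reflp[OF Quotient3_l2, of x] by simp

lemma abs_rep_l2 [simp]: "abs_l2 (rep_l2 x) = x"
  by (rule Quotient3_abs_rep[OF Quotient3_l2])

lemma abs_l2_eq_iff: "sq_int f \<Longrightarrow> sq_int g \<Longrightarrow> abs_l2 f = abs_l2 g \<longleftrightarrow> (AE x in lebesgue. f x = g x)"
  using Quotient3_rel[OF Quotient3_l2, of f g] by auto

lemma rep_abs_l2: "sq_int f \<Longrightarrow> AE x in lebesgue. rep_l2 (abs_l2 f) x = f x"
  by (subst abs_l2_eq_iff[symmetric]) (auto simp: sq_int_rep)

lemma abs_l2_add: "sq_int f \<Longrightarrow> sq_int g \<Longrightarrow> abs_l2 f + abs_l2 g = abs_l2 (\<lambda>x. f x + g x)"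
  by (rule plus_l2.abs_eq) (auto simp: eq_onp_def)

lemma abs_l2_diff: "sq_int f \<Longrightarrow> sq_int g \<Longrightarrow> abs_l2 f - abs_l2 g = abs_l2 (\<lambda>x. f x - g x)"
  by (rule minus_l2.abs_eq) (auto simp: eq_onp_def)

lemma abs_l2_scaleR: "sq_int f \<Longrightarrow> c *\<^sub>R abs_l2 f = abs_l2 (\<lambda>x. c *\<^sub>R f x)"
  by (rule scaleR_l2.abs_eq) (auto simp: eq_onp_def)

lemma abs_l2_inner: "sq_int f \<Longrightarrow> sq_int g \<Longrightarrow> abs_l2 f \<bullet> abs_l2 g = (LINT x|lebesgue. f x \<bullet> g x)"
  by (rule inner_l2.abs_eq) (auto simp: eq_onp_def)

lemma abs_l2_norm: "sq_int f \<Longrightarrow> norm (abs_l2 f) = sqrt (LINT x|lebesgue. (norm (f x))\<^sup>2)"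
  by (simp add: norm_l2_def abs_l2_inner power2_norm_eq_inner)

lemma nn_integral_abs_l2:
  assumes "sq_int f"
  shows "(\<integral>\<^sup>+x. ennreal ((norm (f x))\<^sup>2) \<partial>lebesgue) = ennreal ((norm (abs_l2 f))\<^sup>2)"
  using assms unfolding sq_int_def
  by (simp add: nn_integral_eq_integral abs_l2_norm assms)

text \<open>Where \<open>\<Sum>k. 4 ^ k * (norm (f (Suc k) x - f k x))\<^sup>2\<close> is finite, the increments at \<open>x\<close>
  are bounded by a multiple of \<open>1 / 2 ^ k\<close>.\<close>

lemma fast_Cauchy_convergent_AE:
  fixes f :: "nat \<Rightarrow> 'a::euclidean_space \<Rightarrow> 'b::euclidean_space"
  assumes f: "\<And>k. sq_int (f k)"
    and fast: "\<And>k. norm (abs_l2 (f (Suc k)) - abs_l2 (f k)) \<le> (1/4) ^ k"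
  shows "AE x in lebesgue. convergent (\<lambda>n. f n x)"
proof -
  let ?d = "\<lambda>k x. f (Suc k) x - f k x"
  have d: "sq_int (?d k)" for k using f by (intro sq_int_diff)
  have dm [measurable]: "?d k \<in> borel_measurable lebesgue" for k using d[of k] unfolding sq_int_def by simp
  \<comment> \<open>The squared increments have integrals at most \<open>(1/16) ^ k\<close>; the
    weight \<open>4 ^ k\<close> still leaves a convergent geometric series and gives summability
    pointwise.\<close>
  have "(\<integral>\<^sup>+x. (\<Sum>k. ennreal (4 ^ k * (norm (?d k x))\<^sup>2)) \<partial>lebesgue) =
      (\<Sum>k. \<integral>\<^sup>+x. ennreal (4 ^ k * (norm (?d k x))\<^sup>2) \<partial>lebesgue)"
    by (rule nn_integral_suminf) measurable
  also have "\<dots> \<le> (\<Sum>k. ennreal ((1/4) ^ k))"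
  proof (rule suminf_le)
    fix k
    have "(\<integral>\<^sup>+x. ennreal (4 ^ k * (norm (?d k x))\<^sup>2) \<partial>lebesgue) =
        ennreal (4 ^ k) * (\<integral>\<^sup>+x. ennreal ((norm (?d k x))\<^sup>2) \<partial>lebesgue)"
      by (subst nn_integral_cmult[symmetric]) (auto simp: ennreal_mult)
    also have "\<dots> = ennreal (4 ^ k * (norm (abs_l2 (?d k)))\<^sup>2)"
      by (simp add: nn_integral_abs_l2[OF d] ennreal_mult)
    also have "\<dots> \<le> ennreal (4 ^ k * ((1/4) ^ k)\<^sup>2)"
      using fast[of k] f by (intro ennreal_leI mult_left_mono power_mono) (auto simp: abs_l2_diff)
    also have "4 ^ k * ((1/4) ^ k)\<^sup>2 = (1/4 :: real) ^ k"
      by (simp add: power2_eq_square power_mult_distrib[symmetric] flip: mult.assoc)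
    finally show "(\<integral>\<^sup>+x. ennreal (4 ^ k * (norm (?d k x))\<^sup>2) \<partial>lebesgue) \<le> ennreal ((1/4) ^ k)" .
  qed auto
  also have "\<dots> = ennreal (\<Sum>k. (1/4) ^ k)"
    by (rule suminf_ennreal2) (auto intro!: summable_geometric)
  also have "\<dots> < \<infinity>" by simp
  finally have "(\<integral>\<^sup>+x. (\<Sum>k. ennreal (4 ^ k * (norm (?d k x))\<^sup>2)) \<partial>lebesgue) \<noteq> \<infinity>" by simp
  then have "AE x in lebesgue. (\<Sum>k. ennreal (4 ^ k * (norm (?d k x))\<^sup>2)) \<noteq> \<infinity>"
    by (intro nn_integral_PInf_AE) auto
  then show ?thesis
  proof (rule AE_mp, intro AE_I2 impI)
    fix x
    define s where "s = (\<Sum>k. ennreal (4 ^ k * (norm (?d k x))\<^sup>2))"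
    assume "(\<Sum>k. ennreal (4 ^ k * (norm (?d k x))\<^sup>2)) \<noteq> \<infinity>"
    then have "s \<noteq> \<infinity>" unfolding s_def .
    then obtain C where C: "0 \<le> C" "s = ennreal C" by (cases s) auto
    have bnd: "norm (?d k x) \<le> sqrt C * (1/2) ^ k" for k
    proof -
      have "(\<Sum>i\<in>{k}. ennreal (4 ^ i * (norm (?d i x))\<^sup>2)) \<le> s"
        unfolding s_def by (rule sum_le_suminf) auto
      then have "ennreal (4 ^ k * (norm (?d k x))\<^sup>2) \<le> ennreal C"
        unfolding C(2) by simp
      then have "4 ^ k * (norm (?d k x))\<^sup>2 \<le> C" using C(1) by (simp only: ennreal_le_iff)
      moreover have "(2::real) ^ k * 2 ^ k = 4 ^ k" by (subst power_mult_distrib[symmetric]) simp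
      then have "4 ^ k * (norm (?d k x))\<^sup>2 = (2 ^ k * norm (?d k x))\<^sup>2"
        by (simp only: power_mult_distrib power2_eq_square[of "2 ^ k"])
      ultimately have "2 ^ k * norm (?d k x) \<le> sqrt C"
        by (simp add: real_le_rsqrt)
      then show ?thesis by (simp add: field_simps power_one_over)
    qed
    have "summable (\<lambda>k. ?d k x)"
    proof (rule summable_norm_cancel, rule summable_comparison_test)
      show "summable (\<lambda>k. sqrt C * (1/2) ^ k)" by (intro summable_mult summable_geometric) auto
      show "\<exists>N. \<forall>n\<ge>N. norm (norm (?d n x)) \<le> sqrt C * (1/2) ^ n" using bnd by auto
    qed
    then have "convergent (\<lambda>n. \<Sum>k<n. ?d k x)" by (simp add: summable_iff_convergent)
    then have "convergent (\<lambda>n. f 0 x + (\<Sum>k<n. ?d k x))" by (intro convergent_add convergent_const)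
    moreover have "f 0 x + (\<Sum>k<n. ?d k x) = f n x" for n
      using sum_lessThan_telescope[of "\<lambda>k. f k x" n] by simp
    ultimately show "convergent (\<lambda>n. f n x)" by simp
  qed
qed

instance l2 :: (euclidean_space, euclidean_space) complete_space
proof
  fix X :: "nat \<Rightarrow> ('a, 'b) l2" assume X: "Cauchy X"
  have "\<forall>k. \<exists>N. \<forall>m\<ge>N. \<forall>n\<ge>N. dist (X m) (X n) < (1/4) ^ k"
    using X unfolding Cauchy_def by simp
  then obtain N where N: "\<And>k m n. N k \<le> m \<Longrightarrow> N k \<le> n \<Longrightarrow> dist (X m) (X n) < (1/4) ^ k" by metis
  \<comment> \<open>The sum dominates every earlier threshold \<open>N i\<close>, and the summand k
    makes r strictly increasing.\<close>
  define r where "r k = (\<Sum>i\<le>k. N i) + k" for k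
  have r: "strict_mono r" unfolding strict_mono_Suc_iff r_def by simp
  have Nr: "N k \<le> r m" if "k \<le> m" for k m
  proof -
    have "N k \<le> (\<Sum>i\<le>m. N i)" using that by (intro member_le_sum) auto
    then show ?thesis unfolding r_def by simp
  qed
  have fast: "dist (X (r m)) (X (r k)) \<le> (1/4) ^ k" if "k \<le> m" for k m
    using N[of k "r m" "r k"] Nr that by (simp add: less_imp_le)
  define f where "f k = rep_l2 (X (r k))" for k
  have f: "sq_int (f k)" for k unfolding f_def by (rule sq_int_rep)
  have absf: "abs_l2 (f k) = X (r k)" for k unfolding f_def by simp
  have fm [measurable]: "f k \<in> borel_measurable lebesgue" for k using f unfolding sq_int_def by simp
  have conv: "AE x in lebesgue. convergent (\<lambda>n. f n x)"
    by (rule fast_Cauchy_convergent_AE[OF f])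
      (use fast in \<open>simp add: absf flip: dist_norm\<close>)
  define g where "g x = lim (\<lambda>n. f n x)" for x
  have gm [measurable]: "g \<in> borel_measurable lebesgue"
    unfolding g_def by (rule borel_measurable_lim_metric) simp
  \<comment> \<open>Fatou's lemma carries the Cauchy bound over to the pointwise limit g. It shows
    at once that \<open>g - f k\<close> is square integrable and how small it is.\<close>
  have fatou: "(\<integral>\<^sup>+x. ennreal ((norm (g x - f k x))\<^sup>2) \<partial>lebesgue) \<le> ennreal (((1/4) ^ k)\<^sup>2)" for k
  proof -
    have "(\<integral>\<^sup>+x. ennreal ((norm (g x - f k x))\<^sup>2) \<partial>lebesgue) =
        (\<integral>\<^sup>+x. liminf (\<lambda>n. ennreal ((norm (f n x - f k x))\<^sup>2)) \<partial>lebesgue)"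
    proof (rule nn_integral_cong_AE, use conv in \<open>rule AE_mp\<close>, intro AE_I2 impI)
      fix x assume "convergent (\<lambda>n. f n x)"
      then have "(\<lambda>n. f n x) \<longlonglongrightarrow> g x" unfolding g_def by (simp add: convergent_LIMSEQ_iff)
      then have "(\<lambda>n. ennreal ((norm (f n x - f k x))\<^sup>2)) \<longlonglongrightarrow> ennreal ((norm (g x - f k x))\<^sup>2)"
        by (intro tendsto_intros) auto
      then show "ennreal ((norm (g x - f k x))\<^sup>2) = liminf (\<lambda>n. ennreal ((norm (f n x - f k x))\<^sup>2))"
        using lim_imp_Liminf by force
    qed
    also have "\<dots> \<le> liminf (\<lambda>n. \<integral>\<^sup>+x. ennreal ((norm (f n x - f k x))\<^sup>2) \<partial>lebesgue)"
      by (rule nn_integral_liminf) measurable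
    also have "\<dots> \<le> liminf (\<lambda>n. ennreal (((1/4) ^ k)\<^sup>2))"
    proof (rule Liminf_mono, rule eventually_sequentiallyI[of k])
      fix n assume "k \<le> n"
      then have "(norm (abs_l2 (\<lambda>x. f n x - f k x)))\<^sup>2 \<le> ((1/4) ^ k)\<^sup>2"
        using fast[of k n] f by (intro power_mono) (auto simp: dist_norm absf abs_l2_diff[symmetric])
      then show "(\<integral>\<^sup>+x. ennreal ((norm (f n x - f k x))\<^sup>2) \<partial>lebesgue) \<le> ennreal (((1/4) ^ k)\<^sup>2)"
        using f by (subst nn_integral_abs_l2) (auto intro: sq_int_diff ennreal_leI)
    qed
    also have "\<dots> = ennreal (((1/4) ^ k)\<^sup>2)" by (simp add: Liminf_const)
    finally show ?thesis .
  qed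
  have gf: "sq_int (\<lambda>x. g x - f k x)" for k
    unfolding sq_int_def
  proof (intro conjI integrableI_bounded)
    show "(\<integral>\<^sup>+x. ennreal (norm ((norm (g x - f k x))\<^sup>2)) \<partial>lebesgue) < \<infinity>"
      using fatou[of k] by (simp add: order_le_less_trans)
  qed measurable
  have g: "sq_int g" using sq_int_add[OF gf[of 0] f[of 0]] by simp
  have "dist (X (r k)) (abs_l2 g) \<le> (1/4) ^ k" for k
  proof -
    have "ennreal ((norm (abs_l2 (\<lambda>x. g x - f k x)))\<^sup>2) \<le> ennreal (((1/4) ^ k)\<^sup>2)"
      unfolding nn_integral_abs_l2[OF gf, symmetric] by (rule fatou)
    then have "(norm (abs_l2 (\<lambda>x. g x - f k x)))\<^sup>2 \<le> ((1/4) ^ k)\<^sup>2" by simp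
    then have "norm (abs_l2 (\<lambda>x. g x - f k x)) \<le> (1/4) ^ k" by (rule power2_le_imp_le) simp
    then show ?thesis using f g by (simp add: dist_norm norm_minus_commute absf abs_l2_diff[symmetric])
  qed
  then have "(\<lambda>k. dist (X (r k)) (abs_l2 g)) \<longlonglongrightarrow> 0"
    by (intro tendsto_sandwich[OF _ _ tendsto_const LIMSEQ_realpow_zero[of "1/4"]])
      (auto intro!: always_eventually)
  then have "(X \<circ> r) \<longlonglongrightarrow> abs_l2 g" by (subst tendsto_dist_iff) (simp add: o_def)
  then show "convergent X"
    using Cauchy_converges_subseq[OF X r] convergent_def by blast
qed

subsection \<open>Test functions\<close>

lemma Ck_Suc_imp_Ck: "Ck (Suc k) \<phi> \<Longrightarrow> Ck k \<phi>"
proof (induction k arbitrary: \<phi>)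
  case 0
  then show ?case
    by (auto intro!: continuous_at_imp_continuous_on differentiable_imp_continuous_within)
qed auto

lemma Ck_const: "Ck k (\<lambda>x. c)"
proof (induction k arbitrary: c)
  case (Suc k)
  then show ?case by (simp add: frechet_derivative_const)
qed simp

lemma frechet_derivative_add:
  "\<phi> differentiable (at x) \<Longrightarrow> \<psi> differentiable (at x) \<Longrightarrow>
   frechet_derivative (\<lambda>x. \<phi> x + \<psi> x) (at x) b =
     frechet_derivative \<phi> (at x) b + frechet_derivative \<psi> (at x) b"
  by (subst frechet_derivative_at[symmetric, OF has_derivative_add])
    (auto simp: frechet_derivative_works)

lemma frechet_derivative_mult:
  fixes \<phi> \<psi> :: "'a::euclidean_space \<Rightarrow> real"
  shows "\<phi> differentiable (at x) \<Longrightarrow> \<psi> differentiable (at x) \<Longrightarrow>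
   frechet_derivative (\<lambda>x. \<phi> x * \<psi> x) (at x) b =
     \<phi> x * frechet_derivative \<psi> (at x) b + frechet_derivative \<phi> (at x) b * \<psi> x"
  by (subst frechet_derivative_at[symmetric, OF has_derivative_mult])
    (auto simp: frechet_derivative_works)

lemma Ck_add: "Ck k \<phi> \<Longrightarrow> Ck k \<psi> \<Longrightarrow> Ck k (\<lambda>x. \<phi> x + \<psi> x)"
proof (induction k arbitrary: \<phi> \<psi>)
  case 0
  then show ?case by (auto intro: continuous_intros)
next
  case (Suc k)
  then show ?case by (simp add: frechet_derivative_add)
qed

lemma Ck_mult: "Ck k \<phi> \<Longrightarrow> Ck k \<psi> \<Longrightarrow> Ck k (\<lambda>x. \<phi> x * \<psi> x)"
proof (induction k arbitrary: \<phi> \<psi>)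
  case 0
  then show ?case by (auto intro: continuous_intros)
next
  case (Suc k)
  have "Ck k \<phi>" "Ck k \<psi>" using Suc.prems Ck_Suc_imp_Ck by auto
  then show ?case using Suc by (auto simp: frechet_derivative_mult intro!: Ck_add Suc.IH)
qed

lemma Ck_cmult: "Ck k \<phi> \<Longrightarrow> Ck k (\<lambda>x. c * \<phi> x)"
  by (rule Ck_mult[OF Ck_const])

lemma Ck_prod: "finite I \<Longrightarrow> (\<And>i. i \<in> I \<Longrightarrow> Ck k (\<phi> i)) \<Longrightarrow> Ck k (\<lambda>x. \<Prod>i\<in>I. \<phi> i x)"
  by (induction I rule: finite_induct) (auto intro: Ck_const Ck_mult)

section \<open>Smooth bump functions on boxes\<close>

definition flat :: "real poly \<Rightarrow> real \<Rightarrow> real" where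
  "flat p t = (if 0 < t then poly p (1 / t) * exp (- (1 / t)) else 0)"

lemma tendsto_poly_exp_0: "((\<lambda>s::real. poly p s * exp (- s)) \<longlongrightarrow> 0) at_top"
proof -
  have "((\<lambda>s. \<Sum>i\<le>degree p. coeff p i * (s ^ i / exp s)) \<longlongrightarrow> (\<Sum>i\<le>degree p. coeff p i * 0)) at_top"
    by (intro tendsto_intros tendsto_power_div_exp_0)
  moreover have "(\<lambda>s. \<Sum>i\<le>degree p. coeff p i * (s ^ i / exp s)) = (\<lambda>s. poly p s * exp (- s))"
    by (auto simp: poly_altdef exp_minus sum_distrib_left divide_inverse mult_ac)
  ultimately show ?thesis by simp
qed

text \<open>In \<open>s = 1 / t\<close> differentiation by t is \<open>- s\<^sup>2\<close> times
  differentiation by s, which sends \<open>p(s) exp(-s)\<close> to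
  \<open>s\<^sup>2 (p - p')(s) exp(-s)\<close>. Thus the family with p varying is closed under
  differentiation, and smoothness of all orders follows by induction with p arbitrary.\<close>

lemma flat_has_derivative:
  "(flat p has_real_derivative flat (monom 1 2 * (p - pderiv p)) t) (at t)"
proof -
  consider "t > 0" | "t < 0" | "t = 0" by linarith
  then show ?thesis
  proof cases
    case 1
    have d: "((\<lambda>t. poly p (1 / t) * exp (- (1 / t))) has_real_derivative
        flat (monom 1 2 * (p - pderiv p)) t) (at t)"
      using 1 unfolding flat_def
      by (auto intro!: derivative_eq_intros DERIV_chain2[OF poly_DERIV]
          simp: poly_monom field_simps power2_eq_square)
    have ev: "\<forall>\<^sub>F s in nhds t. poly p (1 / s) * exp (- (1 / s)) = flat p s"
      using eventually_nhds_in_open[of "{0<..}" t] 1 by (auto elim!: eventually_mono simp: flat_def)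
    show ?thesis using DERIV_cong_ev[OF refl ev refl] d by (simp only:)
  next
    case 2
    have d: "((\<lambda>t. 0) has_real_derivative flat (monom 1 2 * (p - pderiv p)) t) (at t)"
      using 2 unfolding flat_def by simp
    have ev: "\<forall>\<^sub>F s in nhds t. 0 = flat p s"
      using eventually_nhds_in_open[of "{..<0}" t] 2 by (auto elim!: eventually_mono simp: flat_def)
    show ?thesis using DERIV_cong_ev[OF refl ev refl] d by (simp only:)
  next
    case 3
    \<comment> \<open>Dividing by h multiplies the polynomial in \<open>1 / h\<close> by its
      variable, hence \<open>pCons 0 p\<close>.\<close>
    have "((\<lambda>h. poly (pCons 0 p) (inverse h) * exp (- inverse h)) \<longlongrightarrow> 0) (at_right 0)"
      by (rule filterlim_compose[OF tendsto_poly_exp_0 filterlim_inverse_at_top_right])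
    then have "((\<lambda>h. (flat p (t + h) - flat p t) / h) \<longlongrightarrow> 0) (at_right 0)"
      by (rule Lim_transform_eventually)
        (auto simp: eventually_at_right_field flat_def 3 inverse_eq_divide intro!: exI[of _ 1])
    moreover have "((\<lambda>h. (flat p (t + h) - flat p t) / h) \<longlongrightarrow> 0) (at_left 0)"
      by (rule Lim_transform_eventually[OF tendsto_const])
        (auto simp: eventually_at_left_field flat_def 3 intro!: exI[of _ "-1"])
    ultimately have "((\<lambda>h. (flat p (t + h) - flat p t) / h) \<longlongrightarrow> 0) (at 0)"
      by (simp add: filterlim_split_at)
    then show ?thesis unfolding DERIV_def by (simp add: 3 flat_def)
  qed
qed

lemma flat_inner_has_derivative:
  fixes b :: "'a::euclidean_space"
  shows "((\<lambda>x. flat p (c * (x \<bullet> b - l))) has_derivative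
    (\<lambda>h. c * (h \<bullet> b) * flat (monom 1 2 * (p - pderiv p)) (c * (x \<bullet> b - l)))) (at x)"
proof -
  have "((\<lambda>x. c * (x \<bullet> b - l)) has_derivative (\<lambda>h. c * (h \<bullet> b))) (at x)"
    by (auto intro!: derivative_eq_intros)
  from has_derivative_compose[OF this flat_has_derivative[of p "c * (x \<bullet> b - l)", unfolded has_field_derivative_def]]
  show ?thesis by (simp add: mult_ac)
qed

lemma Ck_flat_inner:
  fixes b :: "'a::euclidean_space"
  shows "Ck k (\<lambda>x. flat p (c * (x \<bullet> b - l)))"
proof (induction k arbitrary: p)
  case 0
  show ?case
    by (auto intro!: continuous_at_imp_continuous_on has_derivative_continuous flat_inner_has_derivative)
next
  case (Suc k)
  have "frechet_derivative (\<lambda>x. flat p (c * (x \<bullet> b - l))) (at x) b' =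
      c * (b' \<bullet> b) * flat (monom 1 2 * (p - pderiv p)) (c * (x \<bullet> b - l))" for x b'
    using frechet_derivative_at[OF flat_inner_has_derivative[of p c b l x]] by metis
  moreover have "(\<lambda>x. flat p (c * (x \<bullet> b - l))) differentiable (at x)" for x
    unfolding differentiable_def using flat_inner_has_derivative by blast
  ultimately show ?case using Suc by (auto intro: Ck_cmult)
qed

text \<open>One factor for each face of the box, positive on the inner side only. Larger n steepens
  the factors, and the limit is the indicator function of the open box.\<close>

definition box_bump :: "nat \<Rightarrow> 'a::euclidean_space \<Rightarrow> 'a \<Rightarrow> 'a \<Rightarrow> real" where
  "box_bump n l r x = (\<Prod>b\<in>Basis. flat 1 (real (Suc n) * (x \<bullet> b - l \<bullet> b)) *
     flat 1 (- real (Suc n) * (x \<bullet> b - r \<bullet> b)))"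

lemma box_bump_Ck: "Ck k (box_bump n l r)"
  unfolding box_bump_def[abs_def] by (intro Ck_prod Ck_mult Ck_flat_inner finite_Basis)

lemma flat_1_nonzero_iff: "flat 1 t \<noteq> 0 \<longleftrightarrow> 0 < t"
  unfolding flat_def by simp

lemma box_bump_support: "{x. box_bump n l r x \<noteq> 0} = box l r"
  unfolding box_bump_def
  by (auto simp: flat_1_nonzero_iff box_def zero_less_mult_iff mult_less_0_iff simp del: of_nat_Suc)

lemma flat_1_bounds: "0 \<le> flat 1 t" "flat 1 t \<le> 1"
  unfolding flat_def by auto

lemma box_bump_bounds: "0 \<le> box_bump n l r x" "box_bump n l r x \<le> 1"
  unfolding box_bump_def
  by (auto intro!: prod_nonneg prod_le_1 mult_nonneg_nonneg mult_le_one flat_1_bounds)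

lemma box_bump_test: "cbox l r \<subseteq> D \<Longrightarrow> box_bump n l r \<in> test_functions D"
proof -
  assume D: "cbox l r \<subseteq> D"
  have sub: "closure (box l r) \<subseteq> cbox l r" by (rule closure_minimal[OF box_subset_cbox closed_cbox])
  then have "compact (closure (box l r))" using compact_cbox by (metis bounded_cbox bounded_subset closed_closure compact_eq_bounded_closed)
  then show ?thesis unfolding test_functions_def using D sub by (auto simp: box_bump_support box_bump_Ck)
qed

lemma flat_1_tendsto:
  assumes "0 < s" shows "(\<lambda>n. flat 1 (real (Suc n) * s)) \<longlonglongrightarrow> 1"
proof -
  have "(\<lambda>n. exp (- (inverse (real (Suc n)) * inverse s))) \<longlonglongrightarrow> exp (- (0 * inverse s))"
    by (intro tendsto_intros LIMSEQ_inverse_real_of_nat)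
  then show ?thesis using assms
    by (simp add: flat_def zero_less_mult_iff divide_inverse del: of_nat_Suc)
qed

lemma box_bump_tendsto: "(\<lambda>n. box_bump n l r x) \<longlonglongrightarrow> indicator (box l r) x"
proof (cases "x \<in> box l r")
  case True
  have "(\<lambda>n. box_bump n l r x) \<longlonglongrightarrow> (\<Prod>b\<in>(Basis::'a set). 1 * 1)"
    unfolding box_bump_def
  proof (intro tendsto_prod tendsto_mult)
    fix b :: 'a assume b: "b \<in> Basis"
    show "(\<lambda>n. flat 1 (real (Suc n) * (x \<bullet> b - l \<bullet> b))) \<longlonglongrightarrow> 1"
      by (rule flat_1_tendsto) (use True b in \<open>auto simp: box_def\<close>)
    have "(\<lambda>n. flat 1 (real (Suc n) * (r \<bullet> b - x \<bullet> b))) \<longlonglongrightarrow> 1"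
      by (rule flat_1_tendsto) (use True b in \<open>auto simp: box_def\<close>)
    then show "(\<lambda>n. flat 1 (- real (Suc n) * (x \<bullet> b - r \<bullet> b))) \<longlonglongrightarrow> 1"
      by (simp only: mult_minus_left minus_mult_right minus_diff_eq)
  qed
  then show ?thesis using True by simp
next
  case False
  then have "box_bump n l r x = 0" for n using box_bump_support[of n l r] by blast
  then show ?thesis using False by simp
qed

section \<open>The fundamental lemma of the calculus of variations\<close>

lemma Ck_continuous: "Ck k \<phi> \<Longrightarrow> continuous_on UNIV \<phi>"
proof (induction k arbitrary: \<phi>)
  case (Suc k)
  show ?case by (rule Suc.IH[OF Ck_Suc_imp_Ck[OF Suc.prems]])
qed simp

lemma continuous_borel_measurable_lebesgue:
  fixes g :: "'a::euclidean_space \<Rightarrow> 'b::euclidean_space"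
  shows "continuous_on UNIV g \<Longrightarrow> g \<in> borel_measurable lebesgue"
  by (rule measurable_completion) (use borel_measurable_continuous_onI[of g] in simp)

lemma integral_lebesgue_on_support:
  fixes g :: "'a::euclidean_space \<Rightarrow> real"
  assumes "D \<in> sets lebesgue" "\<And>x. x \<notin> D \<Longrightarrow> g x = 0"
  shows "(LINT x|lebesgue_on D. g x) = (LINT x|lebesgue. g x)"
proof -
  have "(LINT x|lebesgue_on D. g x) = (LINT x|lebesgue. indicator D x *\<^sub>R g x)"
    using assms(1) by (intro integral_restrict_space) simp
  also have "(\<lambda>x. indicator D x *\<^sub>R g x) = g" using assms(2) by (auto simp: indicator_def fun_eq_iff)
  finally show ?thesis .
qed

text \<open>Bump functions tend boundedly to indicators of boxes, so h has integral zero over every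
  box whose closure lies in D. A Dynkin argument extends this to the Borel subsets of such a box,
  among them the sets where h is positive or negative, and countably many boxes cover D.\<close>

lemma fundamental_lemma:
  fixes h :: "'a::euclidean_space \<Rightarrow> real"
  assumes D: "open D" and h: "integrable (lebesgue_on D) h"
    and ortho: "\<And>\<phi>. \<phi> \<in> test_functions D \<Longrightarrow> (LINT x|lebesgue_on D. h x * \<phi> x) = 0"
  shows "AE x in lebesgue_on D. h x = 0"
proof -
  have Dm: "D \<in> sets lebesgue" using D by (simp add: borel_open)
  define H where "H x = indicator D x *\<^sub>R h x" for x
  have iH: "integrable lebesgue H"
    using h integrable_restrict_space[of D lebesgue h] Dm unfolding H_def by simp
  have Hm [measurable]: "H \<in> borel_measurable lebesgue" using iH by simp
  have iHs: "set_integrable lebesgue A H" if "A \<in> sets borel" for A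
    unfolding set_integrable_def using integrable_mult_indicator[OF _ iH, of A] that by simp
  have box: "(LINT x:box l r|lebesgue. H x) = 0" if lr: "cbox l r \<subseteq> D" for l r
  proof -
    have mb: "box_bump n l r \<in> borel_measurable lebesgue" for n
      using continuous_borel_measurable_lebesgue[OF Ck_continuous[OF box_bump_Ck]] .
    have "(\<lambda>n. LINT x|lebesgue. H x * box_bump n l r x) \<longlonglongrightarrow>
        (LINT x|lebesgue. H x * indicator (box l r) x)"
    proof (rule integral_dominated_convergence[where w = "\<lambda>x. norm (H x)"])
      show "AE x in lebesgue. (\<lambda>n. H x * box_bump n l r x) \<longlonglongrightarrow> H x * indicator (box l r) x"
        by (intro AE_I2 tendsto_intros box_bump_tendsto)
      show "AE x in lebesgue. norm (H x * box_bump n l r x) \<le> norm (H x)" for n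
        using box_bump_bounds[of n l r] by (intro AE_I2) (simp add: abs_mult mult_left_le)
      show "(\<lambda>x. H x * indicator (box l r) x) \<in> borel_measurable lebesgue"
        by (intro borel_measurable_times Hm borel_measurable_indicator) auto
    qed (use iH mb in auto)
    moreover have "(LINT x|lebesgue. H x * box_bump n l r x) = 0" for n
    proof -
      have "(LINT x|lebesgue. H x * box_bump n l r x) =
          (LINT x|lebesgue_on D. h x * box_bump n l r x)"
        using Dm by (subst integral_restrict_space) (auto simp: H_def mult.assoc)
      then show ?thesis using ortho[OF box_bump_test[OF lr]] by simp
    qed
    ultimately show ?thesis
      unfolding set_lebesgue_integral_def by (simp add: LIMSEQ_const_iff mult.commute)
  qed
  have zero: "AE x in lebesgue. x \<in> box l r \<longrightarrow> H x = 0" if lr: "cbox l r \<subseteq> D" for l r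
  proof -
    \<comment> \<open>Induction over the sigma-algebra generated by the intersection-stable family
      of boxes. The fixed box confines everything to D.\<close>
    have gen: "(LINT x:box l r \<inter> A|lebesgue. H x) = 0" if "A \<in> sets borel" for A
    proof -
      let ?G = "range (\<lambda>(a, b). box a b :: 'a set)"
      have Bm: "box l r \<in> sets borel" by simp
      have A: "A \<in> sigma_sets UNIV ?G"
        using that by (subst (asm) borel_eq_box) simp
      have sub: "sigma_sets UNIV ?G = sets borel"
        by (subst borel_eq_box) simp
      have IS: "Int_stable ?G"
        by (auto simp: Int_stable_def box_Int_box)
      have G: "?G \<subseteq> Pow UNIV" by simp
      show ?thesis using IS G A
      proof (induction rule: sigma_sets_induct_disjoint)
        case (basic A)
        then obtain a b where A: "A = box a b" by auto
        have "cbox (\<Sum>i\<in>Basis. max (l \<bullet> i) (a \<bullet> i) *\<^sub>R i) (\<Sum>i\<in>Basis. min (r \<bullet> i) (b \<bullet> i) *\<^sub>R i) \<subseteq> cbox l r"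
          by (auto simp: mem_box)
        then show ?case unfolding A box_Int_box using lr by (intro box) auto
      next
        case (compl A)
        have Am: "A \<in> sets borel" using compl(1) sub by simp
        have "(LINT x:box l r|lebesgue. H x) =
            (LINT x:(box l r \<inter> A) \<union> (box l r \<inter> (UNIV - A))|lebesgue. H x)"
          by (rule arg_cong[where f = "\<lambda>S. LINT x:S|lebesgue. H x"]) auto
        also have "\<dots> = (LINT x:box l r \<inter> A|lebesgue. H x) + (LINT x:box l r \<inter> (UNIV - A)|lebesgue. H x)"
          by (intro set_integral_Un iHs) (use Am Bm in auto)
        finally show ?case using box[OF lr] compl(2) by simp
      next
        case (union A)
        have Am: "A i \<in> sets borel" for i using union(2) sub by auto
        have "(LINT x:box l r \<inter> (\<Union>i. A i)|lebesgue. H x) = (LINT x:(\<Union>i. box l r \<inter> A i)|lebesgue. H x)"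
          by (rule arg_cong[where f = "\<lambda>S. LINT x:S|lebesgue. H x"]) auto
        also have "\<dots> = (\<Sum>i. (LINT x:box l r \<inter> A i|lebesgue. H x))"
        proof (rule lebesgue_integral_countable_add)
          show "set_integrable lebesgue (\<Union>i. box l r \<inter> A i) H" using Am Bm by (intro iHs) auto
          show "box l r \<inter> A i \<in> sets lebesgue" for i using Am[of i] by auto
          show "i \<noteq> j \<Longrightarrow> (box l r \<inter> A i) \<inter> (box l r \<inter> A j) = {}" for i j
            using union(1) unfolding disjoint_family_on_def by blast
        qed
        finally show ?case using union(3) by simp
      qed (auto simp: set_lebesgue_integral_def)
    qed
    \<comment> \<open>\<open>gen\<close> applies to Borel sets, while \<open>H\<close> is only
      Lebesgue measurable, so the sign sets are taken from a Borel version of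
      \<open>H\<close>.\<close>
    obtain H' where H': "H' \<in> borel_measurable lborel" "AE x in lborel. H x = H' x"
      using completion_ex_borel_measurable_real[OF Hm] by blast
    have eq: "AE x in lebesgue. H x = H' x" using AE_completion[OF H'(2)] .
    have part: "AE x in lebesgue. x \<in> box l r \<inter> {x. 0 < s * H' x} \<longrightarrow> H x = 0" for s :: real
    proof -
      let ?A = "{x. 0 < s * H' x}"
      have A: "?A \<in> sets borel" using H'(1) by measurable
      have "AE x in lebesgue. 0 \<le> indicator (box l r \<inter> ?A) x * (s * H x)"
        using eq by (rule AE_mp) (auto simp: indicator_def)
      moreover have "integrable lebesgue (\<lambda>x. indicator (box l r \<inter> ?A) x * (s * H x))"
        using integrable_mult_right[OF iHs[of "box l r \<inter> ?A", unfolded set_integrable_def], of s] A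
        by (simp add: mult_ac)
      moreover have "(LINT x|lebesgue. indicator (box l r \<inter> ?A) x * (s * H x)) = 0"
      proof -
        have "(LINT x|lebesgue. indicator (box l r \<inter> ?A) x * (s * H x)) =
            s * (LINT x:box l r \<inter> ?A|lebesgue. H x)"
          unfolding set_lebesgue_integral_def by (simp add: mult.left_commute flip: integral_mult_right_zero)
        then show ?thesis using gen[OF A] by simp
      qed
      ultimately have "AE x in lebesgue. indicator (box l r \<inter> ?A) x * (s * H x) = 0"
        using integral_nonneg_eq_0_iff_AE by blast
      then show ?thesis by (rule AE_mp) (auto simp: indicator_def intro!: AE_I2 split: if_splits)
    qed
    from eq part[of 1] part[of "-1"] show ?thesis
    proof eventually_elim
      case (elim x)
      then show ?case by (cases "H' x" "0::real" rule: linorder_cases) auto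
    qed
  qed
  obtain \<D> where \<D>: "countable \<D>" "\<D> \<subseteq> Pow D" "\<And>X. X \<in> \<D> \<Longrightarrow> \<exists>a b. X = cbox a b" "\<Union>\<D> = D"
    using open_countable_Union_open_cbox[OF D] by metis
  have "AE x in lebesgue. \<forall>X\<in>\<D>. x \<in> X \<longrightarrow> H x = 0"
    unfolding AE_ball_countable[OF \<D>(1)]
  proof
    fix X assume X: "X \<in> \<D>"
    then obtain a b where ab: "X = cbox a b" using \<D>(3) by blast
    \<comment> \<open>The cover consists of closed boxes, but \<open>zero\<close> speaks of open
      ones; the faces form a null set.\<close>
    have "cbox a b - box a b \<in> null_sets lebesgue"
      using negligible_frontier_interval[of a b] by (simp add: negligible_iff_null_sets)
    then have "AE x in lebesgue. x \<notin> cbox a b - box a b" by (rule AE_not_in)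
    moreover have "AE x in lebesgue. x \<in> box a b \<longrightarrow> H x = 0"
      using X \<D>(2) ab by (intro zero) auto
    ultimately show "AE x in lebesgue. x \<in> X \<longrightarrow> H x = 0"
      unfolding ab by eventually_elim blast
  qed
  then have "AE x in lebesgue. x \<in> D \<longrightarrow> h x = 0"
    by (rule AE_mp) (use \<D>(4) in \<open>auto simp: H_def indicator_def intro!: AE_I2\<close>)
  then show ?thesis using Dm by (subst AE_restrict_space_iff) auto
qed

section \<open>Integration by parts for compactly supported functions\<close>

lemma integrable_compact_support:
  fixes g :: "'a::euclidean_space \<Rightarrow> 'b::euclidean_space"
  assumes "continuous_on UNIV g" "compact K" "\<And>x. x \<notin> K \<Longrightarrow> g x = 0"
  shows "integrable lborel g"
proof -
  have "integrable lborel (\<lambda>x. indicator K x *\<^sub>R g x)"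
    using assms by (intro borel_integrable_compact) (auto intro: continuous_on_subset)
  moreover have "(\<lambda>x. indicator K x *\<^sub>R g x) = g" using assms(3) by (auto simp: indicator_def)
  ultimately show ?thesis by simp
qed

lemma integrable_compact_support_lebesgue:
  fixes g :: "'a::euclidean_space \<Rightarrow> 'b::euclidean_space"
  assumes "continuous_on UNIV g" "compact K" "\<And>x. x \<notin> K \<Longrightarrow> g x = 0"
  shows "integrable lebesgue g"
  using integrable_compact_support[OF assms] integrable_completion[of g lborel]
    borel_measurable_continuous_onI[OF assms(1)] by simp

lemma lborel_integral_translation:
  fixes g :: "'a::euclidean_space \<Rightarrow> real"
  assumes "continuous_on UNIV g"
  shows "(LINT x|lborel. g (x + t)) = (LINT x|lborel. g x)"
proof -
  have d: "distr lborel borel (\<lambda>x. t + x) = (lborel :: 'a measure)"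
    using lborel_affine[of 1 t] by (simp add: density_1)
  have "(LINT x|distr lborel borel (\<lambda>x. t + x). g x) = (LINT x|lborel. g (t + x))"
    by (rule integral_distr) (use borel_measurable_continuous_onI[OF assms] in auto)
  then show ?thesis unfolding d by (simp add: add.commute)
qed

lemma frechet_derivative_outside:
  fixes \<phi> :: "'a::euclidean_space \<Rightarrow> real"
  assumes "compact K" "\<And>x. x \<notin> K \<Longrightarrow> \<phi> x = 0" "x \<notin> K"
  shows "frechet_derivative \<phi> (at x) b = 0"
proof -
  have "open (- K)" using assms(1) by (simp add: compact_imp_closed open_Compl)
  have "((\<lambda>x. 0::real) has_derivative (\<lambda>h. 0)) (at x)" by simp
  then have "(\<phi> has_derivative (\<lambda>h. 0)) (at x)"
    by (rule has_derivative_transform_within_open[OF _ \<open>open (- K)\<close>]) (use assms in auto)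
  from frechet_derivative_at[OF this] show ?thesis by metis
qed

lemma directional_DERIV:
  fixes \<phi> :: "'a::euclidean_space \<Rightarrow> real"
  assumes "\<And>x. \<phi> differentiable (at x)"
  shows "((\<lambda>t. \<phi> (x + t *\<^sub>R b)) has_real_derivative frechet_derivative \<phi> (at (x + t *\<^sub>R b)) b) (at t)"
proof -
  have d: "(\<phi> has_derivative frechet_derivative \<phi> (at (x + t *\<^sub>R b))) (at (x + t *\<^sub>R b))"
    using assms frechet_derivative_works by blast
  have "((\<lambda>t. x + t *\<^sub>R b) has_derivative (\<lambda>h. h *\<^sub>R b)) (at t)"
    by (auto intro!: derivative_eq_intros)
  from has_derivative_compose[OF this d]
  have "((\<lambda>t. \<phi> (x + t *\<^sub>R b)) has_derivative (\<lambda>h. frechet_derivative \<phi> (at (x + t *\<^sub>R b)) (h *\<^sub>R b))) (at t)" .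
  moreover have "linear (frechet_derivative \<phi> (at (x + t *\<^sub>R b)))"
    using d has_derivative_linear by blast
  ultimately show ?thesis
    unfolding has_field_derivative_def by (simp add: linear_scale mult.commute[of _ "frechet_derivative _ _ _"])
qed

text \<open>The integrals of the difference quotients vanish by translation invariance, and
  they converge to the integral of the derivative by dominated convergence.\<close>

lemma integral_frechet_derivative_zero:
  fixes \<phi> :: "'a::euclidean_space \<Rightarrow> real"
  assumes \<phi>: "Ck 1 \<phi>" and K: "compact K" "\<And>x. x \<notin> K \<Longrightarrow> \<phi> x = 0" and b: "b \<in> Basis"
  shows "(LINT x|lebesgue. frechet_derivative \<phi> (at x) b) = 0"
proof -
  let ?d = "\<lambda>x. frechet_derivative \<phi> (at x) b"
  have diff: "\<And>x. \<phi> differentiable (at x)" and cd: "continuous_on UNIV ?d"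
    using \<phi> b by auto
  have c: "continuous_on UNIV \<phi>" by (rule Ck_continuous[OF \<phi>])
  have i\<phi>: "integrable lborel \<phi>" by (rule integrable_compact_support[OF c K])
  have m\<phi> [measurable]: "\<phi> \<in> borel_measurable lborel" using i\<phi> by simp
  have "bounded (?d ` K)"
    using K cd by (intro compact_imp_bounded compact_continuous_image) (auto intro: continuous_on_subset)
  then obtain C where C: "0 < C" "\<And>x. x \<in> K \<Longrightarrow> \<bar>?d x\<bar> \<le> C"
    unfolding bounded_pos by auto
  have dC: "\<bar>?d x\<bar> \<le> C" for x
    using C frechet_derivative_outside[OF K] by (cases "x \<in> K") auto
  obtain R where R: "\<And>x. x \<in> K \<Longrightarrow> norm x \<le> R"
    using K(1) compact_imp_bounded bounded_iff by metis
  \<comment> \<open>The increments have length at most 1, so outside radius \<open>R + 1\<close>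
    neither x nor the shifted point meets K and all difference quotients vanish.\<close>
  let ?K = "cball 0 (R + 1) :: 'a set"
  define F where "F n x = (\<phi> (x + inverse (real (Suc n)) *\<^sub>R b) - \<phi> x) / inverse (real (Suc n))" for n x
  have inv: "0 < inverse (real (Suc n))" "inverse (real (Suc n)) \<le> 1" for n
    by (simp_all add: inverse_le_1_iff)
  have bound: "\<bar>F n x\<bar> \<le> C * indicator ?K x" for n x
  proof (cases "x \<in> ?K")
    case True
    let ?h = "inverse (real (Suc n))"
    obtain z where "\<phi> (x + ?h *\<^sub>R b) - \<phi> (x + 0 *\<^sub>R b) = (?h - 0) * ?d (x + z *\<^sub>R b)"
      using MVT2[OF inv(1)[of n], of "\<lambda>t. \<phi> (x + t *\<^sub>R b)" "\<lambda>t. ?d (x + t *\<^sub>R b)"]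
        directional_DERIV[OF diff] by blast
    then have "F n x = ?d (x + z *\<^sub>R b)" unfolding F_def by simp
    then show ?thesis using True dC by simp
  next
    case False
    then have x: "R + 1 < norm x" by simp
    have "norm x \<le> norm (x + inverse (real (Suc n)) *\<^sub>R b) + norm (inverse (real (Suc n)) *\<^sub>R b)"
      by (metis add_diff_cancel norm_triangle_ineq4)
    also have "norm (inverse (real (Suc n)) *\<^sub>R b) \<le> 1" using inv[of n] b by simp
    finally have "x \<notin> K" "x + inverse (real (Suc n)) *\<^sub>R b \<notin> K" using R x by force+
    then show ?thesis unfolding F_def using K(2) False by simp
  qed
  have lim: "(\<lambda>n. F n x) \<longlonglongrightarrow> ?d x" for x
  proof -
    have "((\<lambda>t. (\<phi> (x + t *\<^sub>R b) - \<phi> x) / t) \<longlongrightarrow> ?d x) (at 0)"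
      using directional_DERIV[OF diff, of x b 0] unfolding DERIV_def by simp
    moreover have "filterlim (\<lambda>n. inverse (real (Suc n))) (at 0) sequentially"
      unfolding filterlim_at using LIMSEQ_inverse_real_of_nat by auto
    ultimately show ?thesis unfolding F_def by (rule filterlim_compose)
  qed
  have "(\<lambda>n. LINT x|lborel. F n x) \<longlonglongrightarrow> (LINT x|lborel. ?d x)"
  proof (rule integral_dominated_convergence[where w = "\<lambda>x. C * indicator ?K x"])
    show "integrable lborel (\<lambda>x. C * indicator ?K x)"
      using emeasure_lborel_cball_finite[of 0 "R + 1"]
      by (intro integrable_mult_right integrable_real_indicator) auto
    show "F n \<in> borel_measurable lborel" for n unfolding F_def[abs_def] by measurable
    show "?d \<in> borel_measurable lborel" using borel_measurable_continuous_onI[OF cd] by simp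
  qed (use bound lim in auto)
  moreover have "(LINT x|lborel. F n x) = 0" for n
  proof -
    let ?t = "inverse (real (Suc n)) *\<^sub>R b"
    have it: "integrable lborel (\<lambda>x. \<phi> (x + ?t))"
    proof (rule integrable_compact_support)
      show "continuous_on UNIV (\<lambda>x. \<phi> (x + ?t))"
        by (intro continuous_on_compose2[OF c] continuous_intros) auto
      show "compact ((\<lambda>x. x - ?t) ` K)" using K(1) by (intro compact_continuous_image continuous_intros)
      show "x \<notin> (\<lambda>x. x - ?t) ` K \<Longrightarrow> \<phi> (x + ?t) = 0" for x
        using K(2)[of "x + ?t"] by (metis add_diff_cancel imageI)
    qed
    have "(LINT x|lborel. F n x) = ((LINT x|lborel. \<phi> (x + ?t)) - (LINT x|lborel. \<phi> x)) / inverse (real (Suc n))"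
      unfolding F_def using it i\<phi> by simp
    then show ?thesis using lborel_integral_translation[OF c, of ?t] by simp
  qed
  ultimately have "(LINT x|lborel. ?d x) = 0" by (simp add: LIMSEQ_const_iff)
  then show ?thesis
    using integral_completion[of ?d lborel] borel_measurable_continuous_onI[OF cd] by simp
qed

section \<open>Test functions as elements of the Sobolev space\<close>

lemma test_function_Ck: "\<phi> \<in> test_functions D \<Longrightarrow> Ck k \<phi>"
  unfolding test_functions_def by simp

lemma test_function_support:
  assumes "\<phi> \<in> test_functions D"
  shows "\<exists>K. compact K \<and> K \<subseteq> D \<and> (\<forall>x. x \<notin> K \<longrightarrow> \<phi> x = 0)"
  using assms closure_subset[of "{x. \<phi> x \<noteq> 0}"]
  by (intro exI[of _ "closure {x. \<phi> x \<noteq> 0}"]) (auto simp: test_functions_def)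

lemma test_functionI:
  assumes "\<And>k. Ck k \<phi>" "compact K" "K \<subseteq> D" "\<And>x. x \<notin> K \<Longrightarrow> \<phi> x = 0"
  shows "\<phi> \<in> test_functions D"
proof -
  have sub: "closure {x. \<phi> x \<noteq> 0} \<subseteq> K"
    by (rule closure_minimal) (use assms compact_imp_closed in auto)
  then have "compact (closure {x. \<phi> x \<noteq> 0})"
    using assms(2) by (meson bounded_subset closed_closure compact_eq_bounded_closed)
  then show ?thesis unfolding test_functions_def using sub assms by auto
qed

lemma test_function_add:
  assumes "\<phi> \<in> test_functions D" "\<psi> \<in> test_functions D"
  shows "(\<lambda>x. \<phi> x + \<psi> x) \<in> test_functions D"
proof -
  obtain K where "compact K" "K \<subseteq> D" "\<And>x. x \<notin> K \<Longrightarrow> \<phi> x = 0"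
    using test_function_support[OF assms(1)] by blast
  moreover obtain L where "compact L" "L \<subseteq> D" "\<And>x. x \<notin> L \<Longrightarrow> \<psi> x = 0"
    using test_function_support[OF assms(2)] by blast
  ultimately show ?thesis
    using assms by (intro test_functionI[of _ "K \<union> L"] Ck_add test_function_Ck[OF assms(1)]
        test_function_Ck[OF assms(2)]) auto
qed

lemma test_function_cmult:
  assumes "\<phi> \<in> test_functions D"
  shows "(\<lambda>x. c * \<phi> x) \<in> test_functions D"
proof -
  obtain K where "compact K" "K \<subseteq> D" "\<And>x. x \<notin> K \<Longrightarrow> \<phi> x = 0"
    using test_function_support[OF assms] by blast
  then show ?thesis
    using assms by (intro test_functionI[of _ K] Ck_cmult test_function_Ck[OF assms]) auto
qed

lemma Ck_1_frechet_continuous: "Ck 1 \<phi> \<Longrightarrow> b \<in> Basis \<Longrightarrow> continuous_on UNIV (\<lambda>x. frechet_derivative \<phi> (at x) b)"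
  by simp

lemma Ck_1_differentiable: "Ck 1 \<phi> \<Longrightarrow> \<phi> differentiable (at x)"
  by simp

text \<open>The product inherits the compact support of \<psi>, so its derivative has integral zero
  while \<phi> may be arbitrary at infinity.\<close>

lemma integration_by_parts:
  fixes \<phi> \<psi> :: "'a::euclidean_space \<Rightarrow> real"
  assumes \<phi>: "Ck 1 \<phi>" and \<psi>: "Ck 1 \<psi>"
    and K: "compact K" "\<And>x. x \<notin> K \<Longrightarrow> \<psi> x = 0" and b: "b \<in> Basis"
  shows "(LINT x|lebesgue. \<phi> x * frechet_derivative \<psi> (at x) b) =
    - (LINT x|lebesgue. frechet_derivative \<phi> (at x) b * \<psi> x)"
proof -
  have i1: "integrable lebesgue (\<lambda>x. \<phi> x * frechet_derivative \<psi> (at x) b)"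
    using Ck_continuous[OF \<phi>] Ck_1_frechet_continuous[OF \<psi> b] frechet_derivative_outside[where \<phi> = \<psi>, OF K]
    by (intro integrable_compact_support_lebesgue[OF _ K(1)] continuous_on_mult) auto
  have i2: "integrable lebesgue (\<lambda>x. frechet_derivative \<phi> (at x) b * \<psi> x)"
    using Ck_continuous[OF \<psi>] Ck_1_frechet_continuous[OF \<phi> b] K(2)
    by (intro integrable_compact_support_lebesgue[OF _ K(1)] continuous_on_mult) auto
  have "(LINT x|lebesgue. frechet_derivative (\<lambda>x. \<phi> x * \<psi> x) (at x) b) = 0"
    by (rule integral_frechet_derivative_zero[OF Ck_mult[OF \<phi> \<psi>] K(1) _ b]) (simp add: K(2))
  moreover have "(\<lambda>x. frechet_derivative (\<lambda>x. \<phi> x * \<psi> x) (at x) b) =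
      (\<lambda>x. \<phi> x * frechet_derivative \<psi> (at x) b + frechet_derivative \<phi> (at x) b * \<psi> x)"
    using frechet_derivative_mult Ck_1_differentiable \<phi> \<psi> by blast
  ultimately show ?thesis using i1 i2 by simp
qed

definition grad :: "('a::euclidean_space \<Rightarrow> real) \<Rightarrow> 'a \<Rightarrow> 'a" where
  "grad \<phi> x = (\<Sum>b\<in>Basis. frechet_derivative \<phi> (at x) b *\<^sub>R b)"

lemma grad_inner: "b \<in> Basis \<Longrightarrow> grad \<phi> x \<bullet> b = frechet_derivative \<phi> (at x) b"
  unfolding grad_def by simp

lemma continuous_compact_support_L2:
  fixes g :: "'a::euclidean_space \<Rightarrow> 'b::euclidean_space"
  assumes D: "D \<in> sets lebesgue" and "continuous_on UNIV g" "compact K" "\<And>x. x \<notin> K \<Longrightarrow> g x = 0"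
  shows "g \<in> L2 D"
proof -
  have "integrable lebesgue (\<lambda>x. (norm (g x))\<^sup>2)"
    using assms by (intro integrable_compact_support_lebesgue[of _ K]) (auto intro!: continuous_intros)
  then have "integrable lebesgue (\<lambda>x. indicator D x *\<^sub>R (norm (g x))\<^sup>2)"
    by (rule integrable_mult_indicator[OF D])
  moreover have "g \<in> borel_measurable (lebesgue_on D)"
    using continuous_borel_measurable_lebesgue[OF assms(2)] by (rule measurable_restrict_space1)
  ultimately show ?thesis
    unfolding L2_def using D by (simp add: integrable_restrict_space)
qed

lemma test_function_L2:
  assumes "D \<in> sets lebesgue" "\<phi> \<in> test_functions D" shows "\<phi> \<in> L2 D"
proof -
  obtain K where "compact K" "K \<subseteq> D" "\<And>x. x \<notin> K \<Longrightarrow> \<phi> x = 0"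
    using test_function_support[OF assms(2)] by blast
  then show ?thesis
    using continuous_compact_support_L2[OF assms(1) Ck_continuous[OF test_function_Ck[OF assms(2)]]] by blast
qed

lemma test_function_weak_grad:
  assumes D: "D \<in> sets lebesgue" and \<phi>: "\<phi> \<in> test_functions D"
  shows "is_weak_grad D \<phi> (grad \<phi>)"
  unfolding is_weak_grad_def
proof (intro conjI ballI)
  have \<phi>1: "Ck 1 \<phi>" by (rule test_function_Ck[OF \<phi>])
  obtain K where K: "compact K" "K \<subseteq> D" "\<And>x. x \<notin> K \<Longrightarrow> \<phi> x = 0"
    using test_function_support[OF \<phi>] by blast
  show "grad \<phi> \<in> L2 D"
  proof (rule continuous_compact_support_L2[OF D _ K(1)])
    show "continuous_on UNIV (grad \<phi>)"
      unfolding grad_def[abs_def] by (intro continuous_intros Ck_1_frechet_continuous[OF \<phi>1])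
    show "x \<notin> K \<Longrightarrow> grad \<phi> x = 0" for x
      unfolding grad_def using frechet_derivative_outside[where \<phi> = \<phi>, OF K(1,3)] by simp
  qed
  fix \<psi> :: "'a \<Rightarrow> real" and b :: 'a assume \<psi>: "\<psi> \<in> test_functions D" and b: "b \<in> Basis"
  obtain L where L: "compact L" "L \<subseteq> D" "\<And>x. x \<notin> L \<Longrightarrow> \<psi> x = 0"
    using test_function_support[OF \<psi>] by blast
  have "(LINT x|lebesgue_on D. \<phi> x * frechet_derivative \<psi> (at x) b) =
      (LINT x|lebesgue. \<phi> x * frechet_derivative \<psi> (at x) b)"
    using L(2) frechet_derivative_outside[where \<phi> = \<psi>, OF L(1,3)] by (intro integral_lebesgue_on_support[OF D]) auto
  also have "\<dots> = - (LINT x|lebesgue. frechet_derivative \<phi> (at x) b * \<psi> x)"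
    by (rule integration_by_parts[OF \<phi>1 test_function_Ck[OF \<psi>] L(1,3) b])
  also have "(LINT x|lebesgue. frechet_derivative \<phi> (at x) b * \<psi> x) =
      (LINT x|lebesgue_on D. frechet_derivative \<phi> (at x) b * \<psi> x)"
    using L by (intro integral_lebesgue_on_support[symmetric, OF D]) auto
  finally show "(LINT x|lebesgue_on D. \<phi> x * frechet_derivative \<psi> (at x) b) =
      - (LINT x|lebesgue_on D. (grad \<phi> x \<bullet> b) * \<psi> x)" by (simp add: grad_inner b)
qed

lemma is_weak_grad_integral:
  "is_weak_grad D v g \<Longrightarrow> \<phi> \<in> test_functions D \<Longrightarrow> b \<in> Basis \<Longrightarrow>
    (LINT x|lebesgue_on D. v x * frechet_derivative \<phi> (at x) b) =
        - (LINT x|lebesgue_on D. (g x \<bullet> b) * \<phi> x)"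
  unfolding is_weak_grad_def by blast

text \<open>Integrating the derivative of \<open>(\<phi> x)\<^sup>2 * (x \<bullet> b)\<close> in direction \<open>b\<close> gives zero.\<close>

lemma poincare_test_function:
  fixes D :: "'a::euclidean_space set"
  assumes D: "D \<in> sets lebesgue" "D \<subseteq> ball 0 R" and \<phi>: "\<phi> \<in> test_functions D"
  shows "(LINT x|lebesgue_on D. (\<phi> x)\<^sup>2) \<le> 4 * R\<^sup>2 * (LINT x|lebesgue_on D. (norm (grad \<phi> x))\<^sup>2)"
proof -
  obtain b :: 'a where b: "b \<in> Basis" using nonempty_Basis by blast
  let ?p = "\<lambda>x. frechet_derivative \<phi> (at x) b"
  have \<phi>1: "Ck 1 \<phi>" by (rule test_function_Ck[OF \<phi>])
  obtain K where K: "compact K" "K \<subseteq> D" "\<And>x. x \<notin> K \<Longrightarrow> \<phi> x = 0" using test_function_support[OF \<phi>] by blast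
  have c\<phi>: "continuous_on UNIV \<phi>" by (rule Ck_continuous[OF \<phi>1])
  have cp: "continuous_on UNIV ?p" by (rule Ck_1_frechet_continuous[OF \<phi>1 b])
  have p0: "x \<notin> K \<Longrightarrow> ?p x = 0" for x using frechet_derivative_outside[where \<phi> = \<phi>, OF K(1,3)] .
  have b': "((\<lambda>x. x \<bullet> b) has_derivative (\<lambda>h. h \<bullet> b)) (at x)" for x
    by (auto intro!: derivative_eq_intros)
  have fb: "frechet_derivative (\<lambda>x. x \<bullet> b) (at x) = (\<lambda>h. h \<bullet> b)" for x
    using frechet_derivative_at[OF b'] by metis
  have Cb: "Ck 1 (\<lambda>x. x \<bullet> b)"
    using b' by (auto simp: fb differentiable_def)
  let ?\<chi> = "\<lambda>x. (\<phi> x * \<phi> x) * (x \<bullet> b)"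
  have C\<phi>\<phi>: "Ck 1 (\<lambda>x. \<phi> x * \<phi> x)" by (rule Ck_mult[OF \<phi>1 \<phi>1])
  have "(LINT x|lebesgue. frechet_derivative ?\<chi> (at x) b) = 0"
    by (rule integral_frechet_derivative_zero[OF Ck_mult[OF C\<phi>\<phi> Cb] K(1) _ b]) (simp add: K(3))
  moreover have d\<chi>: "frechet_derivative ?\<chi> (at x) b = (\<phi> x)\<^sup>2 + 2 * \<phi> x * ?p x * (x \<bullet> b)" for x
    using frechet_derivative_mult[OF Ck_1_differentiable[OF C\<phi>\<phi>] Ck_1_differentiable[OF Cb], of x b]
      frechet_derivative_mult[OF Ck_1_differentiable[OF \<phi>1] Ck_1_differentiable[OF \<phi>1], of x b] b
    by (simp add: fb power2_eq_square algebra_simps)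
  ultimately have zero: "(LINT x|lebesgue. (\<phi> x)\<^sup>2 + 2 * \<phi> x * ?p x * (x \<bullet> b)) = 0" by simp
  have i1: "integrable lebesgue (\<lambda>x. (\<phi> x)\<^sup>2)"
    using c\<phi> K by (intro integrable_compact_support_lebesgue[OF _ K(1)] continuous_intros) auto
  have i2: "integrable lebesgue (\<lambda>x. (?p x)\<^sup>2)"
    using cp p0 by (intro integrable_compact_support_lebesgue[OF _ K(1)] continuous_intros) auto
  have i3: "integrable lebesgue (\<lambda>x. (\<phi> x)\<^sup>2 + 2 * \<phi> x * ?p x * (x \<bullet> b))"
    using c\<phi> cp K(3) by (intro integrable_compact_support_lebesgue[OF _ K(1)] continuous_intros) auto
  \<comment> \<open>Completing the square with \<open>\<phi> + 2 * ?p * (x \<bullet> b)\<close>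
    absorbs the mixed term into half of \<open>\<phi>\<^sup>2\<close>; together with
    \<open>\<bar>x \<bullet> b\<bar> \<le> R\<close> this produces the constant
    \<open>4 * R\<^sup>2\<close>.\<close>
  have pt: "(\<phi> x)\<^sup>2 / 2 - 2 * R\<^sup>2 * (?p x)\<^sup>2 \<le> (\<phi> x)\<^sup>2 + 2 * \<phi> x * ?p x * (x \<bullet> b)" for x
  proof (cases "x \<in> K")
    case True
    then have "norm x \<le> R" using K(2) D(2) by fastforce
    then have "\<bar>x \<bullet> b\<bar> \<le> R" using Basis_le_norm[OF b, of x] by linarith
    then have "(?p x)\<^sup>2 * (x \<bullet> b)\<^sup>2 \<le> (?p x)\<^sup>2 * R\<^sup>2"
      using power_mono[of "\<bar>x \<bullet> b\<bar>" R 2] by (intro mult_left_mono) auto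
    moreover have "0 \<le> (\<phi> x + 2 * ?p x * (x \<bullet> b))\<^sup>2 / 2" by simp
    then have "- (2 * ((?p x)\<^sup>2 * (x \<bullet> b)\<^sup>2)) \<le> (\<phi> x)\<^sup>2 / 2 + 2 * \<phi> x * ?p x * (x \<bullet> b)"
      by (simp add: power2_eq_square algebra_simps)
    ultimately show ?thesis by (simp add: mult_ac)
  qed (use K(3) p0 in simp)
  have "(LINT x|lebesgue. (\<phi> x)\<^sup>2 / 2 - 2 * R\<^sup>2 * (?p x)\<^sup>2) \<le> 0"
    unfolding zero[symmetric] by (rule integral_mono) (use i1 i2 i3 pt in auto)
  then have le: "(LINT x|lebesgue. (\<phi> x)\<^sup>2) \<le> 4 * R\<^sup>2 * (LINT x|lebesgue. (?p x)\<^sup>2)"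
    using i1 i2 by simp
  have L2: "grad \<phi> \<in> L2 D" using test_function_weak_grad[OF D(1) \<phi>] unfolding is_weak_grad_def by blast
  have "(LINT x|lebesgue_on D. (\<phi> x)\<^sup>2) = (LINT x|lebesgue. (\<phi> x)\<^sup>2)"
    using K by (intro integral_lebesgue_on_support[OF D(1)]) auto
  also note le
  also have "(LINT x|lebesgue. (?p x)\<^sup>2) = (LINT x|lebesgue_on D. (?p x)\<^sup>2)"
    using K p0 by (intro integral_lebesgue_on_support[OF D(1), symmetric]) auto
  also have "4 * R\<^sup>2 * \<dots> \<le> 4 * R\<^sup>2 * (LINT x|lebesgue_on D. (norm (grad \<phi> x))\<^sup>2)"
  proof (intro mult_left_mono integral_mono)
    show "integrable (lebesgue_on D) (\<lambda>x. (?p x)\<^sup>2)"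
      using integrable_mult_indicator[OF D(1) i2] D(1) by (simp add: integrable_restrict_space)
    show "integrable (lebesgue_on D) (\<lambda>x. (norm (grad \<phi> x))\<^sup>2)" using L2 unfolding L2_def by simp
    show "(?p x)\<^sup>2 \<le> (norm (grad \<phi> x))\<^sup>2" for x
      using Basis_le_norm[OF b, of "grad \<phi> x"] power_mono[of "\<bar>?p x\<bar>" "norm (grad \<phi> x)" 2]
      by (simp add: grad_inner b)
  qed simp
  finally show ?thesis .
qed

subsection \<open>Multiplication operators\<close>

definition emb :: "'a::euclidean_space set \<Rightarrow> ('a \<Rightarrow> 'b::euclidean_space) \<Rightarrow> ('a, 'b) l2" where
  "emb D g = abs_l2 (\<lambda>x. indicator D x *\<^sub>R g x)"

definition ess_bounded :: "'a::euclidean_space set \<Rightarrow> ('a \<Rightarrow> real) \<Rightarrow> bool" where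
  "ess_bounded D m \<longleftrightarrow> m \<in> borel_measurable (lebesgue_on D) \<and> (\<exists>C. AE x in lebesgue_on D. \<bar>m x\<bar> \<le> C)"

text \<open>The indicator discards the values of m off D, where nothing is known about m.
  Consequently the operator for the constant 1 is the projection onto fields vanishing off
  D.\<close>

definition mulop :: "'a::euclidean_space set \<Rightarrow> ('a \<Rightarrow> real) \<Rightarrow>
    ('a, 'b::euclidean_space) l2 \<Rightarrow> ('a, 'b) l2" where
  "mulop D m F = abs_l2 (\<lambda>x. (indicator D x * m x) *\<^sub>R rep_l2 F x)"

definition mul :: "'a::euclidean_space set \<Rightarrow> ('a \<Rightarrow> real) \<Rightarrow>
    ('a, 'b::euclidean_space) l2 \<Rightarrow>\<^sub>L ('a, 'b) l2" where
  "mul D m = Blinfun (mulop D m)"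

context
  fixes D :: "'a::euclidean_space set"
  assumes D: "D \<in> sets lebesgue"
begin

lemma L2_iff_sq_int: "g \<in> L2 D \<longleftrightarrow> sq_int (\<lambda>x. indicator D x *\<^sub>R g x)"
proof -
  have "(\<lambda>x. (norm (indicator D x *\<^sub>R g x))\<^sup>2) = (\<lambda>x. indicator D x *\<^sub>R (norm (g x))\<^sup>2)"
    by (auto simp: indicator_def)
  then show ?thesis
    using D unfolding L2_def sq_int_def
    by (simp add: borel_measurable_restrict_space_iff integrable_restrict_space)
qed

lemma L2_add: "g \<in> L2 D \<Longrightarrow> h \<in> L2 D \<Longrightarrow> (\<lambda>x. g x + h x) \<in> L2 D"
  unfolding L2_iff_sq_int using sq_int_add by (fastforce simp: scaleR_add_right)

lemma L2_scaleR: "g \<in> L2 D \<Longrightarrow> (\<lambda>x. c *\<^sub>R g x) \<in> L2 D"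
  unfolding L2_iff_sq_int using sq_int_scaleR[of "\<lambda>x. indicator D x *\<^sub>R g x" c]
  by (simp add: mult.commute)

lemma emb_add: "g \<in> L2 D \<Longrightarrow> h \<in> L2 D \<Longrightarrow> emb D (\<lambda>x. g x + h x) = emb D g + emb D h"
  unfolding L2_iff_sq_int emb_def by (simp add: abs_l2_add scaleR_add_right)

lemma emb_scaleR: "g \<in> L2 D \<Longrightarrow> emb D (\<lambda>x. c *\<^sub>R g x) = c *\<^sub>R emb D g"
  unfolding L2_iff_sq_int emb_def by (simp add: abs_l2_scaleR mult.commute)

lemma emb_eqI:
  assumes "g \<in> L2 D" "h \<in> L2 D" "AE x in lebesgue_on D. g x = h x"
  shows "emb D g = emb D h"
proof -
  have "AE x in lebesgue. x \<in> D \<longrightarrow> g x = h x"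
    using assms(3) D by (simp add: AE_restrict_space_iff)
  then have "AE x in lebesgue. indicator D x *\<^sub>R g x = indicator D x *\<^sub>R h x"
    by (rule AE_mp) (auto simp: indicator_def)
  then show ?thesis
    using assms(1,2) unfolding L2_iff_sq_int emb_def by (simp add: abs_l2_eq_iff)
qed

lemma L2_inner_integrable:
  assumes "g \<in> L2 D" "h \<in> L2 D"
  shows "integrable (lebesgue_on D) (\<lambda>x. g x \<bullet> h x)"
proof -
  have "integrable lebesgue (\<lambda>x. (indicator D x *\<^sub>R g x) \<bullet> (indicator D x *\<^sub>R h x))"
    using assms unfolding L2_iff_sq_int by (rule sq_int_inner)
  moreover have "(\<lambda>x. (indicator D x *\<^sub>R g x) \<bullet> (indicator D x *\<^sub>R h x)) =
      (\<lambda>x. indicator D x *\<^sub>R (g x \<bullet> h x))" by (auto simp: indicator_def)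
  ultimately show ?thesis using D by (simp add: integrable_restrict_space)
qed

lemma emb_inner:
  assumes "g \<in> L2 D" "h \<in> L2 D"
  shows "emb D g \<bullet> emb D h = (LINT x|lebesgue_on D. g x \<bullet> h x)"
proof -
  have "emb D g \<bullet> emb D h = (LINT x|lebesgue. (indicator D x *\<^sub>R g x) \<bullet> (indicator D x *\<^sub>R h x))"
    using assms unfolding L2_iff_sq_int emb_def by (rule abs_l2_inner)
  also have "(\<lambda>x. (indicator D x *\<^sub>R g x) \<bullet> (indicator D x *\<^sub>R h x)) =
      (\<lambda>x. indicator D x *\<^sub>R (g x \<bullet> h x))" by (auto simp: indicator_def)
  finally show ?thesis using D by (simp add: integral_restrict_space)
qed

lemma emb_norm: "g \<in> L2 D \<Longrightarrow> norm (emb D g) = sqrt (LINT x|lebesgue_on D. (norm (g x))\<^sup>2)"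
  by (simp add: norm_eq_sqrt_inner emb_inner power2_norm_eq_inner)

lemma sq_int_mult:
  fixes f :: "'a \<Rightarrow> 'b::euclidean_space"
  assumes m: "m \<in> borel_measurable (lebesgue_on D)" "AE x in lebesgue_on D. \<bar>m x\<bar> \<le> C" and f: "sq_int f"
  shows "sq_int (\<lambda>x. (indicator D x * m x) *\<^sub>R f x)"
    and "(LINT x|lebesgue. (norm ((indicator D x * m x) *\<^sub>R f x))\<^sup>2) \<le> C\<^sup>2 * (LINT x|lebesgue. (norm (f x))\<^sup>2)"
proof -
  have mm: "(\<lambda>x. indicator D x * m x) \<in> borel_measurable lebesgue"
    using m(1) D borel_measurable_restrict_space_iff[of D lebesgue m] by simp
  have fm: "f \<in> borel_measurable lebesgue" using f unfolding sq_int_def by simp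
  have "AE x in lebesgue. x \<in> D \<longrightarrow> \<bar>m x\<bar> \<le> C"
    using m(2) D by (simp add: AE_restrict_space_iff)
  then have le: "AE x in lebesgue. (norm ((indicator D x * m x) *\<^sub>R f x))\<^sup>2 \<le> C\<^sup>2 * (norm (f x))\<^sup>2"
  proof (rule AE_mp, intro AE_I2 impI)
    fix x assume x: "x \<in> D \<longrightarrow> \<bar>m x\<bar> \<le> C"
    show "(norm ((indicator D x * m x) *\<^sub>R f x))\<^sup>2 \<le> C\<^sup>2 * (norm (f x))\<^sup>2"
    proof (cases "x \<in> D")
      case True
      then have "\<bar>m x\<bar>\<^sup>2 \<le> C\<^sup>2" using x by (intro power_mono) auto
      then have "\<bar>m x\<bar>\<^sup>2 * (norm (f x))\<^sup>2 \<le> C\<^sup>2 * (norm (f x))\<^sup>2" by (intro mult_right_mono) auto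
      then show ?thesis using True by (simp add: power_mult_distrib)
    qed simp
  qed
  have i: "integrable lebesgue (\<lambda>x. C\<^sup>2 * (norm (f x))\<^sup>2)"
    using f unfolding sq_int_def by simp
  have i': "integrable lebesgue (\<lambda>x. (norm ((indicator D x * m x) *\<^sub>R f x))\<^sup>2)"
    by (rule Bochner_Integration.integrable_bound[OF i]) (use le mm fm in auto)
  then show "sq_int (\<lambda>x. (indicator D x * m x) *\<^sub>R f x)"
    unfolding sq_int_def using mm fm by auto
  have "(LINT x|lebesgue. (norm ((indicator D x * m x) *\<^sub>R f x))\<^sup>2) \<le> (LINT x|lebesgue. C\<^sup>2 * (norm (f x))\<^sup>2)"
    by (rule integral_mono_AE[OF i' i le])
  then show "(LINT x|lebesgue. (norm ((indicator D x * m x) *\<^sub>R f x))\<^sup>2) \<le> C\<^sup>2 * (LINT x|lebesgue. (norm (f x))\<^sup>2)"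
    by simp
qed

lemma sq_int_mulop: "ess_bounded D m \<Longrightarrow> sq_int (\<lambda>x. (indicator D x * m x) *\<^sub>R rep_l2 F x)"
  unfolding ess_bounded_def using sq_int_mult(1) sq_int_rep by blast

lemma mulop_norm_le:
  assumes "m \<in> borel_measurable (lebesgue_on D)" "AE x in lebesgue_on D. \<bar>m x\<bar> \<le> C" "0 \<le> C"
  shows "norm (mulop D m F) \<le> C * norm F"
proof -
  have "norm (mulop D m F) = sqrt (LINT x|lebesgue. (norm ((indicator D x * m x) *\<^sub>R rep_l2 F x))\<^sup>2)"
    unfolding mulop_def by (rule abs_l2_norm) (rule sq_int_mult(1)[OF assms(1,2) sq_int_rep])
  also have "\<dots> \<le> sqrt (C\<^sup>2 * (LINT x|lebesgue. (norm (rep_l2 F x))\<^sup>2))"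
    by (rule real_sqrt_le_mono) (rule sq_int_mult(2)[OF assms(1,2) sq_int_rep])
  also have "\<dots> = C * norm F"
    using abs_l2_norm[OF sq_int_rep, of F] assms(3) by (simp add: real_sqrt_mult)
  finally show ?thesis .
qed

lemma mulop_abs:
  assumes "ess_bounded D m" "sq_int f"
  shows "mulop D m (abs_l2 f) = abs_l2 (\<lambda>x. (indicator D x * m x) *\<^sub>R f x)"
proof -
  have "AE x in lebesgue. (indicator D x * m x) *\<^sub>R rep_l2 (abs_l2 f) x = (indicator D x * m x) *\<^sub>R f x"
    using rep_abs_l2[OF assms(2)] by (rule AE_mp) auto
  moreover have "sq_int (\<lambda>x. (indicator D x * m x) *\<^sub>R f x)"
    using assms sq_int_mult(1) unfolding ess_bounded_def by blast
  ultimately show ?thesis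
    unfolding mulop_def using sq_int_mulop[OF assms(1)] by (subst abs_l2_eq_iff)
qed

lemma bounded_linear_mulop:
  assumes m: "ess_bounded D m"
  shows "bounded_linear (mulop D m :: ('a, 'b::euclidean_space) l2 \<Rightarrow> _)"
proof -
  obtain C where C: "m \<in> borel_measurable (lebesgue_on D)" "AE x in lebesgue_on D. \<bar>m x\<bar> \<le> C"
    using m unfolding ess_bounded_def by blast
  have C': "AE x in lebesgue_on D. \<bar>m x\<bar> \<le> \<bar>C\<bar>" using C(2) by (rule AE_mp) auto
  show ?thesis
  proof (rule bounded_linear_intro)
    fix F G :: "('a, 'b) l2" and r :: real
    show "mulop D m (F + G) = mulop D m F + mulop D m G"
      using mulop_abs[OF m sq_int_add[OF sq_int_rep[of F] sq_int_rep[of G]]]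
        abs_l2_add[OF sq_int_rep[of F] sq_int_rep[of G]]
        abs_l2_add[OF sq_int_mulop[OF m, of F] sq_int_mulop[OF m, of G]]
      by (simp add: mulop_def scaleR_add_right)
    show "mulop D m (r *\<^sub>R F) = r *\<^sub>R mulop D m F"
      using mulop_abs[OF m sq_int_scaleR[OF sq_int_rep[of F], of r]]
        abs_l2_scaleR[OF sq_int_rep[of F], of r]
        abs_l2_scaleR[OF sq_int_mulop[OF m, of F], of r]
      by (simp add: mulop_def mult.commute)
    show "norm (mulop D m F) \<le> norm F * \<bar>C\<bar>"
      using mulop_norm_le[OF C(1) C', of F] by (simp add: mult.commute)
  qed
qed

lemma mul_apply: "ess_bounded D m \<Longrightarrow> blinfun_apply (mul D m) = mulop D m"
  unfolding mul_def by (rule bounded_linear_Blinfun_apply) (rule bounded_linear_mulop)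

text \<open>The passage from the sup norm of a coefficient to an operator norm, by which
  differentiability of \<open>a\<close> in the parameter becomes differentiability of the
  operators.\<close>

lemma mul_norm_le:
  assumes "m \<in> borel_measurable (lebesgue_on D)" "AE x in lebesgue_on D. \<bar>m x\<bar> \<le> C" "0 \<le> C"
  shows "norm (mul D m :: ('a, 'b::euclidean_space) l2 \<Rightarrow>\<^sub>L _) \<le> C"
proof (rule norm_blinfun_bound)
  have "ess_bounded D m" using assms unfolding ess_bounded_def by blast
  then show "norm (blinfun_apply (mul D m) F) \<le> C * norm F" for F :: "('a, 'b) l2"
    using mulop_norm_le[OF assms] by (simp add: mul_apply)
qed fact

lemma ess_bounded_add: "ess_bounded D m \<Longrightarrow> ess_bounded D n \<Longrightarrow> ess_bounded D (\<lambda>x. m x + n x)"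
proof -
  assume m: "ess_bounded D m" and n: "ess_bounded D n"
  then obtain C E where "AE x in lebesgue_on D. \<bar>m x\<bar> \<le> C" "AE x in lebesgue_on D. \<bar>n x\<bar> \<le> E"
    unfolding ess_bounded_def by blast
  then have "AE x in lebesgue_on D. \<bar>m x + n x\<bar> \<le> C + E" by eventually_elim linarith
  then show ?thesis using m n unfolding ess_bounded_def by auto
qed

lemma ess_bounded_cmult: "ess_bounded D m \<Longrightarrow> ess_bounded D (\<lambda>x. c * m x)"
proof -
  assume m: "ess_bounded D m"
  then obtain C where "AE x in lebesgue_on D. \<bar>m x\<bar> \<le> C" unfolding ess_bounded_def by blast
  then have "AE x in lebesgue_on D. \<bar>c * m x\<bar> \<le> \<bar>c\<bar> * C"
    by eventually_elim (simp add: abs_mult mult_left_mono)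
  then show ?thesis using m unfolding ess_bounded_def by auto
qed

lemma mul_add:
  "ess_bounded D m \<Longrightarrow> ess_bounded D n \<Longrightarrow> mul D (\<lambda>x. m x + n x) = mul D m + mul D n"
  by (rule blinfun_eqI)
    (simp add: mul_apply ess_bounded_add blinfun.add_left mulop_def abs_l2_add sq_int_mulop
      distrib_left scaleR_add_left)

lemma mul_cmult:
  assumes m: "ess_bounded D m"
  shows "mul D (\<lambda>x. c * m x) = c *\<^sub>R mul D m"
proof (rule blinfun_eqI)
  fix F :: "('a, 'b) l2"
  have "mulop D (\<lambda>x. c * m x) F = c *\<^sub>R mulop D m F"
    unfolding mulop_def abs_l2_scaleR[OF sq_int_mulop[OF m]] by (simp add: mult.left_commute)
  then show "mul D (\<lambda>x. c * m x) F = (c *\<^sub>R mul D m) F"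
    by (simp add: mul_apply m ess_bounded_cmult blinfun.scaleR_left)
qed

lemma mul_inner:
  assumes "ess_bounded D m"
  shows "mul D m F \<bullet> G = (LINT x|lebesgue. (indicator D x * m x) * (rep_l2 F x \<bullet> rep_l2 G x))"
  unfolding mul_apply[OF assms] mulop_def
  using abs_l2_inner[OF sq_int_mulop[OF assms] sq_int_rep[of G]] by simp

lemma mul_sym: "ess_bounded D m \<Longrightarrow> mul D m F \<bullet> G = F \<bullet> mul D m G"
  using mul_inner[of m F G] mul_inner[of m G F] by (simp add: inner_commute)

lemma mulop_emb:
  assumes "ess_bounded D m" "g \<in> L2 D"
  shows "mulop D m (emb D g) = emb D (\<lambda>x. m x *\<^sub>R g x)"
proof -
  have "(\<lambda>x. (indicator D x * m x) *\<^sub>R (indicator D x *\<^sub>R g x)) = (\<lambda>x. indicator D x *\<^sub>R m x *\<^sub>R g x)"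
    by (auto simp: indicator_def)
  then show ?thesis
    using mulop_abs[OF assms(1)] assms(2) unfolding L2_iff_sq_int emb_def by metis
qed

lemma L2_mult: "ess_bounded D m \<Longrightarrow> g \<in> L2 D \<Longrightarrow> (\<lambda>x. m x *\<^sub>R g x) \<in> L2 D"
proof -
  assume m: "ess_bounded D m" and g: "g \<in> L2 D"
  have "(\<lambda>x. (indicator D x * m x) *\<^sub>R (indicator D x *\<^sub>R g x)) = (\<lambda>x. indicator D x *\<^sub>R m x *\<^sub>R g x)"
    by (auto simp: indicator_def)
  then show ?thesis
    using m g sq_int_mult(1) unfolding L2_iff_sq_int ess_bounded_def by metis
qed

lemma mul_emb_inner:
  assumes "ess_bounded D m" "g \<in> L2 D" "h \<in> L2 D"
  shows "mul D m (emb D g) \<bullet> emb D h = (LINT x|lebesgue_on D. m x * (g x \<bullet> h x))"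
  using assms by (simp add: mul_apply mulop_emb emb_inner L2_mult)

lemma ess_bounded_const: "ess_bounded D (\<lambda>x. c)"
  unfolding ess_bounded_def by auto

lemma rep_l2_L2: "rep_l2 F \<in> L2 D"
  unfolding L2_iff_sq_int using sq_int_mulop[OF ess_bounded_const[of 1], of F] by simp

lemma emb_rep_l2: "emb D (rep_l2 F) = mul D (\<lambda>x. 1) F"
  by (simp add: mul_apply ess_bounded_const mulop_def emb_def)

text \<open>Elements of the image of \<open>emb D\<close> are fixed by the continuous projection
  \<open>mul D (\<lambda>x. 1)\<close>, and so are their limits. Hence any representative of a
  limit, restricted to D, represents it.\<close>

lemma emb_limit:
  assumes lim: "(\<lambda>n. emb D (g n)) \<longlonglongrightarrow> F" and g: "\<And>n. g n \<in> L2 D"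
  shows "emb D (rep_l2 F) = F"
proof -
  have "(\<lambda>n. mul D (\<lambda>x. 1) (emb D (g n))) \<longlonglongrightarrow> mul D (\<lambda>x. 1) F"
    by (intro tendsto_intros lim)
  moreover have "mul D (\<lambda>x. 1) (emb D (g n)) = emb D (g n)" for n
    using g by (simp add: mul_apply ess_bounded_const mulop_emb)
  ultimately have "(\<lambda>n. emb D (g n)) \<longlonglongrightarrow> mul D (\<lambda>x. 1) F" by (simp only:)
  then show ?thesis unfolding emb_rep_l2 by (rule LIMSEQ_unique[OF _ lim])
qed

text \<open>Cauchy--Schwarz in the energy inner product: \<open>m\<close> is dominated by \<open>K * a\<close>, and the factor
  \<open>a\<close> is distributed as \<open>sqrt a\<close> to both arguments.\<close>

lemma mul_weighted_bound:
  fixes F G :: "('a, 'b::euclidean_space) l2"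
  assumes m: "ess_bounded D m" and a: "ess_bounded D a" and K: "0 \<le> K"
    and le: "AE x in lebesgue_on D. \<bar>m x\<bar> \<le> K * a x" and a0: "AE x in lebesgue_on D. 0 \<le> a x"
  shows "\<bar>mul D m F \<bullet> G\<bar> \<le> K * sqrt (mul D a F \<bullet> F) * sqrt (mul D a G \<bullet> G)"
proof -
  have sq: "ess_bounded D (\<lambda>x. sqrt (a x))"
  proof -
    obtain C where C: "AE x in lebesgue_on D. \<bar>a x\<bar> \<le> C" using a unfolding ess_bounded_def by blast
    have "AE x in lebesgue_on D. \<bar>sqrt (a x)\<bar> \<le> sqrt C"
      using C a0 by eventually_elim simp
    then show ?thesis using a unfolding ess_bounded_def by auto
  qed
  \<comment> \<open>A scalar function whose norm is the energy norm of F, so that the Cauchy-Schwarz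
    inequality of the scalar space applies.\<close>
  define r where "r F x = norm ((indicator D x * sqrt (a x)) *\<^sub>R rep_l2 F x)" for F :: "('a, 'b) l2" and x
  have rs: "sq_int (r F)" for F
  proof -
    note s = sq_int_mulop[OF sq, of F, unfolded sq_int_def]
    have "r F \<in> borel_measurable lebesgue"
      unfolding r_def[abs_def] by (rule measurable_compose[OF conjunct1[OF s] borel_measurable_norm])
    then show ?thesis unfolding sq_int_def using conjunct2[OF s] by (simp only: r_def real_norm_def abs_norm_cancel)
  qed
  have rn: "norm (abs_l2 (r F)) = sqrt (mul D a F \<bullet> F)" for F
  proof -
    have "AE x in lebesgue. x \<in> D \<longrightarrow> 0 \<le> a x" using a0 D by (simp add: AE_restrict_space_iff)
    then have e1: "AE x in lebesgue. (norm (r F x))\<^sup>2 = (indicator D x * a x) * (rep_l2 F x \<bullet> rep_l2 F x)"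
      by (rule AE_mp) (auto simp: r_def indicator_def power_mult_distrib power2_norm_eq_inner)
    have e2: "(\<lambda>x. (indicator D x * a x) * (rep_l2 F x \<bullet> rep_l2 F x)) \<in> borel_measurable lebesgue"
      using sq_int_inner[OF sq_int_mulop[OF a, of F] sq_int_rep[of F]] by simp
    have e3: "(\<lambda>x. (norm (r F x))\<^sup>2) \<in> borel_measurable lebesgue"
      by (rule borel_measurable_integrable[OF conjunct2[OF rs[of F, unfolded sq_int_def]]])
    have "(LINT x|lebesgue. (norm (r F x))\<^sup>2) = mul D a F \<bullet> F"
      unfolding mul_inner[OF a] by (rule integral_cong_AE[OF e3 e2 e1])
    then show ?thesis by (simp add: abs_l2_norm rs)
  qed
  have iL: "integrable lebesgue (\<lambda>x. (indicator D x * m x) * (rep_l2 F x \<bullet> rep_l2 G x))"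
    using sq_int_inner[OF sq_int_mulop[OF m, of F] sq_int_rep[of G]] by simp
  have "AE x in lebesgue. x \<in> D \<longrightarrow> \<bar>m x\<bar> \<le> K * a x" "AE x in lebesgue. x \<in> D \<longrightarrow> 0 \<le> a x"
    using le a0 D by (simp_all add: AE_restrict_space_iff)
  then have pt: "AE x in lebesgue. \<bar>(indicator D x * m x) * (rep_l2 F x \<bullet> rep_l2 G x)\<bar> \<le> K * (r F x \<bullet> r G x)"
  proof eventually_elim
    case (elim x)
    show ?case
    proof (cases "x \<in> D")
      case True
      have "\<bar>m x\<bar> * \<bar>rep_l2 F x \<bullet> rep_l2 G x\<bar> \<le> (K * a x) * (norm (rep_l2 F x) * norm (rep_l2 G x))"
        using elim True K by (intro mult_mono Cauchy_Schwarz_ineq2) auto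
      also have "\<dots> = K * ((sqrt (a x) * norm (rep_l2 F x)) * (sqrt (a x) * norm (rep_l2 G x)))"
      proof -
        have "a x = sqrt (a x) * sqrt (a x)" using elim True by simp
        then show ?thesis by (metis mult.assoc mult.left_commute)
      qed
      finally show ?thesis using True elim by (simp add: r_def abs_mult)
    qed (simp add: r_def)
  qed
  have "\<bar>mul D m F \<bullet> G\<bar> \<le> (LINT x|lebesgue. \<bar>(indicator D x * m x) * (rep_l2 F x \<bullet> rep_l2 G x)\<bar>)"
    unfolding mul_inner[OF m] by (rule integral_abs_bound)
  also have "\<dots> \<le> (LINT x|lebesgue. K * (r F x \<bullet> r G x))"
    by (rule integral_mono_AE) (use iL pt sq_int_inner[OF rs rs] in auto)
  also have "\<dots> = K * (abs_l2 (r F) \<bullet> abs_l2 (r G))"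
    by (simp add: abs_l2_inner rs)
  also have "\<dots> \<le> K * (norm (abs_l2 (r F)) * norm (abs_l2 (r G)))"
    by (intro mult_left_mono norm_cauchy_schwarz K)
  finally show ?thesis by (simp add: rn mult.assoc)
qed

end

subsection \<open>Weak gradients\<close>

text \<open>In the quotient the choice made by \<open>wgrad\<close> disappears: on
  \<open>H1 D\<close> this map is linear on the nose, not only almost everywhere.\<close>

definition gemb :: "'a::euclidean_space set \<Rightarrow> ('a \<Rightarrow> real) \<Rightarrow> ('a, 'a) l2" where
  "gemb D v = emb D (wgrad D v)"

context
  fixes D :: "'a::euclidean_space set"
  assumes D: "open D" "bounded D"
begin

lemma D_lebesgue: "D \<in> sets lebesgue"
  using D(1) by (simp add: borel_open)

text \<open>Boundedness of D gives finite measure. With a constant field b, the coordinate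
  \<open>g x \<bullet> b\<close> of a square integrable field is an integrable inner
  product.\<close>

lemma const_L2: "(\<lambda>x. c) \<in> L2 D"
proof -
  have "D \<in> lmeasurable" using D by (simp add: lmeasurable_open)
  then have "emeasure lebesgue D < \<infinity>"
    unfolding infinity_ennreal_def less_top[symmetric] by (rule fmeasurableD2)
  then have "integrable lebesgue (indicator D :: 'a \<Rightarrow> real)"
    by (rule integrable_real_indicator[OF D_lebesgue])
  then have "integrable lebesgue (\<lambda>x. indicator D x *\<^sub>R (norm c)\<^sup>2)" by (rule integrable_scaleR_left)
  then have "integrable (lebesgue_on D) (\<lambda>x. (norm c)\<^sup>2)"
    using D_lebesgue by (subst integrable_restrict_space) auto
  then show ?thesis unfolding L2_def by simp
qed

lemma test_scaleR_L2:
  assumes "\<phi> \<in> test_functions D" shows "(\<lambda>x. \<phi> x *\<^sub>R b) \<in> L2 D"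
proof -
  obtain K where K: "compact K" "\<forall>x. x \<notin> K \<longrightarrow> \<phi> x = 0" using test_function_support[OF assms] by blast
  show ?thesis
    by (rule continuous_compact_support_L2[OF D_lebesgue _ K(1)])
      (use K(2) Ck_continuous[OF test_function_Ck[OF assms, of 0]] in \<open>auto intro: continuous_on_scaleR\<close>)
qed

lemma test_frechet_L2:
  assumes "\<phi> \<in> test_functions D" "b \<in> Basis"
  shows "(\<lambda>x. frechet_derivative \<phi> (at x) b) \<in> L2 D"
proof -
  obtain K where K: "compact K" "\<forall>x. x \<notin> K \<longrightarrow> \<phi> x = 0" using test_function_support[OF assms(1)] by blast
  show ?thesis
  proof (rule continuous_compact_support_L2[OF D_lebesgue _ K(1)])
    show "continuous_on UNIV (\<lambda>x. frechet_derivative \<phi> (at x) b)"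
      by (rule Ck_1_frechet_continuous[OF test_function_Ck[OF assms(1)] assms(2)])
    show "x \<notin> K \<Longrightarrow> frechet_derivative \<phi> (at x) b = 0" for x
      by (rule frechet_derivative_outside[OF K(1)]) (use K(2) in auto)
  qed
qed

lemma weak_grad_L2: "is_weak_grad D v g \<Longrightarrow> g \<in> L2 D"
  unfolding is_weak_grad_def by simp

lemma weak_grad_test_integrable:
  assumes "g \<in> L2 D" "\<phi> \<in> test_functions D"
  shows "integrable (lebesgue_on D) (\<lambda>x. (g x \<bullet> b) * \<phi> x)"
  using L2_inner_integrable[OF D_lebesgue assms(1) test_scaleR_L2[OF assms(2), of b]]
  by (simp add: mult.commute)

lemma weak_grad_unique:
  assumes g: "is_weak_grad D v g" and h: "is_weak_grad D v h"
  shows "AE x in lebesgue_on D. g x = h x"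
proof -
  have gL: "g \<in> L2 D" and hL: "h \<in> L2 D" using g h by (auto dest: weak_grad_L2)
  have "AE x in lebesgue_on D. \<forall>b\<in>Basis. g x \<bullet> b - h x \<bullet> b = 0"
  proof (rule AE_finite_allI[OF finite_Basis])
    fix b :: 'a assume b: "b \<in> Basis"
    show "AE x in lebesgue_on D. g x \<bullet> b - h x \<bullet> b = 0"
    proof (rule fundamental_lemma[OF D(1)])
      show "integrable (lebesgue_on D) (\<lambda>x. g x \<bullet> b - h x \<bullet> b)"
        by (intro Bochner_Integration.integrable_diff L2_inner_integrable[OF D_lebesgue] gL hL const_L2)
      fix \<phi> assume \<phi>: "\<phi> \<in> test_functions D"
      have "(LINT x|lebesgue_on D. (g x \<bullet> b - h x \<bullet> b) * \<phi> x) =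
          (LINT x|lebesgue_on D. (g x \<bullet> b) * \<phi> x) - (LINT x|lebesgue_on D. (h x \<bullet> b) * \<phi> x)"
        unfolding left_diff_distrib
        by (intro Bochner_Integration.integral_diff weak_grad_test_integrable gL hL \<phi>)
      then show "(LINT x|lebesgue_on D. (g x \<bullet> b - h x \<bullet> b) * \<phi> x) = 0"
        using is_weak_grad_integral[OF g \<phi> b] is_weak_grad_integral[OF h \<phi> b] by simp
    qed
  qed
  then show ?thesis
  proof eventually_elim
    case (elim x)
    show ?case by (rule euclidean_eqI) (use elim in simp)
  qed
qed

lemma weak_grad_add:
  assumes v: "v \<in> L2 D" "is_weak_grad D v g" and w: "w \<in> L2 D" "is_weak_grad D w h"
  shows "is_weak_grad D (\<lambda>x. v x + w x) (\<lambda>x. g x + h x)"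
  unfolding is_weak_grad_def
proof (intro conjI ballI)
  have gL: "g \<in> L2 D" and hL: "h \<in> L2 D" using v w by (auto dest: weak_grad_L2)
  then show "(\<lambda>x. g x + h x) \<in> L2 D" by (rule L2_add[OF D_lebesgue])
  fix \<phi> :: "'a \<Rightarrow> real" and b :: 'a assume \<phi>: "\<phi> \<in> test_functions D" and b: "b \<in> Basis"
  have i: "integrable (lebesgue_on D) (\<lambda>x. v x * frechet_derivative \<phi> (at x) b)" if "v \<in> L2 D" for v
    using L2_inner_integrable[OF D_lebesgue that test_frechet_L2[OF \<phi> b]] by simp
  have "(LINT x|lebesgue_on D. (v x + w x) * frechet_derivative \<phi> (at x) b) =
      (LINT x|lebesgue_on D. v x * frechet_derivative \<phi> (at x) b) +
      (LINT x|lebesgue_on D. w x * frechet_derivative \<phi> (at x) b)"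
    unfolding distrib_right by (intro Bochner_Integration.integral_add i v w)
  moreover have "(LINT x|lebesgue_on D. ((g x + h x) \<bullet> b) * \<phi> x) =
      (LINT x|lebesgue_on D. (g x \<bullet> b) * \<phi> x) + (LINT x|lebesgue_on D. (h x \<bullet> b) * \<phi> x)"
    unfolding inner_add_left distrib_right
    by (intro Bochner_Integration.integral_add weak_grad_test_integrable gL hL \<phi>)
  ultimately show "(LINT x|lebesgue_on D. (v x + w x) * frechet_derivative \<phi> (at x) b) =
      - (LINT x|lebesgue_on D. ((g x + h x) \<bullet> b) * \<phi> x)"
    using is_weak_grad_integral[OF v(2) \<phi> b] is_weak_grad_integral[OF w(2) \<phi> b] by simp
qed

lemma weak_grad_cmult:
  assumes v: "is_weak_grad D v g"
  shows "is_weak_grad D (\<lambda>x. c * v x) (\<lambda>x. c *\<^sub>R g x)"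
  unfolding is_weak_grad_def
proof (intro conjI ballI)
  show "(\<lambda>x. c *\<^sub>R g x) \<in> L2 D" by (intro L2_scaleR[OF D_lebesgue] weak_grad_L2[OF v])
  fix \<phi> :: "'a \<Rightarrow> real" and b :: 'a assume \<phi>: "\<phi> \<in> test_functions D" and b: "b \<in> Basis"
  show "(LINT x|lebesgue_on D. c * v x * frechet_derivative \<phi> (at x) b) =
      - (LINT x|lebesgue_on D. (c *\<^sub>R g x \<bullet> b) * \<phi> x)"
    using is_weak_grad_integral[OF v \<phi> b] by (simp add: mult.assoc)
qed

section \<open>The spaces of weakly differentiable functions inside the Hilbert space\<close>

lemma H1_L2: "v \<in> H1 D \<Longrightarrow> v \<in> L2 D"
  unfolding H1_def by simp

lemma H1_weak_grad: "v \<in> H1 D \<Longrightarrow> is_weak_grad D v (wgrad D v)"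
  unfolding H1_def wgrad_def by (auto intro: someI_ex[of "is_weak_grad D v"])

lemma wgrad_L2: "v \<in> H1 D \<Longrightarrow> wgrad D v \<in> L2 D"
  by (rule weak_grad_L2[OF H1_weak_grad])

lemma H1_I: "v \<in> L2 D \<Longrightarrow> is_weak_grad D v g \<Longrightarrow> v \<in> H1 D"
  unfolding H1_def by blast

lemma gemb_eq:
  assumes "v \<in> L2 D" "is_weak_grad D v g"
  shows "gemb D v = emb D g"
proof -
  have w: "is_weak_grad D v (wgrad D v)" by (rule H1_weak_grad[OF H1_I[OF assms]])
  show ?thesis unfolding gemb_def
    by (rule emb_eqI[OF D_lebesgue weak_grad_L2[OF w] weak_grad_L2[OF assms(2)] weak_grad_unique[OF w assms(2)]])
qed

lemma H1_add:
  assumes "v \<in> H1 D" "w \<in> H1 D"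
  shows "(\<lambda>x. v x + w x) \<in> H1 D" and "gemb D (\<lambda>x. v x + w x) = gemb D v + gemb D w"
proof -
  note L = L2_add[OF D_lebesgue H1_L2[OF assms(1)] H1_L2[OF assms(2)]]
  note W = weak_grad_add[OF H1_L2[OF assms(1)] H1_weak_grad[OF assms(1)] H1_L2[OF assms(2)] H1_weak_grad[OF assms(2)]]
  show "(\<lambda>x. v x + w x) \<in> H1 D" by (rule H1_I[OF L W])
  show "gemb D (\<lambda>x. v x + w x) = gemb D v + gemb D w"
    unfolding gemb_eq[OF L W] unfolding gemb_def by (rule emb_add[OF D_lebesgue wgrad_L2 wgrad_L2]) fact+
qed

lemma H1_cmult:
  assumes "v \<in> H1 D"
  shows "(\<lambda>x. c * v x) \<in> H1 D" and "gemb D (\<lambda>x. c * v x) = c *\<^sub>R gemb D v"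
proof -
  have L: "(\<lambda>x. c * v x) \<in> L2 D" using L2_scaleR[OF D_lebesgue H1_L2[OF assms(1)], of c] by simp
  note W = weak_grad_cmult[OF H1_weak_grad[OF assms], of c]
  show "(\<lambda>x. c * v x) \<in> H1 D" by (rule H1_I[OF L W])
  show "gemb D (\<lambda>x. c * v x) = c *\<^sub>R gemb D v"
    unfolding gemb_eq[OF L W] unfolding gemb_def by (rule emb_scaleR[OF D_lebesgue wgrad_L2]) fact
qed

lemma emb_real_diff:
  fixes v w :: "'a \<Rightarrow> real"
  assumes "v \<in> L2 D" "w \<in> L2 D"
  shows "emb D (\<lambda>x. v x - w x) = emb D v - emb D w"
  using emb_add[OF D_lebesgue assms(1) L2_scaleR[OF D_lebesgue assms(2), of "-1"]]
    emb_scaleR[OF D_lebesgue assms(2), of "-1"] by simp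

lemma H1_diff:
  assumes "v \<in> H1 D" "w \<in> H1 D"
  shows "(\<lambda>x. v x - w x) \<in> H1 D" and "gemb D (\<lambda>x. v x - w x) = gemb D v - gemb D w"
  using H1_add[OF assms(1) H1_cmult(1)[OF assms(2), of "-1"]] H1_cmult(2)[OF assms(2), of "-1"] by simp_all

lemma V_norm_eq: "v \<in> H1 D \<Longrightarrow> V_norm D v = norm (gemb D v)"
  unfolding V_norm_def gemb_def by (rule emb_norm[OF D_lebesgue wgrad_L2, symmetric])

lemma H1_norm_diff:
  assumes "v \<in> H1 D" "w \<in> H1 D"
  shows "H1_norm D (\<lambda>x. v x - w x) =
    sqrt ((norm (emb D v - emb D w))\<^sup>2 + (norm (gemb D v - gemb D w))\<^sup>2)"
proof -
  note d = H1_diff[OF assms]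
  have "(norm (emb D v - emb D w))\<^sup>2 = (LINT x|lebesgue_on D. (v x - w x)\<^sup>2)"
    using emb_norm[OF D_lebesgue H1_L2[OF d(1)]] emb_real_diff[OF H1_L2[OF assms(1)] H1_L2[OF assms(2)]]
    by simp
  moreover have "(norm (gemb D v - gemb D w))\<^sup>2 =
      (LINT x|lebesgue_on D. (norm (wgrad D (\<lambda>x. v x - w x) x))\<^sup>2)"
    unfolding d(2)[symmetric] unfolding gemb_def using emb_norm[OF D_lebesgue wgrad_L2[OF d(1)]] by simp
  ultimately show ?thesis unfolding H1_norm_def by simp
qed

lemma test_function_H1: "\<phi> \<in> test_functions D \<Longrightarrow> \<phi> \<in> H1 D"
  by (rule H1_I[OF test_function_L2[OF D_lebesgue] test_function_weak_grad[OF D_lebesgue]])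

lemma H10_H1: "v \<in> H10 D \<Longrightarrow> v \<in> H1 D"
  unfolding H10_def by simp

lemma H10_I:
  assumes v: "v \<in> H1 D" and \<phi>: "\<And>n. \<phi> n \<in> test_functions D"
    and lim: "(\<lambda>n. emb D (\<phi> n)) \<longlonglongrightarrow> emb D v" "(\<lambda>n. gemb D (\<phi> n)) \<longlonglongrightarrow> gemb D v"
  shows "v \<in> H10 D"
proof -
  have "(\<lambda>n. sqrt ((norm (emb D (\<phi> n) - emb D v))\<^sup>2 + (norm (gemb D (\<phi> n) - gemb D v))\<^sup>2))
      \<longlonglongrightarrow> sqrt ((norm (emb D v - emb D v))\<^sup>2 + (norm (gemb D v - gemb D v))\<^sup>2)"
    by (intro tendsto_intros lim)
  then have "(\<lambda>n. H1_norm D (\<lambda>x. \<phi> n x - v x)) \<longlonglongrightarrow> 0"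
    unfolding H1_norm_diff[OF test_function_H1[OF \<phi>] v] by simp
  then show ?thesis unfolding H10_def using v \<phi> by blast
qed

text \<open>Convergence in the norm of \<open>H1\<close> is split into two limits in the Hilbert
  space, so that later arguments can use continuity of the norm and of the inner product.\<close>

lemma H10_approx:
  assumes v: "v \<in> H10 D"
  shows "\<exists>\<phi>. (\<forall>n::nat. \<phi> n \<in> test_functions D) \<and>
    (\<lambda>n. emb D (\<phi> n)) \<longlonglongrightarrow> emb D v \<and> (\<lambda>n. gemb D (\<phi> n)) \<longlonglongrightarrow> gemb D v"
proof -
  obtain \<phi> where \<phi>: "\<And>n::nat. \<phi> n \<in> test_functions D"
    and lim: "(\<lambda>n. H1_norm D (\<lambda>x. \<phi> n x - v x)) \<longlonglongrightarrow> 0"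
    using v unfolding H10_def by blast
  have e: "H1_norm D (\<lambda>x. \<phi> n x - v x) =
      sqrt ((norm (emb D (\<phi> n) - emb D v))\<^sup>2 + (norm (gemb D (\<phi> n) - gemb D v))\<^sup>2)" for n
    by (rule H1_norm_diff[OF test_function_H1[OF \<phi>] H10_H1[OF v]])
  have "(\<lambda>n. emb D (\<phi> n) - emb D v) \<longlonglongrightarrow> 0"
    by (rule Lim_null_comparison[OF _ lim]) (simp add: e real_le_rsqrt)
  moreover have "(\<lambda>n. gemb D (\<phi> n) - gemb D v) \<longlonglongrightarrow> 0"
    by (rule Lim_null_comparison[OF _ lim]) (simp add: e real_le_rsqrt)
  ultimately show ?thesis using \<phi> unfolding LIM_zero_iff by blast
qed

lemma H10_add:
  assumes v: "v \<in> H10 D" and w: "w \<in> H10 D" shows "(\<lambda>x. v x + w x) \<in> H10 D"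
proof -
  obtain \<phi> where \<phi>: "\<And>n::nat. \<phi> n \<in> test_functions D"
    "(\<lambda>n. emb D (\<phi> n)) \<longlonglongrightarrow> emb D v" "(\<lambda>n. gemb D (\<phi> n)) \<longlonglongrightarrow> gemb D v"
    using H10_approx[OF v] by blast
  obtain \<psi> where \<psi>: "\<And>n::nat. \<psi> n \<in> test_functions D"
    "(\<lambda>n. emb D (\<psi> n)) \<longlonglongrightarrow> emb D w" "(\<lambda>n. gemb D (\<psi> n)) \<longlonglongrightarrow> gemb D w"
    using H10_approx[OF w] by blast
  note H = H10_H1[OF v] H10_H1[OF w] test_function_H1[OF \<phi>(1)] test_function_H1[OF \<psi>(1)]
  show ?thesis
  proof (rule H10_I[OF H1_add(1)[OF H(1,2)], of "\<lambda>n x. \<phi> n x + \<psi> n x"])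
    show "(\<lambda>n. emb D (\<lambda>x. \<phi> n x + \<psi> n x)) \<longlonglongrightarrow> emb D (\<lambda>x. v x + w x)"
      unfolding emb_add[OF D_lebesgue H1_L2[OF H(3)] H1_L2[OF H(4)]]
        emb_add[OF D_lebesgue H1_L2[OF H(1)] H1_L2[OF H(2)]]
      by (intro tendsto_add \<phi> \<psi>)
    show "(\<lambda>n. gemb D (\<lambda>x. \<phi> n x + \<psi> n x)) \<longlonglongrightarrow> gemb D (\<lambda>x. v x + w x)"
      unfolding H1_add(2)[OF H(3,4)] H1_add(2)[OF H(1,2)] by (intro tendsto_add \<phi> \<psi>)
  qed (intro test_function_add \<phi> \<psi>)
qed

lemma H10_cmult:
  assumes v: "v \<in> H10 D" shows "(\<lambda>x. c * v x) \<in> H10 D"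
proof -
  obtain \<phi> where \<phi>: "\<And>n::nat. \<phi> n \<in> test_functions D"
    "(\<lambda>n. emb D (\<phi> n)) \<longlonglongrightarrow> emb D v" "(\<lambda>n. gemb D (\<phi> n)) \<longlonglongrightarrow> gemb D v"
    using H10_approx[OF v] by blast
  note H = H10_H1[OF v] test_function_H1[OF \<phi>(1)]
  show ?thesis
  proof (rule H10_I[OF H1_cmult(1)[OF H(1)], of "\<lambda>n x. c * \<phi> n x"])
    show "(\<lambda>n. emb D (\<lambda>x. c * \<phi> n x)) \<longlonglongrightarrow> emb D (\<lambda>x. c * v x)"
      using emb_scaleR[OF D_lebesgue H1_L2[OF H(2)], of c] emb_scaleR[OF D_lebesgue H1_L2[OF H(1)], of c]
        tendsto_scaleR[OF tendsto_const[of c] \<phi>(2)] by simp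
    show "(\<lambda>n. gemb D (\<lambda>x. c * \<phi> n x)) \<longlonglongrightarrow> gemb D (\<lambda>x. c * v x)"
      unfolding H1_cmult(2)[OF H(2)] H1_cmult(2)[OF H(1)] by (intro tendsto_scaleR tendsto_const \<phi>)
  qed (intro test_function_cmult \<phi>)
qed

text \<open>Both sides are continuous under the approximation by test functions, for which the
  inequality is already known.\<close>

lemma poincare_H10: "\<exists>C\<ge>0. \<forall>v\<in>H10 D. norm (emb D v) \<le> C * norm (gemb D v)"
proof -
  obtain R where R: "0 < R" "D \<subseteq> ball 0 R"
    using bounded_subset_ballD[OF D(2), of 0] by blast
  have t: "norm (emb D \<phi>) \<le> 2 * R * norm (gemb D \<phi>)" if \<phi>: "\<phi> \<in> test_functions D" for \<phi>
  proof -
    note L = test_function_L2[OF D_lebesgue \<phi>]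
    note W = test_function_weak_grad[OF D_lebesgue \<phi>]
    have "norm (emb D \<phi>) = sqrt (LINT x|lebesgue_on D. (\<phi> x)\<^sup>2)"
      using emb_norm[OF D_lebesgue L] by simp
    also have "\<dots> \<le> sqrt (4 * R\<^sup>2 * (LINT x|lebesgue_on D. (norm (grad \<phi> x))\<^sup>2))"
      by (intro real_sqrt_le_mono poincare_test_function[OF D_lebesgue R(2) \<phi>])
    also have "\<dots> = 2 * R * norm (gemb D \<phi>)"
      unfolding gemb_eq[OF L W] emb_norm[OF D_lebesgue weak_grad_L2[OF W]] using R(1)
      by (simp add: real_sqrt_mult)
    finally show ?thesis .
  qed
  have "norm (emb D v) \<le> 2 * R * norm (gemb D v)" if v: "v \<in> H10 D" for v
  proof -
    obtain \<phi> where \<phi>: "\<And>n::nat. \<phi> n \<in> test_functions D"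
      "(\<lambda>n. emb D (\<phi> n)) \<longlonglongrightarrow> emb D v" "(\<lambda>n. gemb D (\<phi> n)) \<longlonglongrightarrow> gemb D v"
      using H10_approx[OF v] by blast
    show ?thesis
    proof (rule LIMSEQ_le)
      show "(\<lambda>n. norm (emb D (\<phi> n))) \<longlonglongrightarrow> norm (emb D v)" by (intro tendsto_norm \<phi>)
      show "(\<lambda>n. 2 * R * norm (gemb D (\<phi> n))) \<longlonglongrightarrow> 2 * R * norm (gemb D v)"
        by (intro tendsto_mult tendsto_const tendsto_norm \<phi>)
    qed (use t \<phi>(1) in auto)
  qed
  then show ?thesis using R(1) by (intro exI[of _ "2 * R"]) simp
qed

text \<open>Convergence of gradients alone suffices: the Poincare inequality makes the functions
  themselves Cauchy, and the limit of the gradients is the weak gradient of their limit.\<close>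

lemma H10_closed:
  assumes v: "\<And>n::nat. v n \<in> H10 D" and lim: "(\<lambda>n. gemb D (v n)) \<longlonglongrightarrow> G"
  shows "\<exists>w\<in>H10 D. gemb D w = G"
proof -
  note H = H10_H1[OF v]
  obtain C where C: "0 \<le> C" "\<And>v. v \<in> H10 D \<Longrightarrow> norm (emb D v) \<le> C * norm (gemb D v)"
    using poincare_H10 by blast
  have le: "norm (emb D (v m) - emb D (v n)) \<le> C * norm (gemb D (v m) - gemb D (v n))" for m n
  proof -
    have d: "(\<lambda>x. v m x - v n x) \<in> H10 D"
      using H10_add[OF v[of m] H10_cmult[OF v[of n], of "-1"]] by simp
    show ?thesis
      using C(2)[OF d] unfolding emb_real_diff[OF H1_L2[OF H] H1_L2[OF H]] H1_diff(2)[OF H H] .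
  qed
  have "Cauchy (\<lambda>n. gemb D (v n))" using lim by (rule LIMSEQ_imp_Cauchy)
  have "Cauchy (\<lambda>n. emb D (v n))"
  proof (rule CauchyI)
    fix e :: real assume "0 < e"
    \<comment> \<open>The constant C may be zero, hence the division by
      \<open>C + 1\<close>.\<close>
    then have "0 < e / (C + 1)" using C(1) by simp
    then obtain N where N: "\<And>m n. N \<le> m \<Longrightarrow> N \<le> n \<Longrightarrow> norm (gemb D (v m) - gemb D (v n)) < e / (C + 1)"
      using CauchyD[OF \<open>Cauchy (\<lambda>n. gemb D (v n))\<close>] by blast
    have "norm (emb D (v m) - emb D (v n)) < e" if "N \<le> m" "N \<le> n" for m n
    proof -
      have "norm (emb D (v m) - emb D (v n)) \<le> (C + 1) * norm (gemb D (v m) - gemb D (v n))"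
        using le[of m n] by (simp add: distrib_right add_increasing2)
      also have "\<dots> < (C + 1) * (e / (C + 1))"
        using N[OF that] C(1) by (intro mult_strict_left_mono) auto
      finally show ?thesis using C(1) by simp
    qed
    then show "\<exists>M. \<forall>m\<ge>M. \<forall>n\<ge>M. norm (emb D (v m) - emb D (v n)) < e" by blast
  qed
  then obtain W where W: "(\<lambda>n. emb D (v n)) \<longlonglongrightarrow> W" using Cauchy_convergent convergent_def by blast
  define w where "w = rep_l2 W"
  define g where "g = rep_l2 G"
  have wL: "w \<in> L2 D" and gL: "g \<in> L2 D" unfolding w_def g_def by (rule rep_l2_L2[OF D_lebesgue])+
  have wW: "emb D w = W" unfolding w_def by (rule emb_limit[OF D_lebesgue W H1_L2[OF H]])
  have gG: "emb D g = G"
    unfolding g_def by (rule emb_limit[OF D_lebesgue lim[unfolded gemb_def] wgrad_L2[OF H]])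
  \<comment> \<open>For a fixed test function both sides of the defining identity are inner products
    with fixed elements, so the identity passes to the limit.\<close>
  have wg: "is_weak_grad D w g"
    unfolding is_weak_grad_def
  proof (intro conjI ballI gL)
    fix \<phi> :: "'a \<Rightarrow> real" and b :: 'a assume \<phi>: "\<phi> \<in> test_functions D" and b: "b \<in> Basis"
    note fL = test_frechet_L2[OF \<phi> b] and pL = test_scaleR_L2[OF \<phi>, of b]
    have i1: "(LINT x|lebesgue_on D. z x * frechet_derivative \<phi> (at x) b) =
        emb D z \<bullet> emb D (\<lambda>x. frechet_derivative \<phi> (at x) b)" if "z \<in> L2 D" for z
      using emb_inner[OF D_lebesgue that fL] by simp
    have i2: "(LINT x|lebesgue_on D. (k x \<bullet> b) * \<phi> x) = emb D k \<bullet> emb D (\<lambda>x. \<phi> x *\<^sub>R b)"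
      if "k \<in> L2 D" for k
      using emb_inner[OF D_lebesgue that pL] by (simp add: mult.commute)
    have "emb D (v n) \<bullet> emb D (\<lambda>x. frechet_derivative \<phi> (at x) b) =
        - (gemb D (v n) \<bullet> emb D (\<lambda>x. \<phi> x *\<^sub>R b))" for n
      using is_weak_grad_integral[OF H1_weak_grad[OF H] \<phi> b, of n]
      unfolding i1[OF H1_L2[OF H]] i2[OF wgrad_L2[OF H]] gemb_def .
    moreover have "(\<lambda>n. emb D (v n) \<bullet> emb D (\<lambda>x. frechet_derivative \<phi> (at x) b)) \<longlonglongrightarrow>
        W \<bullet> emb D (\<lambda>x. frechet_derivative \<phi> (at x) b)" by (intro tendsto_intros W)
    moreover have "(\<lambda>n. - (gemb D (v n) \<bullet> emb D (\<lambda>x. \<phi> x *\<^sub>R b))) \<longlonglongrightarrow>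
        - (G \<bullet> emb D (\<lambda>x. \<phi> x *\<^sub>R b))" by (intro tendsto_intros lim)
    ultimately have "W \<bullet> emb D (\<lambda>x. frechet_derivative \<phi> (at x) b) = - (G \<bullet> emb D (\<lambda>x. \<phi> x *\<^sub>R b))"
      by (simp only:) (rule LIMSEQ_unique)
    then show "(LINT x|lebesgue_on D. w x * frechet_derivative \<phi> (at x) b) =
        - (LINT x|lebesgue_on D. (g x \<bullet> b) * \<phi> x)"
      unfolding i1[OF wL] i2[OF gL] wW gG .
  qed
  have gw: "gemb D w = G" using gemb_eq[OF wL wg] gG by simp
  \<comment> \<open>Diagonal choice: one test function close to each \<open>v n\<close> gives a
    single sequence that approximates w.\<close>
  have "\<exists>\<phi>\<in>test_functions D. norm (emb D \<phi> - emb D (v n)) < inverse (real (Suc n)) \<and>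
      norm (gemb D \<phi> - gemb D (v n)) < inverse (real (Suc n))" for n
  proof -
    obtain \<phi> where \<phi>: "\<And>n::nat. \<phi> n \<in> test_functions D"
      "(\<lambda>k. emb D (\<phi> k)) \<longlonglongrightarrow> emb D (v n)" "(\<lambda>k. gemb D (\<phi> k)) \<longlonglongrightarrow> gemb D (v n)"
      using H10_approx[OF v] by blast
    have p: "0 < inverse (real (Suc n))" by simp
    have "\<forall>\<^sub>F k in sequentially. dist (emb D (\<phi> k)) (emb D (v n)) < inverse (real (Suc n)) \<and>
        dist (gemb D (\<phi> k)) (gemb D (v n)) < inverse (real (Suc n))"
      by (intro eventually_conj tendstoD \<phi> p)
    then obtain k where "dist (emb D (\<phi> k)) (emb D (v n)) < inverse (real (Suc n)) \<and>
        dist (gemb D (\<phi> k)) (gemb D (v n)) < inverse (real (Suc n))"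
      using eventually_happens'[OF sequentially_bot] by blast
    then show ?thesis using \<phi>(1)[of k] unfolding dist_norm by blast
  qed
  then obtain \<phi> where \<phi>: "\<And>n. \<phi> n \<in> test_functions D"
    "\<And>n. norm (emb D (\<phi> n) - emb D (v n)) < inverse (real (Suc n))"
    "\<And>n. norm (gemb D (\<phi> n) - gemb D (v n)) < inverse (real (Suc n))" by metis
  have l1: "(\<lambda>n. emb D (\<phi> n) - emb D (v n)) \<longlonglongrightarrow> 0"
    by (rule Lim_null_comparison[OF _ LIMSEQ_inverse_real_of_nat])
      (intro always_eventually allI less_imp_le \<phi>)
  have l2: "(\<lambda>n. gemb D (\<phi> n) - gemb D (v n)) \<longlonglongrightarrow> 0"
    by (rule Lim_null_comparison[OF _ LIMSEQ_inverse_real_of_nat])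
      (intro always_eventually allI less_imp_le \<phi>)
  have "w \<in> H10 D"
  proof (rule H10_I[OF H1_I[OF wL wg], of \<phi>])
    show "(\<lambda>n. emb D (\<phi> n)) \<longlonglongrightarrow> emb D w" using tendsto_add[OF l1 W] wW by simp
    show "(\<lambda>n. gemb D (\<phi> n)) \<longlonglongrightarrow> gemb D w" using tendsto_add[OF l2 lim] gw by simp
  qed (rule \<phi>)
  then show ?thesis using gw by blast
qed

end

subsection \<open>Parametric diffusion\<close>

text \<open>Links \<open>has_partial\<close>, which speaks of difference quotients, to derivatives
  of Hilbert space and operator valued functions of one real variable.\<close>

lemma has_vector_derivative_iff_quotient:
  fixes F :: "real \<Rightarrow> 'b::real_normed_vector"
  shows "(F has_vector_derivative d) (at t) \<longleftrightarrow>
    ((\<lambda>h. (1 / h) *\<^sub>R (F (t + h) - F t) - d) \<longlongrightarrow> 0) (at 0)"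
proof -
  have "norm (F (t + h) - F t - h *\<^sub>R d) / norm h = norm ((1 / h) *\<^sub>R (F (t + h) - F t) - d)"
    if "h \<noteq> 0" for h
  proof -
    have "(1 / h) *\<^sub>R (F (t + h) - F t) - d = (1 / h) *\<^sub>R (F (t + h) - F t - h *\<^sub>R d)"
      using that by (simp add: scaleR_diff_right)
    then show ?thesis by (simp add: divide_inverse mult.commute)
  qed
  then have "((\<lambda>h. norm (F (t + h) - F t - h *\<^sub>R d) / norm h) \<longlongrightarrow> 0) (at 0) \<longleftrightarrow>
      ((\<lambda>h. norm ((1 / h) *\<^sub>R (F (t + h) - F t) - d)) \<longlongrightarrow> 0) (at 0)"
    by (intro filterlim_cong refl) (auto simp: eventually_at_filter)
  then show ?thesis
    unfolding has_vector_derivative_def has_derivative_at tendsto_norm_zero_iff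
    by (simp only: bounded_linear_scaleR_left simp_thms)
qed

lemma subspace_closure:
  fixes S :: "'b::real_normed_vector set"
  assumes "subspace S" shows "subspace (closure S)"
proof (rule subspaceI)
  show "0 \<in> closure S" using subspace_0[OF assms] closure_subset by blast
  fix x y :: 'b and c :: real assume x: "x \<in> closure S"
  then obtain p where p: "\<And>n. p n \<in> S" "p \<longlonglongrightarrow> x" unfolding closure_sequential by blast
  have "(\<lambda>n. c *\<^sub>R p n) \<longlonglongrightarrow> c *\<^sub>R x" by (intro tendsto_intros p)
  then show "c *\<^sub>R x \<in> closure S"
    unfolding closure_sequential using subspace_scale[OF assms p(1)]
    by (intro exI[of _ "\<lambda>n. c *\<^sub>R p n"] conjI allI)
  assume "y \<in> closure S"
  then obtain q where q: "\<And>n. q n \<in> S" "q \<longlonglongrightarrow> y" unfolding closure_sequential by blast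
  have "(\<lambda>n. p n + q n) \<longlonglongrightarrow> x + y" by (intro tendsto_intros p q)
  then show "x + y \<in> closure S"
    unfolding closure_sequential using subspace_add[OF assms p(1) q(1)]
    by (intro exI[of _ "\<lambda>n. p n + q n"] conjI allI)
qed

lemma ess_norm_AE: "AE x in lebesgue_on D. ereal (\<bar>v x\<bar> * w x) \<le> ess_norm D w v"
  unfolding ess_norm_def by (rule esssup_AE)

lemma Linf_ess_bounded:
  assumes "m \<in> Linf D" shows "ess_bounded D m"
proof -
  have s: "sup_norm D m < \<infinity>" using assms unfolding Linf_def by simp
  have ae: "AE x in lebesgue_on D. ereal (\<bar>m x\<bar> * 1) \<le> sup_norm D m" by (rule ess_norm_AE)
  have "AE x in lebesgue_on D. \<bar>m x\<bar> \<le> real_of_ereal (sup_norm D m)"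
    using ae
  proof eventually_elim
    case (elim x)
    then show ?case using s by (cases "sup_norm D m") auto
  qed
  then show ?thesis using assms unfolding ess_bounded_def Linf_def by auto
qed

context
  fixes D :: "'a::euclidean_space set"
  assumes D: "open D" "bounded D"
begin

lemma mul_quotient:
  assumes p: "ess_bounded D p" and q: "ess_bounded D q" and d: "ess_bounded D d"
  shows "ess_bounded D (\<lambda>x. (p x - q x) / h - d x)"
    and "mul D (\<lambda>x. (p x - q x) / h - d x) =
      (1 / h) *\<^sub>R (mul D p - mul D q :: ('a, 'b::euclidean_space) l2 \<Rightarrow>\<^sub>L _) - mul D d"
proof -
  note Dm = D_lebesgue[OF D]
  note b = ess_bounded_cmult[OF Dm] ess_bounded_add[OF Dm]
  have e: "(\<lambda>x. (p x - q x) / h - d x) = (\<lambda>x. (1 / h) * (p x + (-1) * q x) + (-1) * d x)"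
    by (auto simp: divide_inverse mult.commute)
  show "ess_bounded D (\<lambda>x. (p x - q x) / h - d x)" unfolding e by (intro b p q d)
  show "mul D (\<lambda>x. (p x - q x) / h - d x) =
      (1 / h) *\<^sub>R (mul D p - mul D q :: ('a, 'b) l2 \<Rightarrow>\<^sub>L _) - mul D d"
    unfolding e
    by (simp only: mul_add[OF Dm b(1)[OF b(2)[OF p b(1)[OF q]]] b(1)[OF d]]
        mul_add[OF Dm p b(1)[OF q]] mul_cmult[OF Dm b(2)[OF p b(1)[OF q]]]
        mul_cmult[OF Dm q] mul_cmult[OF Dm d]) simp
qed

text \<open>By linearity of \<open>mul D\<close> on essentially bounded coefficients, the error of
  the difference quotient of operators is the operator of the error, whose norm is at most the sup
  norm.\<close>

lemma mul_has_vector_derivative: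
  assumes part: "has_partial (sup_norm D) g j y d" and g: "\<And>y. g y \<in> Linf D" and d: "d \<in> Linf D"
  shows "((\<lambda>t. mul D (g (y(j := t))) :: ('a, 'b::euclidean_space) l2 \<Rightarrow>\<^sub>L _)
    has_vector_derivative mul D d) (at (y j))"
  unfolding has_vector_derivative_iff_quotient
proof (rule tendstoI)
  fix e :: real assume e: "0 < e"
  note q = mul_quotient[OF Linf_ess_bounded[OF g] Linf_ess_bounded[OF g] Linf_ess_bounded[OF d]]
  have "\<forall>\<^sub>F h in at 0. sup_norm D (\<lambda>x. (g (y(j := y j + h)) x - g y x) / h - d x) < ereal (e / 2)"
    using part e unfolding has_partial_def by (intro order_tendstoD(2)) auto
  then show "\<forall>\<^sub>F h in at 0. dist ((1 / h) *\<^sub>R ((mul D (g (y(j := y j + h))) :: ('a, 'b) l2 \<Rightarrow>\<^sub>L _)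
      - mul D (g (y(j := y j)))) - mul D d) 0 < e"
  proof eventually_elim
    case (elim h)
    let ?q = "\<lambda>x. (g (y(j := y j + h)) x - g y x) / h - d x"
    note small = elim
    have "AE x in lebesgue_on D. \<bar>?q x\<bar> \<le> e / 2"
      using ess_norm_AE[where D = D and v = ?q and w = "\<lambda>_. 1"]
    proof eventually_elim
      case (elim x)
      from order_le_less_trans[OF this small] show ?case by simp
    qed
    then have "norm (mul D ?q :: ('a, 'b) l2 \<Rightarrow>\<^sub>L _) \<le> e / 2"
      using e q(1)[of "y(j := y j + h)" y h] unfolding ess_bounded_def
      by (intro mul_norm_le[OF D_lebesgue[OF D]]) auto
    then show ?case using e unfolding q(2) by (simp add: dist_norm)
  qed
qed

lemma has_partial_V_norm:
  assumes der: "((\<lambda>t. gemb D (w (y(j := t)))) has_vector_derivative gemb D d) (at (y j))"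
    and w: "\<And>y. w y \<in> H10 D" and d: "d \<in> H10 D"
  shows "has_partial (\<lambda>v. ereal (V_norm D v)) w j y d"
proof -
  have "V_norm D (\<lambda>x. (w (y(j := y j + h)) x - w y x) / h - d x) =
      norm ((1 / h) *\<^sub>R (gemb D (w (y(j := y j + h))) - gemb D (w (y(j := y j)))) - gemb D d)" for h
  proof -
    note H = H10_H1[OF D w] H10_H1[OF D d]
    note q = H1_diff[OF D H(1) H(1), of "y(j := y j + h)" y]
    note c = H1_cmult[OF D q(1), of "1 / h"]
    have "V_norm D (\<lambda>x. 1 / h * (w (y(j := y j + h)) x - w y x) - d x) =
      norm ((1 / h) *\<^sub>R (gemb D (w (y(j := y j + h))) - gemb D (w y)) - gemb D d)"
      unfolding V_norm_eq[OF D H1_diff(1)[OF D c(1) H(2)]] H1_diff(2)[OF D c(1) H(2)] c(2) q(2) ..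
    then show ?thesis by simp
  qed
  moreover have "((\<lambda>h. norm ((1 / h) *\<^sub>R (gemb D (w (y(j := y j + h))) - gemb D (w (y(j := y j)))) - gemb D d))
      \<longlongrightarrow> 0) (at 0)"
    using der unfolding has_vector_derivative_iff_quotient by (rule tendsto_norm_zero)
  ultimately show ?thesis
    unfolding has_partial_def zero_ereal_def by (simp only:) (rule tendsto_ereal)
qed

lemma V_dual_bound:
  assumes f: "f \<in> V_dual D" and v: "v \<in> H10 D"
  shows "\<bar>f v\<bar> \<le> V_dual_norm D f * V_norm D v" and "0 \<le> V_dual_norm D f"
proof -
  obtain C where C: "\<And>v. v \<in> H10 D \<Longrightarrow> \<bar>f v\<bar> \<le> C * V_norm D v"
    using f unfolding V_dual_def by blast
  have fc: "f (\<lambda>x. c * v x) = c * f v" if "v \<in> H10 D" for v c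
    using f that unfolding V_dual_def by blast
  have N: "V_norm D v = norm (gemb D v)" if "v \<in> H10 D" for v
    by (rule V_norm_eq[OF D H10_H1[OF D that]])
  have bdd: "bdd_above ((\<lambda>v. \<bar>f v\<bar>) ` {v \<in> H10 D. V_norm D v \<le> 1})"
  proof (rule bdd_aboveI2)
    fix v assume v: "v \<in> {v \<in> H10 D. V_norm D v \<le> 1}"
    have "C * V_norm D v \<le> \<bar>C\<bar> * 1" using v N by (intro mult_mono) auto
    then show "\<bar>f v\<bar> \<le> \<bar>C\<bar>" using C[of v] v by simp
  qed
  have up: "\<bar>f v\<bar> \<le> V_dual_norm D f" if "v \<in> H10 D" "V_norm D v \<le> 1" for v
    unfolding V_dual_norm_def by (rule cSUP_upper[OF _ bdd]) (use that in simp)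
  have c: "V_norm D (\<lambda>x. c * v x) = \<bar>c\<bar> * V_norm D v" for c
    using N[OF H10_cmult[OF D v, of c]] N[OF v] H1_cmult(2)[OF D H10_H1[OF D v], of c] by simp
  show "0 \<le> V_dual_norm D f"
    using up[OF H10_cmult[OF D v, of 0]] c[of 0] by simp
  show "\<bar>f v\<bar> \<le> V_dual_norm D f * V_norm D v"
  \<comment> \<open>Here v cannot be normalised, but boundedness of f with some constant C already
    forces \<open>f v = 0\<close>.\<close>
  proof (cases "V_norm D v = 0")
    case True
    then show ?thesis using C[OF v] by simp
  next
    case False
    then have p: "0 < V_norm D v" using N[OF v] by simp
    have "\<bar>f (\<lambda>x. inverse (V_norm D v) * v x)\<bar> \<le> V_dual_norm D f"
      by (rule up[OF H10_cmult[OF D v]]) (use p in \<open>simp add: c\<close>)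
    then show ?thesis unfolding fc[OF v] using p by (simp add: abs_mult field_simps)
  qed
qed

text \<open>Used with two values of N: the inverse of \<open>a_min\<close> for coercivity, and the
  sup norm of \<open>1 / a\<close> for the final estimate.\<close>

lemma mul_inner_lower_bound:
  assumes a: "ess_bounded D a" and g: "g \<in> L2 D" and le: "AE x in lebesgue_on D. 1 \<le> N * a x"
  shows "(norm (emb D g))\<^sup>2 \<le> N * (mul D a (emb D g) \<bullet> emb D g)"
proof -
  note Dm = D_lebesgue[OF D]
  have "(norm (emb D g))\<^sup>2 = (LINT x|lebesgue_on D. g x \<bullet> g x)"
    by (simp add: power2_norm_eq_inner emb_inner[OF Dm g g])
  also have "\<dots> \<le> (LINT x|lebesgue_on D. N * (a x * (g x \<bullet> g x)))"
  proof (rule integral_mono_AE)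
    show "integrable (lebesgue_on D) (\<lambda>x. g x \<bullet> g x)" by (rule L2_inner_integrable[OF Dm g g])
    show "integrable (lebesgue_on D) (\<lambda>x. N * (a x * (g x \<bullet> g x)))"
      using L2_inner_integrable[OF Dm L2_mult[OF Dm a g] g] by (intro integrable_mult_right) simp
    show "AE x in lebesgue_on D. g x \<bullet> g x \<le> N * (a x * (g x \<bullet> g x))"
      using le
    proof eventually_elim
      case (elim x)
      then have "1 * (g x \<bullet> g x) \<le> (N * a x) * (g x \<bullet> g x)" by (intro mult_right_mono) auto
      then show ?case by (simp add: mult.assoc)
    qed
  qed
  also have "\<dots> = N * (mul D a (emb D g) \<bullet> emb D g)"
    by (simp add: mul_emb_inner[OF Dm a g g])
  finally show ?thesis .
qed

text \<open>The extended real is turned into a real number N, so that the final estimate is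
  arithmetic of reals: it is finite by the lower bound l and nonnegative by
  \<open>D \<noteq> {}\<close>.\<close>

lemma sup_norm_inverse:
  assumes ne: "D \<noteq> {}" and a: "a \<in> borel_measurable (lebesgue_on D)"
    and lo: "0 < l" "\<And>x. x \<in> D \<Longrightarrow> l \<le> a x"
  shows "\<exists>N\<ge>0. sup_norm D (\<lambda>x. inverse (a x)) = ereal N \<and> (AE x in lebesgue_on D. 1 \<le> N * a x)"
proof -
  let ?S = "sup_norm D (\<lambda>x. inverse (a x))"
  have up: "?S \<le> ereal (inverse l)"
    unfolding ess_norm_def
  proof (rule esssup_I)
    show "AE x in lebesgue_on D. ereal (\<bar>inverse (a x)\<bar> * 1) \<le> ereal (inverse l)"
    proof (rule AE_I2)
      fix x assume "x \<in> space (lebesgue_on D)"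
      then have "l \<le> a x" using lo(2) by simp
      then have "\<bar>inverse (a x)\<bar> \<le> inverse l" using lo(1) le_imp_inverse_le[of l "a x"] by simp
      then show "ereal (\<bar>inverse (a x)\<bar> * 1) \<le> ereal (inverse l)" by simp
    qed
  qed (use a in measurable)
  have ae: "AE x in lebesgue_on D. ereal (\<bar>inverse (a x)\<bar> * 1) \<le> ?S" by (rule ess_norm_AE)
  \<comment> \<open>A negative essential supremum of a nonnegative function is possible only over a
    null set, and a nonempty open set is not null.\<close>
  have pos: "0 \<le> ?S"
  proof (rule ccontr)
    assume "\<not> 0 \<le> ?S"
    then have neg: "?S < 0" by simp
    have "AE x in lebesgue_on D. False"
      using ae
    proof eventually_elim
      case (elim x)
      have "0 \<le> ereal (\<bar>inverse (a x)\<bar> * 1)" by simp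
      then show ?case using elim neg by (meson leD order_trans)
    qed
    then have "AE x in lebesgue. x \<notin> D"
      using D_lebesgue[OF D] by (simp add: AE_restrict_space_iff)
    then have "D \<in> null_sets lebesgue"
      using D_lebesgue[OF D] by (simp add: AE_iff_null_sets)
    then have "negligible D" by (simp add: negligible_iff_null_sets)
    then show False using open_not_negligible[OF D(1) ne] by simp
  qed
  obtain N where N: "?S = ereal N" using pos up by (cases ?S) auto
  have "AE x in lebesgue_on D. x \<in> D" using AE_space[of "lebesgue_on D"] by simp
  then have "AE x in lebesgue_on D. 1 \<le> N * a x"
    using ae
  proof eventually_elim
    case (elim x)
    then have "0 < a x" using lo by fastforce
    moreover have "\<bar>inverse (a x)\<bar> \<le> N" using elim(2) unfolding N by simp
    ultimately show ?case by (simp add: field_simps)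
  qed
  then show ?thesis using N pos by auto
qed

end

theorem theorem3p1:
  fixes D :: "'a::euclidean_space set"
    and f :: "('a \<Rightarrow> real) \<Rightarrow> real"
    and a :: "(nat \<Rightarrow> real) \<Rightarrow> 'a \<Rightarrow> real"
    and da :: "(nat \<Rightarrow> nat) \<Rightarrow> (nat \<Rightarrow> real) \<Rightarrow> 'a \<Rightarrow> real"
    and a_min a_max :: "(nat \<Rightarrow> real) \<Rightarrow> real"
    and \<delta> :: real
    and \<kappa> :: "(nat \<Rightarrow> real) \<Rightarrow> real"
    and \<beta> :: "nat \<Rightarrow> (nat \<Rightarrow> real) \<Rightarrow> real"
    and X :: "('a \<Rightarrow> real) set"
    and u :: "(nat \<Rightarrow> real) \<Rightarrow> 'a \<Rightarrow> real"
  assumes "bounded_lipschitz_domain D"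
    and "f \<in> V_dual D"
    and "\<forall>y. 0 < a_min y"
    and "\<forall>y. \<forall>x \<in> D. a_min y \<le> a y x \<and> a y x \<le> a_max y"
    and "mixed_partials (Linf D) (sup_norm D) a da"
    and "\<forall>\<nu> \<in> multi_indices. param_continuous (sup_norm D) (da \<nu>)"
    and "1 \<le> \<delta>"
    and "\<forall>y. 1 \<le> \<kappa> y"
    and "\<forall>j y. 0 < \<beta> j y"
    and "\<forall>y. \<exists>U. open U \<and> y \<in> U \<and> (\<forall>\<xi> \<in> U. \<forall>\<nu> \<in> multi_indices.
           ess_norm D (\<lambda>x. inverse (a \<xi> x)) (da \<nu> \<xi>)
             \<le> ereal (\<kappa> y * mi_power (\<lambda>j. \<beta> j y) \<nu> * fact (mi_size \<nu>) powr \<delta>))"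
    and "X \<subseteq> H10 D" and "linear_subspace X"
    and "\<forall>y. u y \<in> X"
    and "\<forall>y. \<forall>v \<in> X.
           (LINT x|lebesgue_on D. a y x * (wgrad D (u y) x \<bullet> wgrad D v x)) = f v"
  shows "\<exists>du. mixed_partials (H10 D) (\<lambda>v. ereal (V_norm D v)) u du \<and>
    (\<forall>y. \<exists>U. open U \<and> y \<in> U \<and> (\<forall>\<xi> \<in> U. \<forall>\<nu> \<in> multi_indices.
       ereal (V_norm D (du \<nu> \<xi>))
         \<le> ereal (mi_power (\<lambda>j. 12 * \<kappa> y * \<beta> j y) \<nu> * phi \<delta> \<nu> * V_dual_norm D f)
             * sup_norm D (\<lambda>x. inverse (a \<xi> x)) \<and>
       ereal (mi_power (\<lambda>j. 12 * \<kappa> y * \<beta> j y) \<nu> * phi \<delta> \<nu> * V_dual_norm D f)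
             * sup_norm D (\<lambda>x. inverse (a \<xi> x))
         \<le> ereal (mi_power (\<lambda>j. 12 * \<kappa> y * \<beta> j y) \<nu> * fact (mi_size \<nu>) powr \<delta> * V_dual_norm D f)
             * sup_norm D (\<lambda>x. inverse (a \<xi> x))))"
proof -
  have D: "open D" "bounded D" and Dne: "D \<noteq> {}"
    using assms(1) unfolding bounded_lipschitz_domain_def by auto
  note Dm = D_lebesgue[OF D]
  have da0: "da (\<lambda>_. 0) = a" using assms(5) unfolding mixed_partials_def by simp
  have daL: "da \<nu> y \<in> Linf D" if "\<nu> \<in> multi_indices" for \<nu> y
    using assms(5) that unfolding mixed_partials_def by blast
  have dapart: "has_partial (sup_norm D) (da \<nu>) j y (da (\<nu>(j := Suc (\<nu> j))) y)"
    if "\<nu> \<in> multi_indices" for \<nu> j y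
    using assms(5) that unfolding mixed_partials_def by blast
  have aL: "a y \<in> Linf D" for y using daL[OF multi_index_zero] by (simp add: da0)
  note eb = Linf_ess_bounded[OF daL] and eba = Linf_ess_bounded[OF aL]
  have a_lo: "a_min y \<le> a y x" if "x \<in> D" for x y using assms(4) that by blast
  have XH: "v \<in> H10 D" if "v \<in> X" for v using assms(11) that by blast
  have XH1: "v \<in> H1 D" if "v \<in> X" for v by (rule H10_H1[OF D XH[OF that]])
  \<comment> \<open>X need not be complete, so Riesz representation is applied on the closure. This
    is why the derivatives are asserted to lie in \<open>H10 D\<close> and not in X.\<close>
  define M where "M = closure (gemb D ` X)"
  define A where "A \<nu> y = (mul D (da \<nu> y) :: ('a, 'a) l2 \<Rightarrow>\<^sub>L _)" for \<nu> y
  define u0 where "u0 y = gemb D (u y)" for y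
  have A0: "A (\<lambda>_. 0) y = mul D (a y)" for y unfolding A_def da0 ..
  have subX: "subspace (gemb D ` X)"
  proof (rule subspaceI)
    have zX: "(\<lambda>x. 0) \<in> X" using assms(12) unfolding linear_subspace_def by blast
    have "gemb D (\<lambda>x. 0 * (0::real)) = 0 *\<^sub>R gemb D (\<lambda>x. 0)" by (rule H1_cmult(2)[OF D XH1[OF zX]])
    then have "gemb D (\<lambda>x. 0) = 0" by simp
    then show "0 \<in> gemb D ` X" using zX by (metis image_eqI)
    fix p q and c :: real assume "p \<in> gemb D ` X"
    then obtain v where v: "p = gemb D v" "v \<in> X" by blast
    have "(\<lambda>x. c * v x) \<in> X" using assms(12) v(2) unfolding linear_subspace_def by blast
    then show "c *\<^sub>R p \<in> gemb D ` X"
      unfolding v(1) H1_cmult(2)[OF D XH1[OF v(2)], symmetric] by (rule imageI)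
    assume "q \<in> gemb D ` X"
    then obtain w where w: "q = gemb D w" "w \<in> X" by blast
    have "(\<lambda>x. v x + w x) \<in> X" using assms(12) v(2) w(2) unfolding linear_subspace_def by blast
    then show "p + q \<in> gemb D ` X"
      unfolding v(1) w(1) H1_add(2)[OF D XH1[OF v(2)] XH1[OF w(2)], symmetric] by (rule imageI)
  qed
  have M_H10: "\<exists>v\<in>H10 D. gemb D v = z" if z: "z \<in> M" for z
  proof -
    obtain p where p: "\<forall>n. p n \<in> gemb D ` X" "p \<longlonglongrightarrow> z"
      using z unfolding M_def closure_sequential by blast
    then have "\<forall>n. \<exists>v. v \<in> X \<and> p n = gemb D v" by blast
    then obtain v where v: "\<And>n. v n \<in> X" "\<And>n. p n = gemb D (v n)" by metis
    have "(\<lambda>n. gemb D (v n)) \<longlonglongrightarrow> z" using p(2) unfolding v(2)[symmetric] by simp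
    then show ?thesis by (rule H10_closed[OF D XH[OF v(1)]])
  qed
  \<comment> \<open>Coercivity holds only for fields that vanish off D, so elements of M must be
    recognised as extensions by zero.\<close>
  have M_L2: "\<exists>g\<in>L2 D. emb D g = z" if z: "z \<in> M" for z
    using M_H10[OF z] wgrad_L2[OF D H10_H1[OF D]] unfolding gemb_def by blast
  have uX: "u y \<in> X" for y using assms(13) by blast
  have inner_f: "A (\<lambda>_. 0) y (u0 y) \<bullet> gemb D v = f v" if v: "v \<in> X" for y v
    unfolding A0 u0_def gemb_def
    using mul_emb_inner[OF Dm eba wgrad_L2[OF D XH1[OF uX]] wgrad_L2[OF D XH1[OF v]]] assms(14) v by simp
  have u0M: "u0 y \<in> M" for y unfolding M_def u0_def using uX closure_subset by blast
  interpret parametric_problem M A u0 a_min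
  proof
    show "subspace M" unfolding M_def by (rule subspace_closure[OF subX])
    show "closed M" unfolding M_def by simp
    show "A (\<lambda>_. 0) y v \<bullet> w = v \<bullet> A (\<lambda>_. 0) y w" for y v w
      unfolding A0 by (rule mul_sym[OF Dm eba])
    show "0 < a_min y" for y using assms(3) by blast
    show "u0 y \<in> M" for y by (rule u0M)
    show "((\<lambda>t. A \<nu> (y(j := t))) has_vector_derivative A (\<nu>(j := Suc (\<nu> j))) y) (at (y j))"
      if "\<nu> \<in> multi_indices" for \<nu> j y
      unfolding A_def
      by (rule mul_has_vector_derivative[OF D dapart[OF that] daL[OF that] daL[OF multi_index_Suc[OF that]]])
    show "a_min y * (norm v)\<^sup>2 \<le> A (\<lambda>_. 0) y v \<bullet> v" if vM: "v \<in> M" for y v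
    proof -
      obtain g where g: "g \<in> L2 D" "emb D g = v" using M_L2[OF vM] by blast
      have p: "0 < a_min y" using assms(3) by blast
      have "AE x in lebesgue_on D. 1 \<le> inverse (a_min y) * a y x"
        by (rule AE_I2) (use a_lo[of _ y] p in \<open>simp add: field_simps\<close>)
      from mul_inner_lower_bound[OF D eba g(1) this]
      show ?thesis using p unfolding g(2) A0 by (simp add: field_simps)
    qed
    show "A (\<lambda>_. 0) y (u0 y) \<bullet> v = A (\<lambda>_. 0) z (u0 z) \<bullet> v" if v: "v \<in> M" for y z v
    proof -
      \<comment> \<open>The equation is known for test functions in X, where both sides equal f;
        continuity extends the equality of the two sides to the closure.\<close>
      have "closed {v. A (\<lambda>_. 0) y (u0 y) \<bullet> v = A (\<lambda>_. 0) z (u0 z) \<bullet> v}"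
        by (intro closed_Collect_eq continuous_intros)
      moreover have "gemb D ` X \<subseteq> {v. A (\<lambda>_. 0) y (u0 y) \<bullet> v = A (\<lambda>_. 0) z (u0 z) \<bullet> v}"
        using inner_f by auto
      ultimately have "M \<subseteq> {v. A (\<lambda>_. 0) y (u0 y) \<bullet> v = A (\<lambda>_. 0) z (u0 z) \<bullet> v}"
        unfolding M_def by (intro closure_minimal)
      then show ?thesis using v by blast
    qed
  qed
  \<comment> \<open>Order zero must be the function u itself and not just some function with the
    same gradient, because \<open>mixed_partials\<close> demands equality there.\<close>
  define dU where "dU \<nu> y = (if \<nu> = (\<lambda>_. 0) then u y else SOME v. v \<in> H10 D \<and> gemb D v = du \<nu> y)" for \<nu> y
  have dU: "dU \<nu> y \<in> H10 D \<and> gemb D (dU \<nu> y) = du \<nu> y" if \<nu>: "\<nu> \<in> multi_indices" for \<nu> y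
  proof (cases "\<nu> = (\<lambda>_. 0)")
    case True
    then show ?thesis using XH[OF uX] by (simp add: dU_def du_zero u0_def)
  next
    case False
    have "\<exists>v. v \<in> H10 D \<and> gemb D v = du \<nu> y" using M_H10[OF du_mem[OF \<nu>]] by blast
    then have "(SOME v. v \<in> H10 D \<and> gemb D v = du \<nu> y) \<in> H10 D \<and>
        gemb D (SOME v. v \<in> H10 D \<and> gemb D v = du \<nu> y) = du \<nu> y" by (rule someI_ex)
    then show ?thesis using False unfolding dU_def by simp
  qed
  have "mixed_partials (H10 D) (\<lambda>v. ereal (V_norm D v)) u dU"
    unfolding mixed_partials_def
  proof (intro conjI ballI allI)
    show "dU (\<lambda>_. 0) = u" unfolding dU_def by simp
    fix \<nu> y assume \<nu>: "\<nu> \<in> multi_indices"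
    show "dU \<nu> y \<in> H10 D" using dU[OF \<nu>] by blast
    fix j
    have e: "\<nu>(j := Suc (\<nu> j)) \<in> multi_indices" by (rule multi_index_Suc[OF \<nu>])
    show "has_partial (\<lambda>v. ereal (V_norm D v)) (dU \<nu>) j y (dU (\<nu>(j := Suc (\<nu> j))) y)"
    proof (rule has_partial_V_norm[OF D])
      show "((\<lambda>t. gemb D (dU \<nu> (y(j := t)))) has_vector_derivative
          gemb D (dU (\<nu>(j := Suc (\<nu> j))) y)) (at (y j))"
        using du_deriv[OF \<nu>, of y j] dU[OF \<nu>] dU[OF e] by (simp only:)
    qed (use dU[OF \<nu>] dU[OF e] in blast)+
  qed
  moreover have "\<exists>U. open U \<and> y \<in> U \<and> (\<forall>\<xi> \<in> U. \<forall>\<nu> \<in> multi_indices.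
       ereal (V_norm D (dU \<nu> \<xi>))
         \<le> ereal (mi_power (\<lambda>j. 12 * \<kappa> y * \<beta> j y) \<nu> * phi \<delta> \<nu> * V_dual_norm D f)
             * sup_norm D (\<lambda>x. inverse (a \<xi> x)) \<and>
       ereal (mi_power (\<lambda>j. 12 * \<kappa> y * \<beta> j y) \<nu> * phi \<delta> \<nu> * V_dual_norm D f)
             * sup_norm D (\<lambda>x. inverse (a \<xi> x))
         \<le> ereal (mi_power (\<lambda>j. 12 * \<kappa> y * \<beta> j y) \<nu> * fact (mi_size \<nu>) powr \<delta> * V_dual_norm D f)
             * sup_norm D (\<lambda>x. inverse (a \<xi> x)))" for y
  proof -
    obtain U where U: "open U" "y \<in> U" and bound: "\<And>\<xi> \<nu>. \<xi> \<in> U \<Longrightarrow> \<nu> \<in> multi_indices \<Longrightarrow>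
        ess_norm D (\<lambda>x. inverse (a \<xi> x)) (da \<nu> \<xi>)
             \<le> ereal (\<kappa> y * mi_power (\<lambda>j. \<beta> j y) \<nu> * fact (mi_size \<nu>) powr \<delta>)"
      using assms(10) by meson
    have \<kappa>: "1 \<le> \<kappa> y" using assms(8) by blast
    have \<beta>: "0 \<le> \<beta> j y" for j using assms(9) less_imp_le by blast
    show ?thesis
    \<comment> \<open>The neighborhood of the hypothesis serves unchanged: the recursion runs at a
      single \<xi> and uses only the bounds there, with the constants \<kappa> and \<beta> frozen at
      y.\<close>
    proof (intro exI[of _ U] conjI ballI U)
      fix \<xi> \<nu> assume \<xi>: "\<xi> \<in> U" and \<nu>: "\<nu> \<in> multi_indices"
      have lo: "0 < a_min \<xi>" using assms(3) by blast
      have am: "a \<xi> \<in> borel_measurable (lebesgue_on D)" using aL unfolding Linf_def by blast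
      obtain N where N: "0 \<le> N" "sup_norm D (\<lambda>x. inverse (a \<xi> x)) = ereal N"
        "AE x in lebesgue_on D. 1 \<le> N * a \<xi> x"
        using sup_norm_inverse[OF D Dne am lo a_lo] by blast
      have inD: "AE x in lebesgue_on D. x \<in> D" using AE_space[of "lebesgue_on D"] by simp
      have apos: "AE x in lebesgue_on D. 0 < a \<xi> x"
        using inD by eventually_elim (use a_lo[of _ \<xi>] lo in fastforce)
      have weighted: "\<bar>A \<mu> \<xi> v \<bullet> w\<bar> \<le>
          \<kappa> y * mi_power (\<lambda>j. \<beta> j y) \<mu> * fact (mi_size \<mu>) powr \<delta> * energy \<xi> v * energy \<xi> w"
        if \<mu>: "\<mu> \<in> multi_indices" for \<mu> v w
      proof -
        let ?K = "\<kappa> y * mi_power (\<lambda>j. \<beta> j y) \<mu> * fact (mi_size \<mu>) powr \<delta>"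
        have K: "0 \<le> ?K" using \<kappa> mi_power_nonneg[of "\<lambda>j. \<beta> j y" \<mu>] \<beta> by simp
        have "AE x in lebesgue_on D. \<bar>da \<mu> \<xi> x\<bar> \<le> ?K * a \<xi> x"
          using apos ess_norm_AE[where D = D and v = "da \<mu> \<xi>" and w = "\<lambda>x. inverse (a \<xi> x)"]
        proof eventually_elim
          case (elim x)
          have "ereal (\<bar>da \<mu> \<xi> x\<bar> * inverse (a \<xi> x)) \<le> ereal ?K"
            using elim(2) bound[OF \<xi> \<mu>] by (rule order_trans)
          then show ?case using elim(1) by (simp add: field_simps)
        qed
        moreover have "AE x in lebesgue_on D. 0 \<le> a \<xi> x"
          using apos by eventually_elim simp
        ultimately show ?thesis
          unfolding energy_def A0 unfolding A_def
          by (rule mul_weighted_bound[OF Dm eb[OF \<mu>] eba K])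
      qed
      \<comment> \<open>The exchange of norms that brings in the sup norm of \<open>1 / a\<close>;
        it is applied to \<open>du \<nu> \<xi>\<close> and, inside \<open>e0\<close>, to
        \<open>u0 \<xi>\<close>.\<close>
      have lower: "norm z \<le> sqrt N * energy \<xi> z" if z: "z \<in> M" for z
      proof -
        obtain g where g: "g \<in> L2 D" "emb D g = z" using M_L2[OF z] by blast
        have "(norm z)\<^sup>2 \<le> N * (energy \<xi> z)\<^sup>2"
          using mul_inner_lower_bound[OF D eba g(1) N(3)] unfolding g(2) energy_sq[OF z] A0 .
        then have "(norm z)\<^sup>2 \<le> (sqrt N * energy \<xi> z)\<^sup>2" using N(1) by (simp add: power_mult_distrib)
        then show ?thesis
          by (rule power2_le_imp_le) (intro mult_nonneg_nonneg real_sqrt_ge_zero N(1) energy_nonneg z)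
      qed
      define F where "F = V_dual_norm D f"
      have F0: "0 \<le> F" unfolding F_def by (rule V_dual_bound(2)[OF D assms(2) XH[OF uX]])
      \<comment> \<open>Testing the equation with u gives the squared energy as
        \<open>f (u \<xi>)\<close>, at most F times the norm of u; \<open>lower\<close> returns one
        factor of energy, which cancels.\<close>
      have e0: "energy \<xi> (u0 \<xi>) \<le> sqrt N * F"
      proof -
        let ?e = "energy \<xi> (u0 \<xi>)"
        have "?e * ?e = f (u \<xi>)"
          using energy_sq[OF u0M, of \<xi> \<xi>] inner_f[OF uX, of \<xi> \<xi>] unfolding u0_def power2_eq_square by simp
        also have "\<dots> \<le> F * V_norm D (u \<xi>)"
          using V_dual_bound(1)[OF D assms(2) XH[OF uX], of \<xi>] unfolding F_def by linarith
        also have "V_norm D (u \<xi>) = norm (u0 \<xi>)" unfolding u0_def by (rule V_norm_eq[OF D XH1[OF uX]])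
        also have "F * norm (u0 \<xi>) \<le> F * (sqrt N * ?e)" by (intro mult_left_mono lower u0M F0)
        finally have *: "?e * ?e \<le> (sqrt N * F) * ?e" by (simp only: mult_ac)
        show ?thesis
        proof (cases "?e = 0")
          case True
          then show ?thesis using N(1) F0 by simp
        next
          case False
          then have "0 < ?e" using energy_nonneg[OF u0M, of \<xi> \<xi>] by simp
          with * show ?thesis by (rule mult_right_le_imp_le)
        qed
      qed
      let ?R = "mi_power (\<lambda>j. 12 * \<kappa> y * \<beta> j y) \<nu>"
      have R0: "0 \<le> ?R" using \<kappa> \<beta> by (intro mi_power_nonneg) simp
      have "V_norm D (dU \<nu> \<xi>) = norm (du \<nu> \<xi>)"
        using V_norm_eq[OF D H10_H1[OF D]] dU[OF \<nu>] by metis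
      also have "\<dots> \<le> sqrt N * energy \<xi> (du \<nu> \<xi>)" by (rule lower[OF du_mem[OF \<nu>]])
      also have "\<dots> \<le> sqrt N * (?R * phi \<delta> \<nu> * energy \<xi> (u0 \<xi>))"
        by (intro mult_left_mono energy_du_le assms(7) \<kappa> \<beta> weighted \<nu>) (use N(1) in auto)
      also have "\<dots> \<le> sqrt N * (?R * phi \<delta> \<nu> * (sqrt N * F))"
        using R0 phi_nonneg[of \<delta> \<nu>] N(1) by (intro mult_left_mono e0) auto
      \<comment> \<open>One root comes from leaving the energy norm at order \<nu>, the other from
        \<open>e0\<close>; together they give the first power of the sup norm of
        \<open>1 / a\<close>.\<close>
      also have "\<dots> = ?R * phi \<delta> \<nu> * F * (sqrt N * sqrt N)" by (simp only: mult_ac)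
      also have "sqrt N * sqrt N = N" using N(1) by simp
      finally have "V_norm D (dU \<nu> \<xi>) \<le> ?R * phi \<delta> \<nu> * F * N" .
      then show "ereal (V_norm D (dU \<nu> \<xi>)) \<le>
          ereal (?R * phi \<delta> \<nu> * V_dual_norm D f) * sup_norm D (\<lambda>x. inverse (a \<xi> x))"
        unfolding N(2) F_def by simp
      have "?R * phi \<delta> \<nu> * F * N \<le> ?R * fact (mi_size \<nu>) powr \<delta> * F * N"
        using R0 F0 N(1) by (intro mult_right_mono mult_left_mono phi_le) auto
      then show "ereal (?R * phi \<delta> \<nu> * V_dual_norm D f) * sup_norm D (\<lambda>x. inverse (a \<xi> x)) \<le>
          ereal (?R * fact (mi_size \<nu>) powr \<delta> * V_dual_norm D f) * sup_norm D (\<lambda>x. inverse (a \<xi> x))"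
        unfolding N(2) F_def by simp
    qed
  qed
  ultimately show ?thesis by blast
qed

end
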